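(* Let $X=\{X_n\}_{n\in\mathbb{N}}$ be a discrete parameter QID process generated by two discrete parameter ID processes $Y,Z$, normalized as in the context, and let $b_n,\Lambda_Y,\Lambda_Z$ and $f_n=b_n^{-1}\pi_n$ be as defined there. Then, assuming that $\{\int_{\partial U}f_n\,d\Lambda_Y\}_{n\in\mathbb{N}}$ is independent of $X$, $$\{X_n\}_{n\in\mathbb{N}}+\Big\{\int_{\partial U}f_n\,d\Lambda_Y\Big\}_{n\in\mathbb{N}}\stackrel{d}{=}\Big\{\int_{\partial U}f_n\,d\Lambda_Z\Big\}_{n\in\mathbb{N}}.$$ Moreover, if the associated QID random measure $\Lambda$ of $X$ exists, then the $f_n$ are $\Lambda$-integrable and $$\{X_n\}_{n\in\mathbb{N}}\stackrel{d}{=}\Big\{\int_{\partial U}f_n\,d\Lambda\Big\}_{n\in\mathbb{N}}.$$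
   Context: A process is ID (QID) if all its finite-dimensional distributions are ID (QID, i.e. have a Lévy–Khintchine representation with Lévy measure replaced by a quasi-Lévy type measure, defined below on $\mathbb{R}$ and analogously on $\mathbb{R}^d$). $Y,Z$ generate $X$ if $X+Y\stackrel{d}{=}Z$ with $Y$ independent of $X$. $\tau(x)=x$ if $\|x\|\le1$, $\tau(x)=x/\|x\|$ otherwise (on any Hilbert space). Normalization. $b_n>0$ are constants such that $\{b_nX_n\},\{b_nY_n\},\{b_nZ_n\}\in l_2$ a.s. An $l_2$-valued ID random element has triplet $(z,\mathcal{K},M)$ if its characteristic function at $y\in l_2$ is $\exp(i\langle z,y\rangle-\frac12\langle y,\mathcal{K}y\rangle+\int_{l_2}(e^{i\langle y,x\rangle}-1-i\langle\tau(x),y\rangle)M(dx))$, with $\mathcal{K}$ a covariance operator and $M$ a Lévy measure on $l_2$. $\{b_nX_n\}$ has characteristic function of this form with $z_0$, covariance operator $\mathcal{K}$ and a quasi-Lévy measure equal to the difference of two Lévy measures; without loss of generality (as throughout the paper's section) the generating processes are taken so that $\{b_nZ_n\}$ has triplet $(0,\mathcal{K},M^{(Z)})$ and $\{b_nY_n\}$ has triplet $(-z_0,0,M^{(Y)})$. Write $\mathcal{K}(y)=\sum_j\beta_j\langle e_j,y\rangle e_j$ with $\beta_j\ge0$, $\sum_j\beta_j<\infty$, $\{e_j\}$ orthonormal in $l_2$. Let $\partial U$ be the unit sphere of $l_2$ and $\pi_n$ the $n$-th coordinate projection on $l_2$. On $\mathcal{B}(\partial U)$ put $\nu_0=\|z_0\|\delta_{z_0/\|z_0\|}$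 if $z_0\ne0$, $\nu_0=0$ if $z_0=0$, and $\nu_1=\sum_j\beta_j\delta_{e_j}$. With $\Psi:\partial U\times(0,\infty)\to l_2\setminus\{0\}$, $\Psi(u,x)=xu$, let $F^{(Z)},F^{(Y)}$ be the unique measures on $\mathcal{B}(\partial U\times(0,\infty))$ with $M^{(Z)}=F^{(Z)}\circ\Psi^{-1}$, $M^{(Y)}=F^{(Y)}\circ\Psi^{-1}$, and $F^{(\cdot)}_A(B)=F^{(\cdot)}(A\times(B\cap(0,\infty)))$, which are Lévy measures on $\mathbb{R}$. $F_A$ is the quasi-Lévy type measure $F_A(B)=F^{(Z)}_A(B)-F^{(Y)}_A(B)$ for Borel $B$ with $0\notin\overline B$. (A quasi-Lévy type measure on $\mathbb{R}$ is a real function on Borel sets $B$ with $0\notin\overline B$ whose restriction to Borel sets disjoint from $(-r,r)$ is a finite signed measure for every $r>0$ and with $\int(1\wedge x^2)|\nu|(dx)<\infty$ for its total variation $|\nu|$; integrals are taken as $\int g\,d\nu^+-\int g\,d\nu^-$.) Random measures on $\mathcal{B}(\partial U)$: a QID (ID) random measure is a real process $\{\Lambda(A)\}$ with $\Lambda(A_n)$ independent for disjoint $A_n$, $\Lambda(\bigcup A_n)=\sum\Lambda(A_n)$ a.s., and each $\Lambda(A)$ QID (ID). $\Lambda$ has parameters $(m_0,m_1,H_\cdot)$ if $\mathbb{E}e^{i\theta\Lambda(A)}=\exp(i\theta m_0(A)-\frac{\theta^2}{2}m_1(A)+\int_{\mathbb{R}}(e^{i\theta x}-1-i\theta\tau(x))H_A(dx))$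 for all $A$. $\Lambda_Z$ and $\Lambda_Y$ are ID random measures with parameters $(0,\nu_1,F^{(Z)}_\cdot)$ and $(-\nu_0,0,F^{(Y)}_\cdot)$. The associated QID random measure $\Lambda$ of $X$ is the QID random measure with parameters $(\nu_0,\nu_1,F_\cdot)$, if it exists; its control measure is $\lambda(A)=\nu_0(A)+\nu_1(A)+\int(1\wedge x^2)F_A^{(Z)}(dx)+\int(1\wedge x^2)F_A^{(Y)}(dx)$. Control measures of $\Lambda_Z,\Lambda_Y$ are $\nu_1(A)+\int(1\wedge x^2)F_A^{(Z)}(dx)$ and $\nu_0(A)+\int(1\wedge x^2)F_A^{(Y)}(dx)$. Integral: for simple $f=\sum_jx_j\mathbf{1}_{A_j}$ (disjoint $A_j$), $\int_Af\,d\Lambda=\sum_jx_j\Lambda(A\cap A_j)$; a measurable $f$ is $\Lambda$-integrable if there are simple $g_k\to f$ a.e. with respect to the control measure with $\int_Ag_k\,d\Lambda$ convergent in probability for every $A\in\mathcal{B}(\partial U)$; $\int_Af\,d\Lambda$ is the limit. *)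

theory Defs
  imports "HOL-Probability.Probability"
begin

section \<open>The Hilbert space of square-summable sequences\<close>

typedef l2 = "{x :: nat \<Rightarrow> real. summable (\<lambda>n. (x n)\<^sup>2)}"
  morphisms l2_coord Abs_l2
  by (rule exI[of _ "\<lambda>_. 0"]) simp

setup_lifting type_definition_l2

lemma l2_eqI: "(\<And>n. l2_coord x n = l2_coord y n) \<Longrightarrow> x = y"
  by (simp add: l2_coord_inject[symmetric] fun_eq_iff)

lemma summable_l2_square: "summable (\<lambda>n. (l2_coord x n)\<^sup>2)"
  using l2_coord[of x] by simp

lemma square_summable_mult:
  fixes x y :: "nat \<Rightarrow> real"
  assumes "summable (\<lambda>n. (x n)\<^sup>2)" "summable (\<lambda>n. (y n)\<^sup>2)"
  shows "summable (\<lambda>n. x n * y n)"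
proof (rule summable_comparison_test')
  show "summable (\<lambda>n. (x n)\<^sup>2 + (y n)\<^sup>2)"
    by (intro summable_add assms)
  show "norm (x n * y n) \<le> (x n)\<^sup>2 + (y n)\<^sup>2" if "n \<ge> 0" for n
  proof -
    have "0 \<le> (\<bar>x n\<bar> - \<bar>y n\<bar>)\<^sup>2" and "0 \<le> (x n)\<^sup>2" and "0 \<le> (y n)\<^sup>2"
      by simp_all
    then have "2 * (\<bar>x n\<bar> * \<bar>y n\<bar>) \<le> (x n)\<^sup>2 + (y n)\<^sup>2"
      by (simp add: power2_diff)
    moreover have "0 \<le> \<bar>x n\<bar> * \<bar>y n\<bar>"
      by simp
    ultimately show ?thesis
      unfolding real_norm_def abs_mult by linarith
  qed
qed

lemma square_summable_add:
  fixes x y :: "nat \<Rightarrow> real"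
  assumes "summable (\<lambda>n. (x n)\<^sup>2)" "summable (\<lambda>n. (y n)\<^sup>2)"
  shows "summable (\<lambda>n. (x n + y n)\<^sup>2)"
proof -
  have "summable (\<lambda>n. (x n)\<^sup>2 + (y n)\<^sup>2 + 2 * (x n * y n))"
    by (intro summable_add assms summable_mult square_summable_mult)
  then show ?thesis
    by (simp add: power2_sum mult.assoc)
qed

lemma summable_l2_mult: "summable (\<lambda>n. l2_coord x n * l2_coord y n)"
  by (intro square_summable_mult summable_l2_square)

instantiation l2 :: real_vector
begin

lift_definition zero_l2 :: l2 is "\<lambda>_. 0"
  by simp

lift_definition plus_l2 :: "l2 \<Rightarrow> l2 \<Rightarrow> l2" is "\<lambda>x y n. x n + y n"
  by (rule square_summable_add)

lift_definition uminus_l2 :: "l2 \<Rightarrow> l2" is "\<lambda>x n. - x n"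
  by simp

lift_definition minus_l2 :: "l2 \<Rightarrow> l2 \<Rightarrow> l2" is "\<lambda>x y n. x n - y n"
  subgoal for x y using square_summable_add[of x "\<lambda>n. - y n"] by simp
  done

lift_definition scaleR_l2 :: "real \<Rightarrow> l2 \<Rightarrow> l2" is "\<lambda>c x n. c * x n"
  by (simp add: power_mult_distrib summable_mult)

instance
  by standard (transfer; simp add: fun_eq_iff algebra_simps)+

end

instantiation l2 :: real_inner
begin

definition inner_l2 :: "l2 \<Rightarrow> l2 \<Rightarrow> real" where
  "inner_l2 x y = (\<Sum>n. l2_coord x n * l2_coord y n)"

definition norm_l2 :: "l2 \<Rightarrow> real" where
  "norm_l2 x = sqrt (inner x x)"

definition sgn_l2 :: "l2 \<Rightarrow> l2" where
  "sgn_l2 x = x /\<^sub>R norm x"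

definition dist_l2 :: "l2 \<Rightarrow> l2 \<Rightarrow> real" where
  "dist_l2 x y = norm (x - y)"

definition uniformity_l2 :: "(l2 \<times> l2) filter" where
  "uniformity_l2 = (INF e\<in>{0<..}. principal {(x, y). dist x y < e})"

definition open_l2 :: "l2 set \<Rightarrow> bool" where
  "open_l2 U \<longleftrightarrow> (\<forall>x\<in>U. eventually (\<lambda>(x', y). x' = x \<longrightarrow> y \<in> U) uniformity)"

instance
proof
  fix x y z :: l2 and r :: real and U :: "l2 set"
  show "dist x y = norm (x - y)"
    by (rule dist_l2_def)
  show "sgn x = x /\<^sub>R norm x"
    by (rule sgn_l2_def)
  show "uniformity = (INF e\<in>{0<..}. principal {(x :: l2, y). dist x y < e})"
    by (rule uniformity_l2_def)
  show "open U \<longleftrightarrow> (\<forall>x\<in>U. \<forall>\<^sub>F (x', y) in uniformity. x' = x \<longrightarrow> y \<in> U)"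
    by (rule open_l2_def)
  show "inner x y = inner y x"
    by (simp add: inner_l2_def mult.commute)
  show "inner (x + y) z = inner x z + inner y z"
    by (simp add: inner_l2_def plus_l2.rep_eq ring_distribs suminf_add summable_l2_mult)
  show "inner (r *\<^sub>R x) y = r * inner x y"
    by (simp add: inner_l2_def scaleR_l2.rep_eq mult.assoc suminf_mult summable_l2_mult)
  show "0 \<le> inner x x"
    by (simp add: inner_l2_def suminf_nonneg summable_l2_mult)
  show "inner x x = 0 \<longleftrightarrow> x = 0"
  proof
    assume "inner x x = 0"
    then have "\<forall>n. l2_coord x n * l2_coord x n = 0"
      unfolding inner_l2_def by (subst (asm) suminf_eq_zero_iff) (simp_all add: summable_l2_mult)
    then show "x = 0"
      by (intro l2_eqI) (simp add: zero_l2.rep_eq)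
  qed (simp add: inner_l2_def zero_l2.rep_eq)
  show "norm x = sqrt (inner x x)"
    by (rule norm_l2_def)
qed

end

text \<open>
  A sequence that is square-summable almost surely is an \<open>l2\<close>-valued random element up to a
  null set, on which the value is set to zero.
\<close>

definition to_l2 :: "(nat \<Rightarrow> real) \<Rightarrow> l2" where
  "to_l2 x = (if summable (\<lambda>n. (x n)\<^sup>2) then Abs_l2 x else 0)"

definition l2_unit :: "nat \<Rightarrow> l2" where
  "l2_unit n = to_l2 (\<lambda>k. if k = n then 1 else 0)"

text \<open>Covariance operators on a Hilbert space are the positive self-adjoint trace-class operators.\<close>

definition covariance_operator :: "(l2 \<Rightarrow> l2) \<Rightarrow> bool" where
  "covariance_operator K \<longleftrightarrow>
     bounded_linear K \<and>
     (\<forall>x y. inner (K x) y = inner x (K y)) \<and>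
     (\<forall>x. 0 \<le> inner (K x) x) \<and>
     summable (\<lambda>n. inner (K (l2_unit n)) (l2_unit n))"


section \<open>Levy measures and quasi-Levy type measures\<close>

definition trunc :: "'v::real_normed_vector \<Rightarrow> 'v" where
  "trunc x = (if norm x \<le> 1 then x else x /\<^sub>R norm x)"

definition levy_measure :: "'v::real_normed_vector measure \<Rightarrow> bool" where
  "levy_measure M \<longleftrightarrow>
     sets M = sets borel \<and> emeasure M {0} = 0 \<and>
     (\<integral>\<^sup>+x. ennreal (min 1 ((norm x)\<^sup>2)) \<partial>M) < \<infinity>"

text \<open>
  Quasi-Levy type measures are needed both on the real line and on the spaces of real functions
  on a finite set, which are not types. They are therefore defined over a measurable space \<open>S\<close>
  with a norm \<open>N\<close> given as a function; a set is bounded away from zero if zero is not in its closure.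
\<close>

definition away_sets :: "'v measure \<Rightarrow> ('v \<Rightarrow> real) \<Rightarrow> 'v set set" where
  "away_sets S N = {B \<in> sets S. \<exists>r>0. \<forall>x\<in>B. r \<le> N x}"

text \<open>
  The positive part of the Jordan decomposition, extended to the whole sigma-algebra without mass
  at zero. The function \<open>ennreal\<close> maps negative numbers to zero. The negative part
  is the positive part of \<open>\<lambda>B. - \<nu> B\<close>, and the total variation is the sum of the two.
\<close>

definition jordan_pos :: "'v measure \<Rightarrow> ('v \<Rightarrow> real) \<Rightarrow> ('v set \<Rightarrow> real) \<Rightarrow> 'v measure" where
  "jordan_pos S N \<nu> =
     measure_of (space S) (sets S) (\<lambda>B. SUP C\<in>{C \<in> away_sets S N. C \<subseteq> B}. ennreal (\<nu> C))"

definition jordan_neg :: "'v measure \<Rightarrow> ('v \<Rightarrow> real) \<Rightarrow> ('v set \<Rightarrow> real) \<Rightarrow> 'v measure" where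
  "jordan_neg S N \<nu> = jordan_pos S N (\<lambda>B. - \<nu> B)"

definition quasi_levy_type :: "'v measure \<Rightarrow> ('v \<Rightarrow> real) \<Rightarrow> ('v set \<Rightarrow> real) \<Rightarrow> bool" where
  "quasi_levy_type S N \<nu> \<longleftrightarrow>
     (\<forall>r>0. \<forall>A :: nat \<Rightarrow> 'v set.
        (\<forall>n. A n \<in> sets S \<and> (\<forall>x\<in>A n. r \<le> N x)) \<and> disjoint_family A
          \<longrightarrow> (\<lambda>n. \<nu> (A n)) sums \<nu> (\<Union>n. A n)) \<and>
     (\<integral>\<^sup>+x. ennreal (min 1 ((N x)\<^sup>2)) \<partial>jordan_pos S N \<nu>) +
       (\<integral>\<^sup>+x. ennreal (min 1 ((N x)\<^sup>2)) \<partial>jordan_neg S N \<nu>) < \<infinity>"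

definition signed_integral ::
  "'v measure \<Rightarrow> ('v \<Rightarrow> real) \<Rightarrow> ('v set \<Rightarrow> real) \<Rightarrow> ('v \<Rightarrow> complex) \<Rightarrow> complex" where
  "signed_integral S N \<nu> g =
     (\<integral>x. g x \<partial>jordan_pos S N \<nu>) - (\<integral>x. g x \<partial>jordan_neg S N \<nu>)"


section \<open>Infinitely divisible and quasi-infinitely divisible laws\<close>

text \<open>
  The parameter \<open>s\<close> is the summation of the underlying vector space: \<open>sum\<close> if this is a type,
  \<open>fd_sum I\<close> for the space of real functions on \<open>I\<close>.
\<close>

definition infinitely_divisible ::
  "((nat \<Rightarrow> 'v) \<Rightarrow> nat set \<Rightarrow> 'v) \<Rightarrow> 'v measure \<Rightarrow> bool" where
  "infinitely_divisible s \<mu> \<longleftrightarrow>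
     (\<forall>n\<ge>1. \<exists>\<rho>. prob_space \<rho> \<and> sets \<rho> = sets \<mu> \<and>
        \<mu> = distr (Pi\<^sub>M {..<n} (\<lambda>_. \<rho>)) \<mu> (\<lambda>w. s w {..<n}))"

definition fd_space :: "'i set \<Rightarrow> ('i \<Rightarrow> real) measure" where
  "fd_space I = Pi\<^sub>M I (\<lambda>_. borel)"

definition fd_sum :: "'i set \<Rightarrow> (nat \<Rightarrow> 'i \<Rightarrow> real) \<Rightarrow> nat set \<Rightarrow> ('i \<Rightarrow> real)" where
  "fd_sum I w K = (\<lambda>i\<in>I. \<Sum>k\<in>K. w k i)"

definition fd_norm :: "'i set \<Rightarrow> ('i \<Rightarrow> real) \<Rightarrow> real" where
  "fd_norm I x = L2_set x I"

definition fd_inner :: "'i set \<Rightarrow> ('i \<Rightarrow> real) \<Rightarrow> ('i \<Rightarrow> real) \<Rightarrow> real" where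
  "fd_inner I x y = (\<Sum>i\<in>I. x i * y i)"

definition fd_trunc :: "'i set \<Rightarrow> ('i \<Rightarrow> real) \<Rightarrow> ('i \<Rightarrow> real)" where
  "fd_trunc I x = (if fd_norm I x \<le> 1 then x else (\<lambda>i\<in>I. x i / fd_norm I x))"

definition QID_real :: "real measure \<Rightarrow> bool" where
  "QID_real \<mu> \<longleftrightarrow>
     (\<exists>\<gamma> a \<nu>. 0 \<le> a \<and> quasi_levy_type borel norm \<nu> \<and>
        (\<forall>\<theta>. char \<mu> \<theta> =
           exp (\<i> * of_real (\<theta> * \<gamma>) - of_real (\<theta>\<^sup>2 / 2 * a) +
             signed_integral borel norm \<nu>
               (\<lambda>x. iexp (\<theta> * x) - 1 - \<i> * of_real (\<theta> * trunc x)))))"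

definition QID_fd :: "'i set \<Rightarrow> ('i \<Rightarrow> real) measure \<Rightarrow> bool" where
  "QID_fd I \<mu> \<longleftrightarrow>
     (\<exists>\<gamma> A \<nu>.
        (\<forall>i\<in>I. \<forall>j\<in>I. A i j = A j i) \<and>
        (\<forall>\<theta>. 0 \<le> fd_inner I \<theta> (\<lambda>i. \<Sum>j\<in>I. A i j * \<theta> j)) \<and>
        quasi_levy_type (fd_space I) (fd_norm I) \<nu> \<and>
        (\<forall>\<theta>. (\<integral>x. iexp (fd_inner I \<theta> x) \<partial>\<mu>) =
           exp (\<i> * of_real (fd_inner I \<theta> \<gamma>)
             - of_real (fd_inner I \<theta> (\<lambda>i. \<Sum>j\<in>I. A i j * \<theta> j) / 2)
             + signed_integral (fd_space I) (fd_norm I) \<nu>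
                 (\<lambda>x. iexp (fd_inner I \<theta> x) - 1 - \<i> * of_real (fd_inner I \<theta> (fd_trunc I x))))))"


section \<open>Processes\<close>

definition process :: "'a measure \<Rightarrow> ('i \<Rightarrow> 'a \<Rightarrow> real) \<Rightarrow> bool" where
  "process P X \<longleftrightarrow> prob_space P \<and> (\<forall>i. X i \<in> borel_measurable P)"

definition process_law :: "'a measure \<Rightarrow> ('i \<Rightarrow> 'a \<Rightarrow> real) \<Rightarrow> ('i \<Rightarrow> real) measure" where
  "process_law P X = distr P (Pi\<^sub>M UNIV (\<lambda>_. borel)) (\<lambda>\<omega> i. X i \<omega>)"

definition independent_processes ::
  "'a measure \<Rightarrow> ('i \<Rightarrow> 'a \<Rightarrow> real) \<Rightarrow> ('i \<Rightarrow> 'a \<Rightarrow> real) \<Rightarrow> bool" where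
  "independent_processes P X Y \<longleftrightarrow>
     prob_space.indep_var P
       (Pi\<^sub>M UNIV (\<lambda>_. borel)) (\<lambda>\<omega> i. X i \<omega>) (Pi\<^sub>M UNIV (\<lambda>_. borel)) (\<lambda>\<omega> i. Y i \<omega>)"

definition fd_law :: "'a measure \<Rightarrow> ('i \<Rightarrow> 'a \<Rightarrow> real) \<Rightarrow> 'i set \<Rightarrow> ('i \<Rightarrow> real) measure" where
  "fd_law P X I = distr P (fd_space I) (\<lambda>\<omega>. \<lambda>i\<in>I. X i \<omega>)"

definition ID_process :: "'a measure \<Rightarrow> ('i \<Rightarrow> 'a \<Rightarrow> real) \<Rightarrow> bool" where
  "ID_process P X \<longleftrightarrow>
     process P X \<and> (\<forall>I. finite I \<longrightarrow> infinitely_divisible (fd_sum I) (fd_law P X I))"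

definition QID_process :: "'a measure \<Rightarrow> ('i \<Rightarrow> 'a \<Rightarrow> real) \<Rightarrow> bool" where
  "QID_process P X \<longleftrightarrow> process P X \<and> (\<forall>I. finite I \<longrightarrow> QID_fd I (fd_law P X I))"

definition generate ::
  "'a measure \<Rightarrow> ('i \<Rightarrow> 'a \<Rightarrow> real) \<Rightarrow> ('i \<Rightarrow> 'a \<Rightarrow> real) \<Rightarrow> 'b measure \<Rightarrow> ('i \<Rightarrow> 'b \<Rightarrow> real) \<Rightarrow> bool"
where
  "generate P X Y P' Z \<longleftrightarrow>
     independent_processes P X Y \<and> process_law P (\<lambda>i \<omega>. X i \<omega> + Y i \<omega>) = process_law P' Z"

definition has_triplet ::
  "'a measure \<Rightarrow> ('a \<Rightarrow> l2) \<Rightarrow> l2 \<Rightarrow> (l2 \<Rightarrow> l2) \<Rightarrow> l2 measure \<Rightarrow> bool" where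
  "has_triplet P W z K M \<longleftrightarrow>
     prob_space P \<and> W \<in> borel_measurable P \<and> infinitely_divisible sum (distr P borel W) \<and>
     covariance_operator K \<and> levy_measure M \<and>
     (\<forall>y. (\<integral>\<omega>. iexp (inner y (W \<omega>)) \<partial>P) =
        exp (\<i> * of_real (inner z y) - of_real (inner y (K y) / 2) +
          (\<integral>x. iexp (inner y x) - 1 - \<i> * of_real (inner (trunc x) y) \<partial>M)))"


section \<open>Random measures\<close>

definition random_measure :: "'u measure \<Rightarrow> 'a measure \<Rightarrow> ('u set \<Rightarrow> 'a \<Rightarrow> real) \<Rightarrow> bool" where
  "random_measure S P \<Lambda> \<longleftrightarrow>
     prob_space P \<and> (\<forall>A\<in>sets S. \<Lambda> A \<in> borel_measurable P) \<and>
     (\<forall>A :: nat \<Rightarrow> 'u set. range A \<subseteq> sets S \<and> disjoint_family A \<longrightarrow>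
        prob_space.indep_vars P (\<lambda>_. borel) (\<lambda>n. \<Lambda> (A n)) UNIV \<and>
        (AE \<omega> in P. (\<lambda>n. \<Lambda> (A n) \<omega>) sums \<Lambda> (\<Union>n. A n) \<omega>))"

definition ID_random_measure ::
  "'u measure \<Rightarrow> 'a measure \<Rightarrow> ('u set \<Rightarrow> 'a \<Rightarrow> real) \<Rightarrow>
   ('u set \<Rightarrow> real) \<Rightarrow> ('u set \<Rightarrow> real) \<Rightarrow> ('u set \<Rightarrow> real measure) \<Rightarrow> bool" where
  "ID_random_measure S P \<Lambda> m0 m1 H \<longleftrightarrow>
     random_measure S P \<Lambda> \<and>
     (\<forall>A\<in>sets S.
        infinitely_divisible sum (distr P borel (\<Lambda> A)) \<and> levy_measure (H A) \<and>
        (\<forall>\<theta>. char (distr P borel (\<Lambda> A)) \<theta> =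
           exp (\<i> * of_real (\<theta> * m0 A) - of_real (\<theta>\<^sup>2 / 2 * m1 A) +
             (\<integral>x. iexp (\<theta> * x) - 1 - \<i> * of_real (\<theta> * trunc x) \<partial>H A))))"

definition QID_random_measure ::
  "'u measure \<Rightarrow> 'a measure \<Rightarrow> ('u set \<Rightarrow> 'a \<Rightarrow> real) \<Rightarrow>
   ('u set \<Rightarrow> real) \<Rightarrow> ('u set \<Rightarrow> real) \<Rightarrow> ('u set \<Rightarrow> real set \<Rightarrow> real) \<Rightarrow> bool" where
  "QID_random_measure S P \<Lambda> m0 m1 H \<longleftrightarrow>
     random_measure S P \<Lambda> \<and>
     (\<forall>A\<in>sets S.
        QID_real (distr P borel (\<Lambda> A)) \<and> quasi_levy_type borel norm (H A) \<and>
        (\<forall>\<theta>. char (distr P borel (\<Lambda> A)) \<theta> =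
           exp (\<i> * of_real (\<theta> * m0 A) - of_real (\<theta>\<^sup>2 / 2 * m1 A) +
             signed_integral borel norm (H A)
               (\<lambda>x. iexp (\<theta> * x) - 1 - \<i> * of_real (\<theta> * trunc x)))))"

definition converges_in_prob :: "'a measure \<Rightarrow> (nat \<Rightarrow> 'a \<Rightarrow> real) \<Rightarrow> ('a \<Rightarrow> real) \<Rightarrow> bool" where
  "converges_in_prob P W L \<longleftrightarrow>
     L \<in> borel_measurable P \<and>
     (\<forall>\<epsilon>>0. (\<lambda>k. measure P {\<omega> \<in> space P. \<epsilon> < \<bar>W k \<omega> - L \<omega>\<bar>}) \<longlonglongrightarrow> 0)"

text \<open>A simple function is written in its canonical form, as a sum over its values.\<close>

definition rm_simple_integral ::
  "'u measure \<Rightarrow> ('u set \<Rightarrow> 'a \<Rightarrow> real) \<Rightarrow> 'u set \<Rightarrow> ('u \<Rightarrow> real) \<Rightarrow> 'a \<Rightarrow> real" where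
  "rm_simple_integral S \<Lambda> A g \<omega> =
     (\<Sum>x\<in>g ` space S. x * \<Lambda> (A \<inter> (g -` {x} \<inter> space S)) \<omega>)"

text \<open>The control measure \<open>\<kappa>\<close> also supplies the measurable space on which \<open>\<Lambda>\<close> is defined.\<close>

definition rm_approximation ::
  "'u measure \<Rightarrow> 'a measure \<Rightarrow> ('u set \<Rightarrow> 'a \<Rightarrow> real) \<Rightarrow> ('u \<Rightarrow> real) \<Rightarrow> (nat \<Rightarrow> 'u \<Rightarrow> real) \<Rightarrow> bool"
where
  "rm_approximation \<kappa> P \<Lambda> f g \<longleftrightarrow>
     (\<forall>k. simple_function \<kappa> (g k)) \<and>
     (AE u in \<kappa>. (\<lambda>k. g k u) \<longlonglongrightarrow> f u) \<and>
     (\<forall>A\<in>sets \<kappa>. \<exists>L. converges_in_prob P (\<lambda>k. rm_simple_integral \<kappa> \<Lambda> A (g k)) L)"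

definition rm_integrable ::
  "'u measure \<Rightarrow> 'a measure \<Rightarrow> ('u set \<Rightarrow> 'a \<Rightarrow> real) \<Rightarrow> ('u \<Rightarrow> real) \<Rightarrow> bool" where
  "rm_integrable \<kappa> P \<Lambda> f \<longleftrightarrow> f \<in> borel_measurable \<kappa> \<and> (\<exists>g. rm_approximation \<kappa> P \<Lambda> f g)"

text \<open>The integral is a random variable determined up to a null set; some version is chosen.\<close>

definition rm_integral ::
  "'u measure \<Rightarrow> 'a measure \<Rightarrow> ('u set \<Rightarrow> 'a \<Rightarrow> real) \<Rightarrow> 'u set \<Rightarrow> ('u \<Rightarrow> real) \<Rightarrow> 'a \<Rightarrow> real" where
  "rm_integral \<kappa> P \<Lambda> A f =
     (SOME L. \<exists>g. rm_approximation \<kappa> P \<Lambda> f g \<and>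
        converges_in_prob P (\<lambda>k. rm_simple_integral \<kappa> \<Lambda> A (g k)) L)"


section \<open>Measures on the unit sphere\<close>

abbreviation unit_sphere :: "l2 set" where
  "unit_sphere \<equiv> sphere 0 1"

definition sphere_space :: "l2 measure" where
  "sphere_space = restrict_space borel unit_sphere"

definition polar_measure :: "l2 measure \<Rightarrow> (l2 \<times> real) measure \<Rightarrow> bool" where
  "polar_measure M F \<longleftrightarrow>
     sets F = sets (restrict_space borel (unit_sphere \<times> {0<..})) \<and>
     M = distr F borel (\<lambda>(u, x). x *\<^sub>R u)"

definition radial_measure :: "(l2 \<times> real) measure \<Rightarrow> l2 set \<Rightarrow> real measure" where
  "radial_measure F A = measure_of UNIV (sets borel) (\<lambda>B. emeasure F (A \<times> (B \<inter> {0<..})))"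

definition radial_difference ::
  "(l2 \<times> real) measure \<Rightarrow> (l2 \<times> real) measure \<Rightarrow> l2 set \<Rightarrow> real set \<Rightarrow> real" where
  "radial_difference FZ FY A B = measure (radial_measure FZ A) B - measure (radial_measure FY A) B"

definition nu0 :: "l2 \<Rightarrow> l2 set \<Rightarrow> real" where
  "nu0 z A = (if z = 0 then 0 else norm z * indicator A (z /\<^sub>R norm z))"

definition nu1 :: "(nat \<Rightarrow> real) \<Rightarrow> (nat \<Rightarrow> l2) \<Rightarrow> l2 set \<Rightarrow> real" where
  "nu1 \<beta> e A = (\<Sum>j. \<beta> j * indicator A (e j))"

definition jump_mass :: "(l2 \<times> real) measure \<Rightarrow> l2 set \<Rightarrow> ennreal" where
  "jump_mass F A = (\<integral>\<^sup>+x. ennreal (min 1 (x\<^sup>2)) \<partial>radial_measure F A)"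

definition control_Z ::
  "(nat \<Rightarrow> real) \<Rightarrow> (nat \<Rightarrow> l2) \<Rightarrow> (l2 \<times> real) measure \<Rightarrow> l2 measure" where
  "control_Z \<beta> e FZ = measure_of unit_sphere (sets sphere_space)
     (\<lambda>A. ennreal (nu1 \<beta> e A) + jump_mass FZ A)"

definition control_Y :: "l2 \<Rightarrow> (l2 \<times> real) measure \<Rightarrow> l2 measure" where
  "control_Y z FY = measure_of unit_sphere (sets sphere_space)
     (\<lambda>A. ennreal (nu0 z A) + jump_mass FY A)"

definition control_X ::
  "l2 \<Rightarrow> (nat \<Rightarrow> real) \<Rightarrow> (nat \<Rightarrow> l2) \<Rightarrow> (l2 \<times> real) measure \<Rightarrow> (l2 \<times> real) measure \<Rightarrow> l2 measure"
where
  "control_X z \<beta> e FZ FY = measure_of unit_sphere (sets sphere_space)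
     (\<lambda>A. ennreal (nu0 z A) + ennreal (nu1 \<beta> e A) + jump_mass FZ A + jump_mass FY A)"

end

theory Submission
  imports Defs
begin

text \<open>
  The function \<open>f n\<close> reads off the \<open>n\<close>-th coordinate of a point of \<open>l2\<close> and divides it by \<open>b n\<close>. A linear
  combination of finitely many \<open>f n\<close> is therefore a linear functional \<open>u \<mapsto> \<langle>y, u\<rangle>\<close> on the unit sphere, and
  the expectation of \<open>iexp\<close> of the corresponding combination of integrals is the exponential of a sum of
  three terms: a multiple of \<open>\<langle>y, z0\<rangle>\<close>, from the point mass in the direction of the drift \<open>z0\<close>, a multiple
  of \<open>\<langle>y, K y\<rangle>\<close>, from the point masses at the eigenvectors of \<open>K\<close>, and a jump part. In polar coordinates
  the jump part is the integral against the Levy measure on \<open>l2\<close>, since truncation acts on the radius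
  only. This is the characteristic function given by the triplet. Hence the integrals with respect
  to \<open>\<Lambda>\<^sub>Y\<close> have the law of \<open>Y\<close> and those with respect to \<open>\<Lambda>\<^sub>Z\<close> the law of \<open>Z\<close>; replacing \<open>Y\<close> in
  \<open>X + Y\<close> by a process of the same law that is also independent of \<open>X\<close> gives the first claim. For \<open>\<Lambda>\<close>
  the exponent is the difference of the exponents for \<open>Z\<close> and \<open>Y\<close>. The exponential of this difference is
  the characteristic function of \<open>X\<close>, because that of \<open>Y\<close> has no zeros.

  Three facts carry this. First, the joint characteristic function of integrals of bounded functions
  (\<open>expectation_iexp_rm_integral\<close>). It contains that the integral is well defined: its definition
  admits every approximation by simple functions that converges almost everywhere and has
  convergent integrals over all sets, and two such approximations could a priori
  have different limits. A gliding hump argument excludes this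
  (\<open>simple_integral_limit_zero_if_AE_tendsto_zero\<close>). It rests on additivity and on the convergence in
  probability of integrals of boundedly convergent simple functions, which hold in the
  quasi-infinitely divisible case as in the infinitely divisible one.
  Second, laws on sequence space are determined by the characteristic functions of their
  finite-dimensional linear combinations (\<open>process_law_eqI_char\<close>), which is derived from the
  one-dimensional uniqueness theorem. Third, the integral against the Jordan decomposition of a
  difference of two Levy measures is the difference of the integrals
  (\<open>signed_integral_levy_difference\<close>).
\<close>

section \<open>Convergence in probability\<close>

text \<open>
  The usual translation-invariant metric for convergence in probability is
  \<open>l0_size P (\<lambda>\<omega>. U \<omega> - V \<omega>)\<close>. Because it satisfies the triangle inequality, the
  \<open>\<epsilon>\<close>-arguments below need no splitting of events.
\<close>

definition l0_size :: "'a measure \<Rightarrow> ('a \<Rightarrow> real) \<Rightarrow> real" where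
  "l0_size P W = (\<integral>\<omega>. min 1 \<bar>W \<omega>\<bar> \<partial>P)"

lemma l0_size_cong_AE:
  assumes "AE \<omega> in P. U \<omega> = V \<omega>"
    and [measurable]: "U \<in> borel_measurable P" "V \<in> borel_measurable P"
  shows "l0_size P U = l0_size P V"
  unfolding l0_size_def using assms(1) by (intro integral_cong_AE) auto

lemma l0_size_nonneg: "0 \<le> l0_size P W"
  unfolding l0_size_def by (intro integral_nonneg_AE) auto

lemma l0_size_uminus: "l0_size P (\<lambda>\<omega>. - W \<omega>) = l0_size P W"
  by (simp add: l0_size_def)

lemma l0_size_tendsto_zero_le:
  assumes "\<And>k. l0_size P (W k) \<le> r k" "r \<longlonglongrightarrow> 0"
  shows "(\<lambda>k. l0_size P (W k)) \<longlonglongrightarrow> 0"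
proof (rule tendsto_sandwich[OF _ _ tendsto_const assms(2)])
  show "\<forall>\<^sub>F k in sequentially. 0 \<le> l0_size P (W k)"
    by (simp add: l0_size_nonneg)
  show "\<forall>\<^sub>F k in sequentially. l0_size P (W k) \<le> r k"
    by (simp add: assms(1))
qed

context prob_space
begin

lemma integrable_min_one:
  assumes [measurable]: "W \<in> borel_measurable M"
  shows "integrable M (\<lambda>\<omega>. min 1 \<bar>W \<omega>\<bar> :: real)"
  by (rule integrable_const_bound[where B = 1]) auto

lemma l0_size_triangle:
  assumes [measurable]: "U \<in> borel_measurable M" "V \<in> borel_measurable M"
  shows "l0_size M (\<lambda>\<omega>. U \<omega> + V \<omega>) \<le> l0_size M U + l0_size M V"
proof -
  have "l0_size M (\<lambda>\<omega>. U \<omega> + V \<omega>) \<le> (\<integral>\<omega>. min 1 \<bar>U \<omega>\<bar> + min 1 \<bar>V \<omega>\<bar> \<partial>M)"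
    unfolding l0_size_def
    by (intro integral_mono Bochner_Integration.integrable_add integrable_min_one) auto
  also have "\<dots> = l0_size M U + l0_size M V"
    unfolding l0_size_def by (intro Bochner_Integration.integral_add integrable_min_one) auto
  finally show ?thesis .
qed

lemma l0_size_sum:
  assumes "finite J" "\<And>i. i \<in> J \<Longrightarrow> V i \<in> borel_measurable M"
  shows "l0_size M (\<lambda>\<omega>. \<Sum>i\<in>J. V i \<omega>) \<le> (\<Sum>i\<in>J. l0_size M (V i))"
  using assms
proof (induction J)
  case (insert j J)
  have "(\<lambda>\<omega>. \<Sum>i\<in>J. V i \<omega>) \<in> borel_measurable M"
    using insert.prems by (intro borel_measurable_sum) auto
  then show ?case
    using l0_size_triangle[of "V j" "\<lambda>\<omega>. \<Sum>i\<in>J. V i \<omega>"] insert by simp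
qed (simp add: l0_size_def)

lemma l0_size_scale:
  assumes [measurable]: "W \<in> borel_measurable M"
  shows "l0_size M (\<lambda>\<omega>. a * W \<omega>) \<le> (1 + \<bar>a\<bar>) * l0_size M W"
proof -
  have "min 1 \<bar>a * x\<bar> \<le> (1 + \<bar>a\<bar>) * min 1 \<bar>x\<bar>" for x :: real
    by (cases "\<bar>x\<bar> \<le> 1") (auto simp: abs_mult min_def algebra_simps)
  then have "l0_size M (\<lambda>\<omega>. a * W \<omega>) \<le> (\<integral>\<omega>. (1 + \<bar>a\<bar>) * min 1 \<bar>W \<omega>\<bar> \<partial>M)"
    unfolding l0_size_def
    by (intro integral_mono integrable_mult_right integrable_min_one) auto
  then show ?thesis by (simp add: l0_size_def)
qed

lemma l0_size_triangle_diff: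
  assumes [measurable]: "U \<in> borel_measurable M" "V \<in> borel_measurable M" "W \<in> borel_measurable M"
  shows "l0_size M (\<lambda>\<omega>. U \<omega> - W \<omega>) \<le> l0_size M (\<lambda>\<omega>. U \<omega> - V \<omega>) + l0_size M (\<lambda>\<omega>. V \<omega> - W \<omega>)"
  using l0_size_triangle[of "\<lambda>\<omega>. U \<omega> - V \<omega>" "\<lambda>\<omega>. V \<omega> - W \<omega>"] by simp

lemma AE_zero_if_l0_size_zero:
  assumes [measurable]: "W \<in> borel_measurable M" and "l0_size M W = 0"
  shows "AE \<omega> in M. W \<omega> = 0"
proof -
  have "AE \<omega> in M. min 1 \<bar>W \<omega>\<bar> = 0"
    using assms(2) integrable_min_one[OF assms(1)] unfolding l0_size_def
    by (subst (asm) integral_nonneg_eq_0_iff_AE) auto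
  then show ?thesis by eventually_elim (auto simp: min_def split: if_splits)
qed

lemma l0_size_tendsto_zero_if_AE:
  assumes [measurable]: "\<And>k. W k \<in> borel_measurable M"
    and "AE \<omega> in M. (\<lambda>k. W k \<omega>) \<longlonglongrightarrow> 0"
  shows "(\<lambda>k. l0_size M (W k)) \<longlonglongrightarrow> 0"
proof -
  have "(\<lambda>k. \<integral>\<omega>. min 1 \<bar>W k \<omega>\<bar> \<partial>M) \<longlonglongrightarrow> (\<integral>\<omega>. 0 \<partial>M)"
  proof (rule integral_dominated_convergence[where w = "\<lambda>_. 1"])
    show "AE \<omega> in M. (\<lambda>k. min 1 \<bar>W k \<omega>\<bar>) \<longlonglongrightarrow> 0"
      using assms(2)
    proof eventually_elim
      case (elim \<omega>)
      then have "(\<lambda>k. min 1 \<bar>W k \<omega>\<bar>) \<longlonglongrightarrow> min 1 \<bar>0\<bar>"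
        by (intro tendsto_intros)
      then show ?case by simp
    qed
  qed auto
  then show ?thesis by (simp add: l0_size_def)
qed

lemma l0_size_le_prob:
  assumes [measurable]: "W \<in> borel_measurable M" and "0 \<le> \<epsilon>"
  shows "l0_size M W \<le> \<epsilon> + prob {\<omega> \<in> space M. \<epsilon> < \<bar>W \<omega>\<bar>}"
proof -
  define A where "A = {\<omega> \<in> space M. \<epsilon> < \<bar>W \<omega>\<bar>}"
  have A [measurable]: "A \<in> events"
    unfolding A_def by measurable
  have int: "integrable M (indicator A :: _ \<Rightarrow> real)"
    by (simp add: emeasure_eq_measure)
  have "l0_size M W \<le> (\<integral>\<omega>. \<epsilon> + indicator A \<omega> \<partial>M)"
    unfolding l0_size_def
  proof (intro integral_mono integrable_min_one Bochner_Integration.integrable_add int)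
    show "min 1 \<bar>W \<omega>\<bar> \<le> \<epsilon> + indicator A \<omega>" if "\<omega> \<in> space M" for \<omega>
      using that assms(2) by (auto simp: indicator_def A_def)
  qed auto
  also have "\<dots> = \<epsilon> + prob A"
    using int A[THEN sets.sets_into_space]
    by (subst Bochner_Integration.integral_add) (auto simp: prob_space Int_absorb2)
  finally show ?thesis
    by (simp add: A_def)
qed

lemma prob_le_l0_size:
  assumes [measurable]: "W \<in> borel_measurable M" and "0 < \<epsilon>"
  shows "prob {\<omega> \<in> space M. \<epsilon> < \<bar>W \<omega>\<bar>} \<le> l0_size M W / min 1 \<epsilon>"
proof -
  have "prob {\<omega> \<in> space M. \<epsilon> < \<bar>W \<omega>\<bar>} \<le> prob {\<omega> \<in> space M. min 1 \<epsilon> \<le> min 1 \<bar>W \<omega>\<bar>}"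
    by (intro finite_measure_mono) auto
  also have "\<dots> \<le> l0_size M W / min 1 \<epsilon>"
    unfolding l0_size_def using assms(2)
    by (intro integral_Markov_inequality_measure[where A = "{}"] integrable_min_one) auto
  finally show ?thesis .
qed

lemma converges_in_prob_iff_l0_size:
  assumes [measurable]: "\<And>k. W k \<in> borel_measurable M"
  shows "converges_in_prob M W L \<longleftrightarrow>
    L \<in> borel_measurable M \<and> (\<lambda>k. l0_size M (\<lambda>\<omega>. W k \<omega> - L \<omega>)) \<longlonglongrightarrow> 0"
proof safe
  assume conv: "converges_in_prob M W L"
  then show [measurable]: "L \<in> borel_measurable M"
    by (simp add: converges_in_prob_def)
  show "(\<lambda>k. l0_size M (\<lambda>\<omega>. W k \<omega> - L \<omega>)) \<longlonglongrightarrow> 0"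
  proof (rule LIMSEQ_I)
    fix r :: real assume r: "0 < r"
    have "(\<lambda>k. prob {\<omega> \<in> space M. r / 2 < \<bar>W k \<omega> - L \<omega>\<bar>}) \<longlonglongrightarrow> 0"
      using conv half_gt_zero[OF r] unfolding converges_in_prob_def by blast
    from order_tendstoD(2)[OF this half_gt_zero[OF r]] obtain k0
      where k0: "\<And>k. k \<ge> k0 \<Longrightarrow> prob {\<omega> \<in> space M. r / 2 < \<bar>W k \<omega> - L \<omega>\<bar>} < r / 2"
      by (auto simp only: eventually_sequentially)
    have "l0_size M (\<lambda>\<omega>. W k \<omega> - L \<omega>) < r" if "k \<ge> k0" for k
      using l0_size_le_prob[of "\<lambda>\<omega>. W k \<omega> - L \<omega>" "r / 2"] k0[OF that] r by simp
    then show "\<exists>k0. \<forall>k\<ge>k0. norm (l0_size M (\<lambda>\<omega>. W k \<omega> - L \<omega>) - 0) < r"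
      using l0_size_nonneg[of M] by auto
  qed
next
  assume [measurable]: "L \<in> borel_measurable M"
    and lim: "(\<lambda>k. l0_size M (\<lambda>\<omega>. W k \<omega> - L \<omega>)) \<longlonglongrightarrow> 0"
  have "(\<lambda>k. prob {\<omega> \<in> space M. \<epsilon> < \<bar>W k \<omega> - L \<omega>\<bar>}) \<longlonglongrightarrow> 0" if "0 < \<epsilon>" for \<epsilon>
  proof (rule tendsto_sandwich[OF _ _ tendsto_const])
    show "\<forall>\<^sub>F k in sequentially. prob {\<omega> \<in> space M. \<epsilon> < \<bar>W k \<omega> - L \<omega>\<bar>}
        \<le> l0_size M (\<lambda>\<omega>. W k \<omega> - L \<omega>) / min 1 \<epsilon>"
      using prob_le_l0_size that by (intro always_eventually allI) auto
    show "(\<lambda>k. l0_size M (\<lambda>\<omega>. W k \<omega> - L \<omega>) / min 1 \<epsilon>) \<longlonglongrightarrow> 0"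
      using tendsto_divide[OF lim tendsto_const, of "min 1 \<epsilon>"] that by auto
  qed auto
  then show "converges_in_prob M W L"
    by (simp add: converges_in_prob_def)
qed

text \<open>
  A subsequence whose increments have summable sizes converges almost surely, since then the truncated
  increments have a finite sum almost surely; the Cauchy property carries its limit to the whole sequence.
\<close>

lemma convergent_in_prob_if_Cauchy:
  assumes [measurable]: "\<And>k. W k \<in> borel_measurable M"
    and Cauchy: "\<And>\<epsilon>. 0 < \<epsilon> \<Longrightarrow> \<exists>N. \<forall>k\<ge>N. \<forall>l\<ge>N. l0_size M (\<lambda>\<omega>. W k \<omega> - W l \<omega>) < \<epsilon>"
  shows "\<exists>L. converges_in_prob M W L"
proof -
  have "\<forall>j. \<exists>N. \<forall>k\<ge>N. \<forall>l\<ge>N. l0_size M (\<lambda>\<omega>. W k \<omega> - W l \<omega>) < (1/2) ^ j"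
    using Cauchy by simp
  then obtain N where N: "\<And>j k l. k \<ge> N j \<Longrightarrow> l \<ge> N j \<Longrightarrow> l0_size M (\<lambda>\<omega>. W k \<omega> - W l \<omega>) < (1/2) ^ j"
    by metis
  \<comment> \<open>The sum makes \<open>r\<close> dominate \<open>N\<close> at \<open>j\<close> and at the next index; the summand \<open>j\<close> makes it unbounded.\<close>
  define r where "r j = (\<Sum>i\<le>j. N i) + j" for j
  have r_ge: "N j \<le> r j" "j \<le> r j" "N j \<le> r (Suc j)" for j
    by (auto simp: r_def intro: le_trans[OF member_le_sum[of j "{..j}" N]])
  define V where "V j \<omega> = W (r (Suc j)) \<omega> - W (r j) \<omega>" for j \<omega>
  have [measurable]: "V j \<in> borel_measurable M" for j
    unfolding V_def by measurable
  have V_small: "l0_size M (V j) \<le> (1/2) ^ j" for j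
    unfolding V_def using N[OF r_ge(3) r_ge(1)] by (intro less_imp_le) simp
  have "AE \<omega> in M. summable (\<lambda>j. min 1 \<bar>V j \<omega>\<bar>)"
  proof -
    have "(\<integral>\<^sup>+\<omega>. (\<Sum>j. ennreal (min 1 \<bar>V j \<omega>\<bar>)) \<partial>M) = (\<Sum>j. \<integral>\<^sup>+\<omega>. ennreal (min 1 \<bar>V j \<omega>\<bar>) \<partial>M)"
      by (intro nn_integral_suminf) auto
    also have "\<dots> = (\<Sum>j. ennreal (l0_size M (V j)))"
      unfolding l0_size_def by (intro suminf_cong nn_integral_eq_integral integrable_min_one) auto
    also have "\<dots> \<le> (\<Sum>j. ennreal ((1/2) ^ j))"
      by (intro suminf_le ennreal_leI V_small) auto
    also have "\<dots> = ennreal (\<Sum>j. (1/2) ^ j)"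
      by (intro suminf_ennreal2) (auto intro: summable_geometric)
    also have "\<dots> < \<infinity>" by simp
    finally have "AE \<omega> in M. (\<Sum>j. ennreal (min 1 \<bar>V j \<omega>\<bar>)) \<noteq> \<infinity>"
      by (intro nn_integral_PInf_AE) auto
    then show ?thesis
      by eventually_elim (auto intro!: summable_suminf_not_top)
  qed
  then have conv: "AE \<omega> in M. convergent (\<lambda>j. W (r j) \<omega>)"
  proof eventually_elim
    case (elim \<omega>)
    then have "(\<lambda>j. min 1 \<bar>V j \<omega>\<bar>) \<longlonglongrightarrow> 0"
      by (rule summable_LIMSEQ_zero)
    then have "\<forall>\<^sub>F j in sequentially. min 1 \<bar>V j \<omega>\<bar> < 1"
      by (rule order_tendstoD) simp
    then have "\<forall>\<^sub>F j in sequentially. norm (V j \<omega>) \<le> min 1 \<bar>V j \<omega>\<bar>"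
      by eventually_elim auto
    then have "summable (\<lambda>j. V j \<omega>)"
      using elim by (rule summable_comparison_test_ev)
    then have "convergent (\<lambda>n. \<Sum>j<n. V j \<omega>)"
      by (rule summable_iff_convergent[THEN iffD1])
    moreover have "(\<Sum>j<n. V j \<omega>) = W (r n) \<omega> - W (r 0) \<omega>" for n
      unfolding V_def by (induction n) auto
    ultimately have "convergent (\<lambda>n. W (r n) \<omega> - W (r 0) \<omega>)" by simp
    then show ?case
      using convergent_add[OF _ convergent_const[of "W (r 0) \<omega>"]] by force
  qed
  define L where "L \<omega> = lim (\<lambda>j. W (r j) \<omega>)" for \<omega>
  have [measurable]: "L \<in> borel_measurable M"
    unfolding L_def by measurable
  have "AE \<omega> in M. (\<lambda>j. W (r j) \<omega> - L \<omega>) \<longlonglongrightarrow> 0"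
    using conv unfolding L_def
    by eventually_elim (simp add: LIM_zero convergent_LIMSEQ_iff)
  then have sub: "(\<lambda>j. l0_size M (\<lambda>\<omega>. W (r j) \<omega> - L \<omega>)) \<longlonglongrightarrow> 0"
    by (intro l0_size_tendsto_zero_if_AE) auto
  have "(\<lambda>k. l0_size M (\<lambda>\<omega>. W k \<omega> - L \<omega>)) \<longlonglongrightarrow> 0"
  proof (rule LIMSEQ_I)
    fix e :: real assume "0 < e"
    then obtain n where n: "\<And>k l. k \<ge> n \<Longrightarrow> l \<ge> n \<Longrightarrow> l0_size M (\<lambda>\<omega>. W k \<omega> - W l \<omega>) < e / 2"
      using Cauchy[of "e / 2"] by auto
    obtain j0 where j0: "\<And>j. j \<ge> j0 \<Longrightarrow> l0_size M (\<lambda>\<omega>. W (r j) \<omega> - L \<omega>) < e / 2"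
      using order_tendstoD(2)[OF sub, of "e / 2"] \<open>0 < e\<close>
      by (auto simp: eventually_sequentially)
    have "l0_size M (\<lambda>\<omega>. W k \<omega> - L \<omega>) < e" if "k \<ge> n" for k
      using l0_size_triangle_diff[of "W k" "W (r (max n j0))" L] n[OF that, of "r (max n j0)"]
        j0[of "max n j0"] r_ge(2)[of "max n j0"] by auto
    then show "\<exists>n. \<forall>k\<ge>n. norm (l0_size M (\<lambda>\<omega>. W k \<omega> - L \<omega>) - 0) < e"
      using l0_size_nonneg[of M] by auto
  qed
  then show ?thesis
    using converges_in_prob_iff_l0_size[of W L] by auto
qed

lemma converges_in_prob_diff:
  assumes [measurable]: "\<And>k. U k \<in> borel_measurable M" "\<And>k. V k \<in> borel_measurable M"
    and U: "converges_in_prob M U K" and V: "converges_in_prob M V L"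
  shows "converges_in_prob M (\<lambda>k \<omega>. U k \<omega> - V k \<omega>) (\<lambda>\<omega>. K \<omega> - L \<omega>)"
proof -
  have [measurable]: "K \<in> borel_measurable M" "L \<in> borel_measurable M"
    using U V by (auto simp: converges_in_prob_def)
  have "l0_size M (\<lambda>\<omega>. (U k \<omega> - V k \<omega>) - (K \<omega> - L \<omega>)) \<le>
      l0_size M (\<lambda>\<omega>. U k \<omega> - K \<omega>) + l0_size M (\<lambda>\<omega>. V k \<omega> - L \<omega>)" for k
    using l0_size_triangle[of "\<lambda>\<omega>. U k \<omega> - K \<omega>" "\<lambda>\<omega>. - (V k \<omega> - L \<omega>)"]
    by (simp add: l0_size_uminus[of M "\<lambda>\<omega>. V k \<omega> - L \<omega>", simplified] algebra_simps)
  moreover have "(\<lambda>k. l0_size M (\<lambda>\<omega>. U k \<omega> - K \<omega>) + l0_size M (\<lambda>\<omega>. V k \<omega> - L \<omega>)) \<longlonglongrightarrow> 0 + 0"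
    using U V by (intro tendsto_add) (simp_all add: converges_in_prob_iff_l0_size)
  ultimately have "(\<lambda>k. l0_size M (\<lambda>\<omega>. (U k \<omega> - V k \<omega>) - (K \<omega> - L \<omega>))) \<longlonglongrightarrow> 0"
    by (intro l0_size_tendsto_zero_le) simp_all
  then show ?thesis
    by (simp add: converges_in_prob_iff_l0_size)
qed

lemma converges_in_prob_cong_AE:
  assumes [measurable]: "\<And>k. U k \<in> borel_measurable M" "\<And>k. V k \<in> borel_measurable M"
    and eq: "\<And>k. AE \<omega> in M. U k \<omega> = V k \<omega>" and U: "converges_in_prob M U L"
  shows "converges_in_prob M V L"
proof -
  have [measurable]: "L \<in> borel_measurable M"
    using U by (auto simp: converges_in_prob_def)
  have "l0_size M (\<lambda>\<omega>. V k \<omega> - L \<omega>) = l0_size M (\<lambda>\<omega>. U k \<omega> - L \<omega>)" for k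
    using eq[of k] by (intro l0_size_cong_AE) (auto elim: eventually_mono)
  with U show ?thesis
    by (simp add: converges_in_prob_iff_l0_size)
qed

lemma expectation_iexp_tendsto:
  assumes [measurable]: "\<And>k. W k \<in> borel_measurable M" "L \<in> borel_measurable M"
    and lim: "(\<lambda>k. l0_size M (\<lambda>\<omega>. W k \<omega> - L \<omega>)) \<longlonglongrightarrow> 0"
  shows "(\<lambda>k. \<integral>\<omega>. iexp (W k \<omega>) \<partial>M) \<longlonglongrightarrow> (\<integral>\<omega>. iexp (L \<omega>) \<partial>M)"
proof -
  have bound: "norm (iexp a - iexp b) \<le> 2 * min 1 \<bar>a - b\<bar>" for a b :: real
  proof -
    have "iexp a - iexp b = iexp b * (iexp (a - b) - 1)"
      by (simp add: right_diff_distrib exp_add[symmetric] del: of_real_diff) (simp add: algebra_simps)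
    then have "norm (iexp a - iexp b) = norm (iexp (a - b) - 1)"
      by (simp add: norm_mult)
    moreover have "norm (iexp (a - b) - 1) \<le> \<bar>a - b\<bar>"
      using iexp_approx1[of "a - b" 0] by simp
    moreover have "norm (iexp (a - b) - 1) \<le> 2"
      using norm_triangle_ineq4[of "iexp (a - b)" 1] by simp
    moreover have "x \<le> 2 * min 1 y" if "x \<le> y" "x \<le> 2" "0 \<le> y" for x y :: real
      using that by (auto simp: min_def)
    ultimately show ?thesis by simp
  qed
  have "norm ((\<integral>\<omega>. iexp (W k \<omega>) \<partial>M) - (\<integral>\<omega>. iexp (L \<omega>) \<partial>M)) \<le> 2 * l0_size M (\<lambda>\<omega>. W k \<omega> - L \<omega>)" for k
  proof -
    have "(\<integral>\<omega>. iexp (W k \<omega>) \<partial>M) - (\<integral>\<omega>. iexp (L \<omega>) \<partial>M) = (\<integral>\<omega>. iexp (W k \<omega>) - iexp (L \<omega>) \<partial>M)"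
      by (simp add: integrable_iexp)
    also have "norm \<dots> \<le> (\<integral>\<omega>. norm (iexp (W k \<omega>) - iexp (L \<omega>)) \<partial>M)"
      by (rule integral_norm_bound)
    also have "\<dots> \<le> (\<integral>\<omega>. 2 * min 1 \<bar>W k \<omega> - L \<omega>\<bar> \<partial>M)"
      by (intro integral_mono integrable_mult_right integrable_min_one integrable_norm
          Bochner_Integration.integrable_diff integrable_iexp bound) auto
    finally show ?thesis by (simp add: l0_size_def)
  qed
  then show ?thesis
    by (intro LIM_zero_cancel[OF Lim_null_comparison[OF _ tendsto_mult_right_zero[OF lim]]]
        always_eventually allI)
qed

text \<open>
  By Levy's continuity theorem the laws converge weakly to the point mass at zero, and
  \<open>min 1 \<bar>x\<bar>\<close> is a bounded continuous test function.
\<close>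

lemma l0_size_tendsto_zero_if_char:
  assumes [measurable]: "\<And>k. W k \<in> borel_measurable M"
    and "\<And>t. (\<lambda>k. char (distr M borel (W k)) t) \<longlonglongrightarrow> 1"
  shows "(\<lambda>k. l0_size M (W k)) \<longlonglongrightarrow> 0"
proof -
  have rd: "real_distribution (distr M borel (W k))" for k
    by (intro real_distribution_distr) auto
  have rd0: "real_distribution (return borel (0::real))"
    unfolding real_distribution_def real_distribution_axioms_def
    by (auto intro!: prob_space_return)
  have "weak_conv_m (\<lambda>k. distr M borel (W k)) (return borel 0)"
    using rd rd0 assms(2) by (intro levy_continuity) (auto simp: char_def integral_return)
  then have "(\<lambda>k. \<integral>x. min 1 \<bar>x\<bar> \<partial>distr M borel (W k)) \<longlonglongrightarrow> (\<integral>x. min 1 \<bar>x\<bar> \<partial>return borel (0::real))"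
    by (rule weak_conv_imp_integral_bdd_continuous_conv[OF rd rd0, where B = 1])
      (auto intro!: continuous_intros)
  then show ?thesis
    by (simp add: l0_size_def integral_distr integral_return)
qed

end

section \<open>Random measures with an exponent functional\<close>

lemma (in prob_space) indep_vars_reindex:
  assumes h: "inj_on h J" and ind: "indep_vars (\<lambda>_. N) X (h ` J)"
  shows "indep_vars (\<lambda>_. N) (\<lambda>j. X (h j)) J"
  unfolding indep_vars_def2 indep_sets_def
proof (intro conjI ballI allI impI)
  show "random_variable N (X (h j))" if "j \<in> J" for j
    using ind that by (auto simp: indep_vars_def2)
  show "{X (h j) -` A \<inter> space M |A. A \<in> sets N} \<subseteq> events" if "j \<in> J" for j
    using ind that by (auto simp: indep_vars_def2 dest!: measurable_sets)
next
  fix K A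
  assume K: "K \<subseteq> J" "K \<noteq> {}" "finite K"
    and A: "A \<in> (\<Pi> j\<in>K. {X (h j) -` A \<inter> space M |A. A \<in> sets N})"
  define B where "B n = A (the_inv_into J h n)" for n
  have B: "B (h j) = A j" if "j \<in> K" for j
    using that K h by (auto simp: B_def the_inv_into_f_f)
  have "prob (\<Inter>n\<in>h ` K. B n) = (\<Prod>n\<in>h ` K. prob (B n))"
    using ind K A by (intro indep_setsD[where I = "h ` J"]) (auto simp: indep_vars_def2 B)
  then show "prob (\<Inter>j\<in>K. A j) = (\<Prod>j\<in>K. prob (A j))"
    using inj_on_subset[OF h K(1)] by (simp add: prod.reindex B)
qed

text \<open>
  The value \<open>E h\<close> stands for the exponent of the characteristic function of \<open>\<integral>h d\<Lambda>\<close> at 1. The theory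
  of the integral uses the Levy-Khintchine form of this exponent only through the two properties
  below: additivity over disjoint supports, which mirrors independence over disjoint sets, and
  dominated continuity up to null sets of the control measure. It is thereby the same for
  infinitely divisible and for quasi-infinitely divisible random measures.
\<close>

locale exponent_functional =
  fixes \<kappa> :: "'u measure" and E :: "('u \<Rightarrow> real) \<Rightarrow> complex"
  assumes E_add: "\<And>g h C. \<lbrakk>g \<in> borel_measurable \<kappa>; h \<in> borel_measurable \<kappa>;
      \<And>u. u \<in> space \<kappa> \<Longrightarrow> \<bar>g u\<bar> \<le> C; \<And>u. u \<in> space \<kappa> \<Longrightarrow> \<bar>h u\<bar> \<le> C;
      \<And>u. u \<in> space \<kappa> \<Longrightarrow> g u = 0 \<or> h u = 0\<rbrakk> \<Longrightarrow> E (\<lambda>u. g u + h u) = E g + E h"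
    and E_tendsto: "\<And>g h C. \<lbrakk>\<And>k. g k \<in> borel_measurable \<kappa>; h \<in> borel_measurable \<kappa>;
      \<And>k u. u \<in> space \<kappa> \<Longrightarrow> \<bar>g k u\<bar> \<le> C; AE u in \<kappa>. (\<lambda>k::nat. g k u) \<longlonglongrightarrow> h u\<rbrakk> \<Longrightarrow>
      (\<lambda>k. E (g k)) \<longlonglongrightarrow> E h"
begin

lemma E_zero: "E (\<lambda>_. 0) = 0"
  using E_add[of "\<lambda>_. 0" "\<lambda>_. 0" 0] by simp

lemma E_sum_indicator:
  assumes "finite J" "\<And>j. j \<in> J \<Longrightarrow> B j \<in> sets \<kappa>" "disjoint_family_on B J"
  shows "E (\<lambda>u. \<Sum>j\<in>J. c j * indicator (B j) u) = (\<Sum>j\<in>J. E (\<lambda>u. c j * indicator (B j) u))"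
  using assms
proof (induction J)
  case empty
  then show ?case by (simp add: E_zero)
next
  case (insert i J)
  have [measurable]: "B i \<in> sets \<kappa>" "\<And>j. j \<in> J \<Longrightarrow> B j \<in> sets \<kappa>"
    using insert.prems by auto
  have "\<bar>\<Sum>j\<in>J. c j * indicator (B j) u\<bar> \<le> \<bar>c i\<bar> + (\<Sum>j\<in>J. \<bar>c j\<bar>)" for u
  proof -
    have "\<bar>\<Sum>j\<in>J. c j * indicator (B j) u\<bar> \<le> (\<Sum>j\<in>J. \<bar>c j * indicator (B j) u\<bar>)"
      by (rule sum_abs)
    also have "\<dots> \<le> (\<Sum>j\<in>J. \<bar>c j\<bar>)"
      by (intro sum_mono) (auto simp: indicator_def)
    finally show ?thesis by simp
  qed
  moreover have "\<bar>c i * indicator (B i) u\<bar> \<le> \<bar>c i\<bar> + (\<Sum>j\<in>J. \<bar>c j\<bar>)" for u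
    by (auto simp: indicator_def intro!: sum_nonneg add_increasing2)
  moreover have "c i * indicator (B i) u = 0 \<or> (\<Sum>j\<in>J. c j * indicator (B j) u) = 0" for u
  proof (cases "u \<in> B i")
    case True
    then have "u \<notin> B j" if "j \<in> J" for j
      using that insert.prems(2) insert.hyps(2) by (auto simp: disjoint_family_on_def)
    then show ?thesis by (simp add: indicator_def)
  qed simp
  ultimately have "E (\<lambda>u. c i * indicator (B i) u + (\<Sum>j\<in>J. c j * indicator (B j) u)) =
      E (\<lambda>u. c i * indicator (B i) u) + E (\<lambda>u. \<Sum>j\<in>J. c j * indicator (B j) u)"
    by (intro E_add[where C = "\<bar>c i\<bar> + (\<Sum>j\<in>J. \<bar>c j\<bar>)"]) measurable
  moreover have "disjoint_family_on B J"
    using insert.prems(2) by (auto simp: disjoint_family_on_def)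
  ultimately show ?case
    using insert.IH insert.prems(1) by (simp only: sum.insert[OF insert.hyps]) simp
qed

end

locale random_integrator = exponent_functional \<kappa> E + prob_space P
  for \<kappa> :: "'u measure" and E and P :: "'a measure" +
  fixes \<Lambda> :: "'u set \<Rightarrow> 'a \<Rightarrow> real"
  assumes random_measure: "random_measure \<kappa> P \<Lambda>"
    and char_\<Lambda>: "\<And>A t. A \<in> sets \<kappa> \<Longrightarrow>
      char (distr P borel (\<Lambda> A)) t = exp (E (\<lambda>u. t * indicator A u))"
begin

lemma measurable_\<Lambda> [measurable]: "A \<in> sets \<kappa> \<Longrightarrow> \<Lambda> A \<in> borel_measurable P"
  using random_measure by (simp add: random_measure_def)

lemma \<Lambda>_empty: "AE \<omega> in P. \<Lambda> {} \<omega> = 0"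
proof -
  have "AE \<omega> in P. (\<lambda>n::nat. \<Lambda> {} \<omega>) sums \<Lambda> (\<Union>n::nat. {}) \<omega>"
    using random_measure unfolding random_measure_def
    by (auto dest!: spec[where x = "\<lambda>_. {}"] simp: disjoint_family_on_def)
  then show ?thesis
  proof eventually_elim
    case (elim \<omega>)
    then have "(\<lambda>n::nat. \<Lambda> {} \<omega>) \<longlonglongrightarrow> 0"
      using summable_LIMSEQ_zero sums_summable by blast
    then show ?case by (simp add: LIMSEQ_const_iff)
  qed
qed

text \<open>A finite disjoint family is continued by empty sets to the sequences that define a random measure.\<close>

lemma \<Lambda>_finite_disjoint_family:
  assumes J: "finite J" and B: "\<And>j. j \<in> J \<Longrightarrow> B j \<in> sets \<kappa>" and disj: "disjoint_family_on B J"
  shows indep_\<Lambda>: "indep_vars (\<lambda>_. borel) (\<lambda>j. \<Lambda> (B j)) J"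
    and \<Lambda>_UN: "AE \<omega> in P. \<Lambda> (\<Union>j\<in>J. B j) \<omega> = (\<Sum>j\<in>J. \<Lambda> (B j) \<omega>)"
proof -
  obtain h where h: "bij_betw h J {0..<card J}"
    using ex_bij_betw_finite_nat[OF J] by blast
  define g where "g = the_inv_into J h"
  have g: "bij_betw g {0..<card J} J"
    unfolding g_def using h by (rule bij_betw_the_inv_into)
  define A where "A n = (if n < card J then B (g n) else {})" for n
  have gJ: "g n \<in> J" if "n < card J" for n
    using g that by (auto simp: bij_betw_def)
  have A_sets: "range A \<subseteq> sets \<kappa>"
    using B gJ by (auto simp: A_def)
  have A_disj: "disjoint_family A"
    unfolding disjoint_family_on_def
  proof (intro ballI impI)
    fix m n :: nat assume "m \<noteq> n"
    show "A m \<inter> A n = {}"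
    proof (cases "m < card J \<and> n < card J")
      case True
      then have "g m \<noteq> g n"
        using g \<open>m \<noteq> n\<close> by (auto simp: bij_betw_def inj_on_def)
      then show ?thesis
        using True disj gJ by (auto simp: A_def disjoint_family_on_def)
    qed (auto simp: A_def)
  qed
  have Ah: "A (h j) = B j" if "j \<in> J" for j
    using h that by (auto simp: A_def g_def bij_betw_def the_inv_into_f_f)
  from A_sets A_disj have ind: "indep_vars (\<lambda>_. borel) (\<lambda>n. \<Lambda> (A n)) UNIV"
    and sums: "AE \<omega> in P. (\<lambda>n. \<Lambda> (A n) \<omega>) sums \<Lambda> (\<Union>n. A n) \<omega>"
    using random_measure by (auto simp: random_measure_def)
  have "indep_vars (\<lambda>_. borel) (\<lambda>j. \<Lambda> (A (h j))) J"
    using indep_vars_reindex[of h J borel "\<lambda>n. \<Lambda> (A n)"] h indep_vars_subset[OF ind subset_UNIV]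
    by (simp add: bij_betw_def o_def)
  then show "indep_vars (\<lambda>_. borel) (\<lambda>j. \<Lambda> (B j)) J"
    by (rule indep_vars_cong[THEN iffD1, rotated -1]) (auto simp: Ah)
  have UN: "(\<Union>n. A n) = (\<Union>j\<in>J. B j)"
  proof -
    have "(\<Union>n. A n) = (\<Union>n\<in>{0..<card J}. B (g n))"
      by (auto simp: A_def split: if_splits)
    also have "\<dots> = (\<Union>j\<in>g ` {0..<card J}. B j)" by simp
    finally show ?thesis
      by (simp only: bij_betw_imp_surj_on[OF g])
  qed
  show "AE \<omega> in P. \<Lambda> (\<Union>j\<in>J. B j) \<omega> = (\<Sum>j\<in>J. \<Lambda> (B j) \<omega>)"
    using sums \<Lambda>_empty
  proof eventually_elim
    case (elim \<omega>)
    then have "(\<lambda>n. \<Lambda> (A n) \<omega>) sums (\<Sum>n\<in>{0..<card J}. \<Lambda> (A n) \<omega>)"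
      by (intro sums_finite) (auto simp: A_def)
    then have "\<Lambda> (\<Union>n. A n) \<omega> = (\<Sum>n\<in>{0..<card J}. \<Lambda> (A n) \<omega>)"
      using elim(1) sums_unique2 by blast
    also have "\<dots> = (\<Sum>n\<in>{0..<card J}. \<Lambda> (B (g n)) \<omega>)"
      by (intro sum.cong) (auto simp: A_def)
    also have "\<dots> = (\<Sum>j\<in>J. \<Lambda> (B j) \<omega>)"
      using g by (rule sum.reindex_bij_betw)
    finally show ?case by (simp add: UN)
  qed
qed

lemma \<Lambda>_Un:
  assumes "A \<in> sets \<kappa>" "B \<in> sets \<kappa>" "A \<inter> B = {}"
  shows "AE \<omega> in P. \<Lambda> (A \<union> B) \<omega> = \<Lambda> A \<omega> + \<Lambda> B \<omega>"
proof -
  have "AE \<omega> in P. \<Lambda> (\<Union>j\<in>UNIV. if j then A else B) \<omega> = (\<Sum>j\<in>UNIV. \<Lambda> (if j then A else B) \<omega>)"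
    using assms by (intro \<Lambda>_UN) (auto simp: disjoint_family_on_def)
  then show ?thesis
    by (simp add: UNIV_bool Un_commute add.commute)
qed

abbreviation simple_integral :: "'u set \<Rightarrow> ('u \<Rightarrow> real) \<Rightarrow> 'a \<Rightarrow> real" where
  "simple_integral \<equiv> rm_simple_integral \<kappa> \<Lambda>"

lemma measurable_simple_integral [measurable]:
  assumes "A \<in> sets \<kappa>" "simple_function \<kappa> d"
  shows "simple_integral A d \<in> borel_measurable P"
  unfolding rm_simple_integral_def
  using assms simple_functionD(2)[OF assms(2)]
  by (intro borel_measurable_sum borel_measurable_times borel_measurable_const measurable_\<Lambda>) auto

text \<open>
  The canonical form of a simple function may be refined: this is how integrals of two simple
  functions are brought to a common partition.
\<close>

lemma simple_integral_partition:
  assumes \<phi>: "simple_function \<kappa> \<phi>" and A: "A \<in> sets \<kappa>"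
    and d: "\<And>u. u \<in> space \<kappa> \<Longrightarrow> d u = r (\<phi> u)"
  shows "AE \<omega> in P. simple_integral A d \<omega> =
    (\<Sum>j\<in>\<phi> ` space \<kappa>. r j * \<Lambda> (A \<inter> (\<phi> -` {j} \<inter> space \<kappa>)) \<omega>)"
proof -
  define J where "J = \<phi> ` space \<kappa>"
  define B where "B j = A \<inter> (\<phi> -` {j} \<inter> space \<kappa>)" for j
  have J: "finite J" and B [measurable]: "B j \<in> sets \<kappa>" for j
    using simple_functionD[OF \<phi>] A by (auto simp: J_def B_def)
  have rJ: "d ` space \<kappa> = r ` J"
    using d by (auto simp: J_def image_iff)
  have "AE \<omega> in P. \<forall>x\<in>r ` J. \<Lambda> (\<Union>j\<in>{j \<in> J. r j = x}. B j) \<omega> = (\<Sum>j | j \<in> J \<and> r j = x. \<Lambda> (B j) \<omega>)"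
    using J by (intro AE_finite_allI \<Lambda>_UN B) (auto simp: disjoint_family_on_def B_def)
  then show ?thesis
  proof eventually_elim
    case (elim \<omega>)
    have "A \<inter> (d -` {x} \<inter> space \<kappa>) = (\<Union>j\<in>{j \<in> J. r j = x}. B j)" for x
      using d by (auto simp: B_def J_def)
    then have "x * \<Lambda> (A \<inter> (d -` {x} \<inter> space \<kappa>)) \<omega> = (\<Sum>j | j \<in> J \<and> r j = x. r j * \<Lambda> (B j) \<omega>)"
      if "x \<in> r ` J" for x
      using bspec[OF elim that] by (simp only:) (auto simp: sum_distrib_left intro!: sum.cong)
    then have "simple_integral A d \<omega> = (\<Sum>x\<in>r ` J. \<Sum>j | j \<in> J \<and> r j = x. r j * \<Lambda> (B j) \<omega>)"
      unfolding rm_simple_integral_def rJ by (intro sum.cong) auto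
    also have "\<dots> = (\<Sum>j\<in>J. r j * \<Lambda> (B j) \<omega>)"
      using J by (intro sum.group) auto
    finally show ?case by (simp add: J_def B_def)
  qed
qed

lemma simple_integral_lincomb2:
  assumes "simple_function \<kappa> d1" "simple_function \<kappa> d2" "A \<in> sets \<kappa>"
  shows "AE \<omega> in P. simple_integral A (\<lambda>u. a * d1 u + b * d2 u) \<omega> =
    a * simple_integral A d1 \<omega> + b * simple_integral A d2 \<omega>"
proof -
  define \<phi> where "\<phi> u = (d1 u, d2 u)" for u
  have \<phi>: "simple_function \<kappa> \<phi>"
    unfolding \<phi>_def using assms by (intro simple_function_Pair)
  note part = simple_integral_partition[OF \<phi> assms(3)]
  have "AE \<omega> in P. simple_integral A (\<lambda>u. a * d1 u + b * d2 u) \<omega> =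
      (\<Sum>j\<in>\<phi> ` space \<kappa>. (a * fst j + b * snd j) * \<Lambda> (A \<inter> (\<phi> -` {j} \<inter> space \<kappa>)) \<omega>)"
    by (rule part) (simp add: \<phi>_def)
  moreover have "AE \<omega> in P. simple_integral A d1 \<omega> =
      (\<Sum>j\<in>\<phi> ` space \<kappa>. fst j * \<Lambda> (A \<inter> (\<phi> -` {j} \<inter> space \<kappa>)) \<omega>)"
    by (rule part) (simp add: \<phi>_def)
  moreover have "AE \<omega> in P. simple_integral A d2 \<omega> =
      (\<Sum>j\<in>\<phi> ` space \<kappa>. snd j * \<Lambda> (A \<inter> (\<phi> -` {j} \<inter> space \<kappa>)) \<omega>)"
    by (rule part) (simp add: \<phi>_def)
  ultimately show ?thesis
    by eventually_elim (simp add: sum_distrib_left sum.distrib[symmetric] algebra_simps)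
qed

lemma simple_integral_diff:
  assumes "simple_function \<kappa> d1" "simple_function \<kappa> d2" "A \<in> sets \<kappa>"
  shows "AE \<omega> in P. simple_integral A (\<lambda>u. d1 u - d2 u) \<omega> =
    simple_integral A d1 \<omega> - simple_integral A d2 \<omega>"
  using simple_integral_lincomb2[OF assms, of 1 "-1"] by simp

lemma simple_integral_lincomb:
  assumes I: "finite I" and d: "\<And>i. i \<in> I \<Longrightarrow> simple_function \<kappa> (d i)" and A: "A \<in> sets \<kappa>"
  shows "AE \<omega> in P. simple_integral A (\<lambda>u. \<Sum>i\<in>I. c i * d i u) \<omega> =
    (\<Sum>i\<in>I. c i * simple_integral A (d i) \<omega>)"
  using I d
proof (induction I)
  case empty
  have "AE \<omega> in P. simple_integral A (\<lambda>u. 0) \<omega> = 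
      (\<Sum>j\<in>(\<lambda>u. 0 :: real) ` space \<kappa>. 0 * \<Lambda> (A \<inter> ((\<lambda>u. 0 :: real) -` {j} \<inter> space \<kappa>)) \<omega>)"
    by (rule simple_integral_partition[where \<phi> = "\<lambda>_. 0" and r = "\<lambda>_. 0"]) (auto simp: A)
  then show ?case by simp
next
  case (insert i I)
  have "AE \<omega> in P. simple_integral A (\<lambda>u. c i * d i u + 1 * (\<Sum>j\<in>I. c j * d j u)) \<omega> =
      c i * simple_integral A (d i) \<omega> + 1 * simple_integral A (\<lambda>u. \<Sum>j\<in>I. c j * d j u) \<omega>"
    using insert.prems A
    by (intro simple_integral_lincomb2 simple_function_sum simple_function_mult simple_function_const) auto
  with insert.IH[OF insert.prems] insert.hyps show ?case
    by (auto elim!: eventually_elim2)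
qed

lemma simple_integral_Un:
  assumes d: "simple_function \<kappa> d" and "A \<in> sets \<kappa>" "B \<in> sets \<kappa>" "A \<inter> B = {}"
  shows "AE \<omega> in P. simple_integral (A \<union> B) d \<omega> = simple_integral A d \<omega> + simple_integral B d \<omega>"
proof -
  define S where "S x = d -` {x} \<inter> space \<kappa>" for x
  have [measurable]: "S x \<in> sets \<kappa>" for x
    using simple_functionD(2)[OF d] by (simp add: S_def)
  have "AE \<omega> in P. \<forall>x\<in>d ` space \<kappa>. \<Lambda> ((A \<inter> S x) \<union> (B \<inter> S x)) \<omega> = \<Lambda> (A \<inter> S x) \<omega> + \<Lambda> (B \<inter> S x) \<omega>"
    using simple_functionD(1)[OF d] assms by (intro AE_finite_allI \<Lambda>_Un) auto
  then show ?thesis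
  proof eventually_elim
    case (elim \<omega>)
    then have "(\<Sum>x\<in>d ` space \<kappa>. x * \<Lambda> ((A \<inter> S x) \<union> (B \<inter> S x)) \<omega>) =
        (\<Sum>x\<in>d ` space \<kappa>. x * (\<Lambda> (A \<inter> S x) \<omega> + \<Lambda> (B \<inter> S x) \<omega>))"
      by (intro sum.cong) auto
    then show ?case
      by (simp add: rm_simple_integral_def S_def[symmetric] Int_Un_distrib2 ring_distribs sum.distrib)
  qed
qed

text \<open>
  Independence turns the characteristic function into a product, and additivity of \<open>E\<close> collects the
  exponents again. The factor \<open>t\<close> stays outside \<open>d\<close> because \<open>t * d\<close> may merge values of \<open>d\<close>.
\<close>

lemma char_simple_integral:
  assumes d: "simple_function \<kappa> d" and A: "A \<in> sets \<kappa>"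
  shows "char (distr P borel (simple_integral A d)) t = exp (E (\<lambda>u. t * (d u * indicator A u)))"
proof -
  define J where "J = d ` space \<kappa>"
  define B where "B x = A \<inter> (d -` {x} \<inter> space \<kappa>)" for x
  have J: "finite J" and B [measurable]: "B x \<in> sets \<kappa>" for x
    using simple_functionD[OF d] A by (auto simp: J_def B_def)
  have disj: "disjoint_family_on B J"
    by (auto simp: disjoint_family_on_def B_def)
  have ind: "indep_vars (\<lambda>_. borel) (\<lambda>x \<omega>. x * \<Lambda> (B x) \<omega>) J"
    by (rule indep_vars_compose2[OF indep_\<Lambda>[OF J B disj]]) simp
  have "char (distr P borel (simple_integral A d)) t = (\<Prod>x\<in>J. char (distr P borel (\<lambda>\<omega>. x * \<Lambda> (B x) \<omega>)) t)"
    using char_distr_sum[OF ind] by (simp add: rm_simple_integral_def[abs_def] J_def B_def)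
  also have "\<dots> = (\<Prod>x\<in>J. char (distr P borel (\<Lambda> (B x))) (t * x))"
    by (intro prod.cong) (simp_all add: char_def integral_distr mult.assoc)
  also have "\<dots> = exp (\<Sum>x\<in>J. E (\<lambda>u. (t * x) * indicator (B x) u))"
    using J by (simp add: char_\<Lambda> exp_sum)
  also have "(\<Sum>x\<in>J. E (\<lambda>u. (t * x) * indicator (B x) u)) = E (\<lambda>u. \<Sum>x\<in>J. (t * x) * indicator (B x) u)"
    by (rule E_sum_indicator[symmetric, OF J B disj])
  also have "(\<lambda>u. \<Sum>x\<in>J. (t * x) * indicator (B x) u) = (\<lambda>u. t * (d u * indicator A u))"
  proof
    fix u
    show "(\<Sum>x\<in>J. (t * x) * indicator (B x) u) = t * (d u * indicator A u)"
    proof (cases "u \<in> A")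
      case True
      then have u: "u \<in> space \<kappa>" using A[THEN sets.sets_into_space] by auto
      then have "(\<Sum>x\<in>J. (t * x) * indicator (B x) u) = (\<Sum>x\<in>J. if x = d u then t * x else 0)"
        using True by (intro sum.cong) (auto simp: B_def indicator_def)
      also have "\<dots> = t * d u"
        using J u by (simp add: J_def)
      finally show ?thesis using True by simp
    qed (auto simp: B_def intro!: sum.neutral)
  qed
  finally show ?thesis .
qed

lemma expectation_iexp_simple_integral:
  assumes "simple_function \<kappa> d" "A \<in> sets \<kappa>"
  shows "(\<integral>\<omega>. iexp (simple_integral A d \<omega>) \<partial>P) = exp (E (\<lambda>u. d u * indicator A u))"
  using char_simple_integral[OF assms, of 1] assms by (simp add: char_def integral_distr)

text \<open>
  The domains \<open>A k\<close> may vary with \<open>k\<close>. Choosing them badly for contradiction yields convergence that is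
  uniform over all measurable subsets of a set.
\<close>

lemma l0_size_simple_integral_tendsto_zero:
  assumes d: "\<And>k. simple_function \<kappa> (d k)" and A: "\<And>k. A k \<in> sets \<kappa>"
    and bound: "\<And>k u. u \<in> A k \<Longrightarrow> \<bar>d k u\<bar> \<le> C"
    and lim: "AE u in \<kappa>. (\<lambda>k. d k u * indicator (A k) u) \<longlonglongrightarrow> 0"
  shows "(\<lambda>k. l0_size P (simple_integral (A k) (d k))) \<longlonglongrightarrow> 0"
proof (rule l0_size_tendsto_zero_if_char)
  have [measurable]: "d k \<in> borel_measurable \<kappa>" for k
    using d by (rule borel_measurable_simple_function)
  note A [measurable]
  fix t
  have "(\<lambda>k. E (\<lambda>u. t * (d k u * indicator (A k) u))) \<longlonglongrightarrow> E (\<lambda>u. 0)"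
  proof (rule E_tendsto[where C = "\<bar>t\<bar> * max 0 C"])
    show "\<bar>t * (d k u * indicator (A k) u)\<bar> \<le> \<bar>t\<bar> * max 0 C" for k u
      using bound[of u k] by (auto simp: abs_mult indicator_def intro!: mult_left_mono)
    show "AE u in \<kappa>. (\<lambda>k. t * (d k u * indicator (A k) u)) \<longlonglongrightarrow> 0"
      using lim by eventually_elim (rule tendsto_mult_right_zero)
  qed auto
  then have "(\<lambda>k. exp (E (\<lambda>u. t * (d k u * indicator (A k) u)))) \<longlonglongrightarrow> exp 0"
    unfolding E_zero by (intro tendsto_exp)
  then show "(\<lambda>k. char (distr P borel (simple_integral (A k) (d k))) t) \<longlonglongrightarrow> 1"
    by (simp add: char_simple_integral d A)
qed (use d A in auto)

end

section \<open>Existence and uniqueness of the integral of a bounded function\<close>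

context random_integrator
begin

text \<open>
  The integrals along two approximations of \<open>f\<close> differ by integrals of simple functions that
  tend to zero almost everywhere, with no uniform bound. That these integrals tend to zero in probability is
  a gliding hump argument. From stage \<open>m\<close> on the functions are bounded by 1 on a set \<open>B m\<close>, and the
  sets \<open>B m\<close> increase to almost all of \<open>A\<close>. Along suitable \<open>m 0 < m 1 < \<dots>\<close> and \<open>k 0, k 1, \<dots>\<close> the
  integral of \<open>d (k j)\<close> is concentrated on the annulus \<open>B (m (Suc j)) - B (m j)\<close>. The union of
  the annuli with \<open>j\<close> even is then a set over which the integrals have two limits: zero, along odd
  \<open>j\<close>, and the limit of the integrals over all of \<open>A\<close>, along even \<open>j\<close>.
\<close>

lemma simple_integral_limit_zero_if_AE_tendsto_zero:
  assumes d: "\<And>k. simple_function \<kappa> (d k)"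
    and d_AE: "AE u in \<kappa>. (\<lambda>k. d k u) \<longlonglongrightarrow> 0"
    and conv: "\<And>A. A \<in> sets \<kappa> \<Longrightarrow> \<exists>L. converges_in_prob P (\<lambda>k. simple_integral A (d k)) L"
    and A: "A \<in> sets \<kappa>" and L: "converges_in_prob P (\<lambda>k. simple_integral A (d k)) L"
  shows "AE \<omega> in P. L \<omega> = 0"
proof -
  have [measurable]: "d k \<in> borel_measurable \<kappa>" for k
    using d by (rule borel_measurable_simple_function)
  note A [measurable]
  note [measurable] = measurable_simple_integral[OF _ d]
  define B where "B m = {u \<in> space \<kappa>. u \<in> A \<and> (\<forall>k\<ge>m. \<bar>d k u\<bar> \<le> 1)}" for m
  have B [measurable]: "B m \<in> sets \<kappa>" for m
    unfolding B_def by measurable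
  have B_mono: "B m \<subseteq> B n" if "m \<le> n" for m n
    using that by (auto simp: B_def)
  have B_A: "B m \<subseteq> A" for m
    by (auto simp: B_def)
  \<comment> \<open>Where the functions are bounded, their integrals over all subsets tend to zero uniformly.\<close>
  have head: "\<exists>k0. \<forall>k\<ge>k0. \<forall>S\<in>sets \<kappa>. S \<subseteq> B m \<longrightarrow> l0_size P (simple_integral S (d k)) < \<epsilon>"
    if "0 < \<epsilon>" for m \<epsilon>
  proof (rule ccontr)
    assume "\<not> ?thesis"
    then have "\<forall>k0. \<exists>k S. k \<ge> k0 + m \<and> S \<in> sets \<kappa> \<and> S \<subseteq> B m \<and> \<epsilon> \<le> l0_size P (simple_integral S (d k))"
      by (meson not_less)
    then obtain k S where kS: "\<And>k0. k k0 \<ge> k0 + m" "\<And>k0. S k0 \<in> sets \<kappa>" "\<And>k0. S k0 \<subseteq> B m"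
        "\<And>k0. \<epsilon> \<le> l0_size P (simple_integral (S k0) (d (k k0)))"
      by metis
    have k_inf: "filterlim k sequentially sequentially"
      by (rule filterlim_at_top_mono[OF filterlim_ident]) (auto intro!: always_eventually le_trans[OF _ kS(1)])
    have "(\<lambda>n. l0_size P (simple_integral (S n) (d (k n)))) \<longlonglongrightarrow> 0"
    proof (rule l0_size_simple_integral_tendsto_zero[where C = 1])
      show "\<bar>d (k n) u\<bar> \<le> 1" if "u \<in> S n" for n u
        using kS(1)[of n] kS(3)[of n] that by (auto simp: B_def)
      show "AE u in \<kappa>. (\<lambda>n. d (k n) u * indicator (S n) u) \<longlonglongrightarrow> 0"
        using d_AE
      proof eventually_elim
        case (elim u)
        then have "(\<lambda>n. d (k n) u) \<longlonglongrightarrow> 0"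
          using k_inf by (rule filterlim_compose)
        then show ?case
          by (rule Lim_null_comparison[rotated, OF tendsto_rabs_zero])
            (auto simp: indicator_def intro!: always_eventually)
      qed
    qed (use d kS in auto)
    then have "\<forall>\<^sub>F n in sequentially. l0_size P (simple_integral (S n) (d (k n))) < \<epsilon>"
      using that by (rule order_tendstoD)
    then show False
      using kS(4) by (auto simp: eventually_sequentially not_less[symmetric])
  qed
  \<comment> \<open>The integral of a single simple function is small over all subsets of a small remainder.\<close>
  have tail: "\<exists>m0. \<forall>S\<in>sets \<kappa>. S \<subseteq> A - B m0 \<longrightarrow> l0_size P (simple_integral S (d k)) < \<epsilon>"
    if "0 < \<epsilon>" for k \<epsilon>
  proof (rule ccontr)
    assume "\<not> ?thesis"
    then have "\<forall>m. \<exists>S. S \<in> sets \<kappa> \<and> S \<subseteq> A - B m \<and> \<epsilon> \<le> l0_size P (simple_integral S (d k))"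
      by (meson not_less)
    then obtain S where S: "\<And>m. S m \<in> sets \<kappa>" "\<And>m. S m \<subseteq> A - B m"
        "\<And>m. \<epsilon> \<le> l0_size P (simple_integral (S m) (d k))"
      by metis
    have S_space: "S m \<subseteq> space \<kappa>" for m
      using S(1) by (rule sets.sets_into_space)
    have "(\<lambda>m. l0_size P (simple_integral (S m) (d k))) \<longlonglongrightarrow> 0"
    proof (rule l0_size_simple_integral_tendsto_zero[where C = "Max ((\<lambda>x. \<bar>x\<bar>) ` d k ` space \<kappa>)"])
      show "\<bar>d k u\<bar> \<le> Max ((\<lambda>x. \<bar>x\<bar>) ` d k ` space \<kappa>)" if "u \<in> S m" for m u
        using simple_functionD(1)[OF d] that S_space[of m] by (intro Max_ge) auto
      show "AE u in \<kappa>. (\<lambda>m. d k u * indicator (S m) u) \<longlonglongrightarrow> 0"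
        using d_AE AE_space
      proof eventually_elim
        case (elim u)
        have "\<forall>\<^sub>F k in sequentially. \<bar>d k u\<bar> < 1"
          using tendsto_rabs_zero[OF elim(1)] by (rule order_tendstoD) simp
        then obtain m0 where m0: "\<And>k. k \<ge> m0 \<Longrightarrow> \<bar>d k u\<bar> < 1"
          by (auto simp: eventually_sequentially)
        have "u \<in> B m" if "u \<in> A" "m \<ge> m0" for m
          unfolding B_def using elim(2) that less_imp_le[OF m0[OF order_trans[OF that(2)]]] by blast
        then have "u \<notin> S m" if "m \<ge> m0" for m
          using S(2)[of m] that by auto
        then show ?case
          by (intro tendsto_eventually) (auto simp: eventually_sequentially intro!: exI[of _ m0])
      qed
    qed (use d S in auto)
    then have "\<forall>\<^sub>F m in sequentially. l0_size P (simple_integral (S m) (d k)) < \<epsilon>"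
      using that by (rule order_tendstoD)
    then show False
      using S(3) by (auto simp: eventually_sequentially not_less[symmetric])
  qed
  define \<epsilon> :: "nat \<Rightarrow> real" where "\<epsilon> j = inverse (real (Suc j))" for j
  have "\<forall>m j. \<exists>k\<ge>j. \<forall>S\<in>sets \<kappa>. S \<subseteq> B m \<longrightarrow> l0_size P (simple_integral S (d k)) < \<epsilon> j"
  proof safe
    fix m j
    obtain k0 where "\<forall>k\<ge>k0. \<forall>S\<in>sets \<kappa>. S \<subseteq> B m \<longrightarrow> l0_size P (simple_integral S (d k)) < \<epsilon> j"
      using head[of "\<epsilon> j" m] by (auto simp: \<epsilon>_def)
    then show "\<exists>k\<ge>j. \<forall>S\<in>sets \<kappa>. S \<subseteq> B m \<longrightarrow> l0_size P (simple_integral S (d k)) < \<epsilon> j"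
      by (intro exI[of _ "max j k0"]) auto
  qed
  then obtain K where K: "\<And>m j. K m j \<ge> j"
      "\<And>m j S. S \<in> sets \<kappa> \<Longrightarrow> S \<subseteq> B m \<Longrightarrow> l0_size P (simple_integral S (d (K m j))) < \<epsilon> j"
    by metis
  have "\<forall>m k j. \<exists>n\<ge>m. \<forall>S\<in>sets \<kappa>. S \<subseteq> A - B n \<longrightarrow> l0_size P (simple_integral S (d k)) < \<epsilon> j"
  proof safe
    fix m k j
    obtain m0 where m0: "\<forall>S\<in>sets \<kappa>. S \<subseteq> A - B m0 \<longrightarrow> l0_size P (simple_integral S (d k)) < \<epsilon> j"
      using tail[of "\<epsilon> j" k] by (auto simp: \<epsilon>_def)
    have "S \<subseteq> A - B m0" if "S \<subseteq> A - B (max m m0)" for S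
      using that B_mono[of m0 "max m m0"] by auto
    with m0 show "\<exists>n\<ge>m. \<forall>S\<in>sets \<kappa>. S \<subseteq> A - B n \<longrightarrow> l0_size P (simple_integral S (d k)) < \<epsilon> j"
      by (intro exI[of _ "max m m0"]) auto
  qed
  then obtain N where N: "\<And>m k j. N m k j \<ge> m"
      "\<And>m k j S. S \<in> sets \<kappa> \<Longrightarrow> S \<subseteq> A - B (N m k j) \<Longrightarrow> l0_size P (simple_integral S (d k)) < \<epsilon> j"
    by metis
  define m where "m = rec_nat 0 (\<lambda>j n. N n (K n j) j)"
  define k where "k j = K (m j) j" for j
  have m_Suc: "m (Suc j) = N (m j) (k j) j" for j
    by (simp add: m_def k_def)
  have m_mono: "m i \<le> m j" if "i \<le> j" for i j
    by (rule lift_Suc_mono_le[OF _ that]) (simp add: m_Suc N(1))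
  have k_ge: "j \<le> k j" for j
    by (simp add: k_def K)
  define D where "D j = B (m (Suc j)) - B (m j)" for j
  define H where "H = (\<Union>j. D (2 * j))"
  have [measurable]: "D j \<in> sets \<kappa>" for j
    unfolding D_def by measurable
  have [measurable]: "H \<in> sets \<kappa>"
    unfolding H_def by measurable
  have H_A: "H \<subseteq> A"
    using B_A by (auto simp: H_def D_def)
  have D_disj: "D i \<inter> D j = {}" if "i < j" for i j
    using B_mono[OF m_mono[of "Suc i" j]] that by (auto simp: D_def)
  have H_even: "H \<inter> D j = D j" if "even j" for j
    using that by (auto simp: H_def elim!: evenE)
  have H_odd: "H \<inter> D j = {}" if "odd j" for j
  proof -
    have "D (2 * i) \<inter> D j = {}" for i
      using that D_disj[of "2 * i" j] D_disj[of j "2 * i"] by (cases "2 * i" j rule: linorder_cases) auto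
    then show ?thesis by (auto simp: H_def)
  qed
  have split: "l0_size P (\<lambda>\<omega>. simple_integral S (d (k j)) \<omega> - simple_integral (S \<inter> D j) (d (k j)) \<omega>)
      \<le> 2 * \<epsilon> j" if S [measurable]: "S \<in> sets \<kappa>" and "S \<subseteq> A" for S j
  proof -
    define S1 where "S1 = S \<inter> B (m j)"
    define S3 where "S3 = S - B (m (Suc j))"
    have [measurable]: "S1 \<in> sets \<kappa>" "S3 \<in> sets \<kappa>"
      unfolding S1_def S3_def by measurable
    have eq: "S = (S1 \<union> S3) \<union> (S \<inter> D j)"
      by (auto simp: S1_def S3_def D_def)
    have "B (m j) \<subseteq> B (m (Suc j))"
      by (intro B_mono m_mono) simp
    then have disj: "S1 \<inter> S3 = {}" "(S1 \<union> S3) \<inter> (S \<inter> D j) = {}"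
      by (auto simp: S1_def S3_def D_def)
    have "AE \<omega> in P. simple_integral ((S1 \<union> S3) \<union> (S \<inter> D j)) (d (k j)) \<omega> =
        simple_integral (S1 \<union> S3) (d (k j)) \<omega> + simple_integral (S \<inter> D j) (d (k j)) \<omega>"
      using disj by (intro simple_integral_Un d) measurable
    moreover have "AE \<omega> in P. simple_integral (S1 \<union> S3) (d (k j)) \<omega> =
        simple_integral S1 (d (k j)) \<omega> + simple_integral S3 (d (k j)) \<omega>"
      using disj by (intro simple_integral_Un d) measurable
    ultimately have "AE \<omega> in P. simple_integral S (d (k j)) \<omega> - simple_integral (S \<inter> D j) (d (k j)) \<omega> =
        simple_integral S1 (d (k j)) \<omega> + simple_integral S3 (d (k j)) \<omega>"
      unfolding eq[symmetric] by eventually_elim simp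
    then have "l0_size P (\<lambda>\<omega>. simple_integral S (d (k j)) \<omega> - simple_integral (S \<inter> D j) (d (k j)) \<omega>) =
        l0_size P (\<lambda>\<omega>. simple_integral S1 (d (k j)) \<omega> + simple_integral S3 (d (k j)) \<omega>)"
      by (rule l0_size_cong_AE) measurable
    also have "\<dots> \<le> l0_size P (simple_integral S1 (d (k j))) + l0_size P (simple_integral S3 (d (k j)))"
      by (rule l0_size_triangle) measurable
    also have "l0_size P (simple_integral S1 (d (k j))) \<le> \<epsilon> j"
      using K(2)[of S1 "m j" j] by (simp add: k_def S1_def less_imp_le)
    also have "l0_size P (simple_integral S3 (d (k j))) \<le> \<epsilon> j"
      using N(2)[of S3 "m j" "k j" j] \<open>S \<subseteq> A\<close>
      by (force simp: m_Suc[symmetric] S3_def less_imp_le)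
    finally show ?thesis by simp
  qed
  obtain L' where L': "converges_in_prob P (\<lambda>k. simple_integral H (d k)) L'"
    using conv[of H] by auto
  have [measurable]: "L \<in> borel_measurable P" "L' \<in> borel_measurable P"
    using L L' by (auto simp: converges_in_prob_def)
  have \<epsilon>_lim: "\<epsilon> \<longlonglongrightarrow> 0"
    unfolding \<epsilon>_def by (rule LIMSEQ_inverse_real_of_nat)
  have k_inf: "filterlim k sequentially sequentially"
    by (rule filterlim_at_top_mono[OF filterlim_ident]) (auto intro!: always_eventually k_ge)
  have L_lim: "(\<lambda>j. l0_size P (\<lambda>\<omega>. simple_integral A (d (k j)) \<omega> - L \<omega>)) \<longlonglongrightarrow> 0"
    using L by (intro filterlim_compose[OF _ k_inf]) (simp add: converges_in_prob_iff_l0_size)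
  have L'_lim: "(\<lambda>j. l0_size P (\<lambda>\<omega>. simple_integral H (d (k j)) \<omega> - L' \<omega>)) \<longlonglongrightarrow> 0"
    using L' by (intro filterlim_compose[OF _ k_inf]) (simp add: converges_in_prob_iff_l0_size)
  have empty: "AE \<omega> in P. simple_integral {} (d j) \<omega> = 0" for j
    using simple_integral_Un[OF d, of "{}" "{}" j] by simp
  \<comment> \<open>Along odd \<open>j\<close> the set \<open>H\<close> misses the annulus that carries the integral.\<close>
  have "l0_size P L' \<le> 2 * \<epsilon> j + l0_size P (\<lambda>\<omega>. simple_integral H (d (k j)) \<omega> - L' \<omega>)" if "odd j" for j
  proof -
    have "l0_size P L' = l0_size P (\<lambda>\<omega>. simple_integral {} (d (k j)) \<omega> - L' \<omega>)"
      using empty[of "k j"] l0_size_uminus[of P L']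
      by (subst (1) l0_size_uminus[symmetric], intro l0_size_cong_AE) (auto elim: eventually_mono)
    also have "\<dots> \<le> l0_size P (\<lambda>\<omega>. simple_integral {} (d (k j)) \<omega> - simple_integral H (d (k j)) \<omega>) +
        l0_size P (\<lambda>\<omega>. simple_integral H (d (k j)) \<omega> - L' \<omega>)"
      by (rule l0_size_triangle_diff) measurable
    also have "l0_size P (\<lambda>\<omega>. simple_integral {} (d (k j)) \<omega> - simple_integral H (d (k j)) \<omega>) \<le> 2 * \<epsilon> j"
      using split[of H j] H_A H_odd[OF that] by (subst l0_size_uminus[symmetric]) simp
    finally show ?thesis by simp
  qed
  then have "l0_size P L' \<le> 2 * \<epsilon> (2 * j + 1) +
      l0_size P (\<lambda>\<omega>. simple_integral H (d (k (2 * j + 1))) \<omega> - L' \<omega>)" for j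
    by simp
  moreover have odd_inf: "filterlim (\<lambda>j::nat. 2 * j + 1) sequentially sequentially"
    by (rule filterlim_at_top_mono[OF filterlim_ident]) auto
  have "(\<lambda>j. 2 * \<epsilon> (2 * j + 1) + l0_size P (\<lambda>\<omega>. simple_integral H (d (k (2 * j + 1))) \<omega> - L' \<omega>)) \<longlonglongrightarrow> 2 * 0 + 0"
    by (intro tendsto_add tendsto_mult tendsto_const filterlim_compose[OF \<epsilon>_lim odd_inf]
        filterlim_compose[OF L'_lim odd_inf])
  ultimately have "l0_size P L' \<le> 0"
    using LIMSEQ_le_const by fastforce
  then have L'_0: "AE \<omega> in P. L' \<omega> = 0"
    using l0_size_nonneg[of P L'] by (intro AE_zero_if_l0_size_zero) auto
  \<comment> \<open>Along even \<open>j\<close> the integrals over \<open>H\<close> and \<open>A\<close> share the annulus that carries them.\<close>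
  have "l0_size P (\<lambda>\<omega>. L \<omega> - L' \<omega>) \<le> l0_size P (\<lambda>\<omega>. simple_integral A (d (k j)) \<omega> - L \<omega>) + 4 * \<epsilon> j +
      l0_size P (\<lambda>\<omega>. simple_integral H (d (k j)) \<omega> - L' \<omega>)" if "even j" for j
  proof -
    have AD: "A \<inter> D j = D j"
      using B_A by (auto simp: D_def)
    have "l0_size P (\<lambda>\<omega>. L \<omega> - L' \<omega>) \<le> l0_size P (\<lambda>\<omega>. L \<omega> - simple_integral A (d (k j)) \<omega>) +
        l0_size P (\<lambda>\<omega>. simple_integral A (d (k j)) \<omega> - L' \<omega>)"
      by (rule l0_size_triangle_diff) measurable
    also have "l0_size P (\<lambda>\<omega>. simple_integral A (d (k j)) \<omega> - L' \<omega>) \<le>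
        l0_size P (\<lambda>\<omega>. simple_integral A (d (k j)) \<omega> - simple_integral (D j) (d (k j)) \<omega>) +
        l0_size P (\<lambda>\<omega>. simple_integral (D j) (d (k j)) \<omega> - L' \<omega>)"
      by (rule l0_size_triangle_diff) measurable
    also have "l0_size P (\<lambda>\<omega>. simple_integral (D j) (d (k j)) \<omega> - L' \<omega>) \<le>
        l0_size P (\<lambda>\<omega>. simple_integral (D j) (d (k j)) \<omega> - simple_integral H (d (k j)) \<omega>) +
        l0_size P (\<lambda>\<omega>. simple_integral H (d (k j)) \<omega> - L' \<omega>)"
      by (rule l0_size_triangle_diff) measurable
    also have "l0_size P (\<lambda>\<omega>. simple_integral A (d (k j)) \<omega> - simple_integral (D j) (d (k j)) \<omega>) \<le> 2 * \<epsilon> j"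
      using split[of A j] AD by simp
    also have "l0_size P (\<lambda>\<omega>. simple_integral (D j) (d (k j)) \<omega> - simple_integral H (d (k j)) \<omega>) \<le> 2 * \<epsilon> j"
      using split[of H j] H_A H_even[OF that] by (subst l0_size_uminus[symmetric]) simp
    also have "l0_size P (\<lambda>\<omega>. L \<omega> - simple_integral A (d (k j)) \<omega>) =
        l0_size P (\<lambda>\<omega>. simple_integral A (d (k j)) \<omega> - L \<omega>)"
      by (subst l0_size_uminus[symmetric]) simp
    finally show ?thesis by simp
  qed
  then have "l0_size P (\<lambda>\<omega>. L \<omega> - L' \<omega>) \<le> l0_size P (\<lambda>\<omega>. simple_integral A (d (k (2 * j))) \<omega> - L \<omega>) +
      4 * \<epsilon> (2 * j) + l0_size P (\<lambda>\<omega>. simple_integral H (d (k (2 * j))) \<omega> - L' \<omega>)" for j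
    by simp
  moreover have even_inf: "filterlim (\<lambda>j::nat. 2 * j) sequentially sequentially"
    by (rule filterlim_at_top_mono[OF filterlim_ident]) auto
  have "(\<lambda>j. l0_size P (\<lambda>\<omega>. simple_integral A (d (k (2 * j))) \<omega> - L \<omega>) +
      4 * \<epsilon> (2 * j) + l0_size P (\<lambda>\<omega>. simple_integral H (d (k (2 * j))) \<omega> - L' \<omega>)) \<longlonglongrightarrow> 0 + 4 * 0 + 0"
    by (intro tendsto_add tendsto_mult tendsto_const filterlim_compose[OF \<epsilon>_lim even_inf]
        filterlim_compose[OF L_lim even_inf] filterlim_compose[OF L'_lim even_inf])
  ultimately have "l0_size P (\<lambda>\<omega>. L \<omega> - L' \<omega>) \<le> 0"
    using LIMSEQ_le_const by fastforce
  then have "AE \<omega> in P. L \<omega> - L' \<omega> = 0"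
    using l0_size_nonneg[of P "\<lambda>\<omega>. L \<omega> - L' \<omega>"] by (intro AE_zero_if_l0_size_zero) auto
  with L'_0 show ?thesis
    by eventually_elim simp
qed

text \<open>Hence the limit of the integrals does not depend on the approximating sequence.\<close>

lemma approximation_limit_unique:
  assumes g: "rm_approximation \<kappa> P \<Lambda> f g" and h: "rm_approximation \<kappa> P \<Lambda> f h" and A: "A \<in> sets \<kappa>"
    and K: "converges_in_prob P (\<lambda>k. simple_integral A (g k)) K"
    and L: "converges_in_prob P (\<lambda>k. simple_integral A (h k)) L"
  shows "AE \<omega> in P. K \<omega> = L \<omega>"
proof -
  have gs: "simple_function \<kappa> (g k)" and hs: "simple_function \<kappa> (h k)" for k
    using g h by (auto simp: rm_approximation_def)
  note [measurable] = measurable_simple_integral[OF _ gs] measurable_simple_integral[OF _ hs]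
  define d where "d k u = g k u - h k u" for k u
  have d: "simple_function \<kappa> (d k)" for k
    unfolding d_def using gs hs by (intro simple_function_diff)
  note [measurable] = measurable_simple_integral[OF _ d]
  have diff: "converges_in_prob P (\<lambda>k. simple_integral B (d k)) (\<lambda>\<omega>. K' \<omega> - L' \<omega>)"
    if [measurable]: "B \<in> sets \<kappa>"
      and "converges_in_prob P (\<lambda>k. simple_integral B (g k)) K'"
      and "converges_in_prob P (\<lambda>k. simple_integral B (h k)) L'" for B K' L'
  proof (rule converges_in_prob_cong_AE)
    show "converges_in_prob P (\<lambda>k \<omega>. simple_integral B (g k) \<omega> - simple_integral B (h k) \<omega>) (\<lambda>\<omega>. K' \<omega> - L' \<omega>)"
      by (intro converges_in_prob_diff that) measurable
    show "AE \<omega> in P. simple_integral B (g k) \<omega> - simple_integral B (h k) \<omega> = simple_integral B (d k) \<omega>" for k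
      unfolding d_def by (rule eventually_mono[OF simple_integral_diff[OF gs[of k] hs[of k] that(1)]]) simp
  qed measurable
  have "AE \<omega> in P. K \<omega> - L \<omega> = 0"
  proof (rule simple_integral_limit_zero_if_AE_tendsto_zero[OF d])
    have "AE u in \<kappa>. (\<lambda>k. g k u) \<longlonglongrightarrow> f u" "AE u in \<kappa>. (\<lambda>k. h k u) \<longlonglongrightarrow> f u"
      using g h by (auto simp: rm_approximation_def)
    then show "AE u in \<kappa>. (\<lambda>k. d k u) \<longlonglongrightarrow> 0"
      unfolding d_def
    proof eventually_elim
      case (elim u)
      then show ?case using tendsto_diff by fastforce
    qed
    show "\<exists>L. converges_in_prob P (\<lambda>k. simple_integral B (d k)) L" if "B \<in> sets \<kappa>" for B
      using g h that diff[OF that] unfolding rm_approximation_def by blast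
  qed (use A diff K L in auto)
  then show ?thesis by eventually_elim simp
qed

text \<open>
  For two members of a bounded pointwise convergent sequence of simple functions the difference
  tends to zero boundedly as both indices grow, so its integrals are Cauchy in probability.
\<close>

lemma bounded_approximation:
  assumes [measurable]: "f \<in> borel_measurable \<kappa>" and bound: "\<And>u. u \<in> space \<kappa> \<Longrightarrow> \<bar>f u\<bar> \<le> C"
  shows "\<exists>h. rm_approximation \<kappa> P \<Lambda> f h \<and> (\<forall>k. \<forall>u\<in>space \<kappa>. \<bar>h k u\<bar> \<le> 2 * C) \<and>
    (\<forall>u\<in>space \<kappa>. (\<lambda>k. h k u) \<longlonglongrightarrow> f u)"
proof -
  obtain h where h: "\<And>k. simple_function \<kappa> (h k)"
      "\<And>u. u \<in> space \<kappa> \<Longrightarrow> (\<lambda>k. h k u) \<longlonglongrightarrow> f u"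
      "\<And>k u. u \<in> space \<kappa> \<Longrightarrow> \<bar>h k u\<bar> \<le> 2 * \<bar>f u\<bar>"
  proof -
    obtain h where "\<forall>k. simple_function \<kappa> (h k)" "\<forall>u\<in>space \<kappa>. (\<lambda>k. h k u) \<longlonglongrightarrow> f u"
        "\<forall>k. \<forall>u\<in>space \<kappa>. dist (h k u) 0 \<le> 2 * dist (f u) 0"
      using borel_measurable_implies_sequence_metric[OF assms(1), of 0] by blast
    then show thesis
      by (intro that[of h]) (simp_all add: dist_real_def)
  qed
  have h_bound: "\<bar>h k u\<bar> \<le> 2 * C" if "u \<in> space \<kappa>" for k u
    using h(3)[OF that, of k] bound[OF that] by linarith
  note [measurable] = measurable_simple_integral[OF _ h(1)]
  have "\<exists>L. converges_in_prob P (\<lambda>k. simple_integral A (h k)) L" if A [measurable]: "A \<in> sets \<kappa>" for A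
  proof (rule convergent_in_prob_if_Cauchy)
    fix \<epsilon> :: real assume "0 < \<epsilon>"
    show "\<exists>N. \<forall>k\<ge>N. \<forall>l\<ge>N. l0_size P (\<lambda>\<omega>. simple_integral A (h k) \<omega> - simple_integral A (h l) \<omega>) < \<epsilon>"
    proof (rule ccontr)
      assume "\<not> ?thesis"
      then have "\<forall>N. \<exists>k l. k \<ge> N \<and> l \<ge> N \<and>
          \<epsilon> \<le> l0_size P (\<lambda>\<omega>. simple_integral A (h k) \<omega> - simple_integral A (h l) \<omega>)"
        by (meson not_less)
      then obtain k l where kl: "\<And>N. k N \<ge> N" "\<And>N. l N \<ge> N"
          "\<And>N. \<epsilon> \<le> l0_size P (\<lambda>\<omega>. simple_integral A (h (k N)) \<omega> - simple_integral A (h (l N)) \<omega>)"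
        by metis
      have inf: "filterlim k sequentially sequentially" "filterlim l sequentially sequentially"
        by (rule filterlim_at_top_mono[OF filterlim_ident], simp add: kl(1,2))+
      define d where "d n u = h (k n) u - h (l n) u" for n u
      have d: "simple_function \<kappa> (d n)" for n
        unfolding d_def using h by (intro simple_function_diff)
      note [measurable] = measurable_simple_integral[OF _ d]
      have "(\<lambda>n. l0_size P (simple_integral A (d n))) \<longlonglongrightarrow> 0"
      proof (rule l0_size_simple_integral_tendsto_zero[where C = "4 * C"])
        show "\<bar>d n u\<bar> \<le> 4 * C" if "u \<in> A" for n u
          using h_bound[of u "k n"] h_bound[of u "l n"] that A[THEN sets.sets_into_space]
          by (auto simp: d_def)
        have "(\<lambda>n. d n u) \<longlonglongrightarrow> f u - f u" if "u \<in> space \<kappa>" for u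
          unfolding d_def
          by (intro tendsto_diff filterlim_compose[OF h(2)[OF that] inf(1)] filterlim_compose[OF h(2)[OF that] inf(2)])
        then show "AE u in \<kappa>. (\<lambda>n. d n u * indicator A u) \<longlonglongrightarrow> 0"
          by (intro AE_I2) (auto intro!: tendsto_mult_left_zero)
      qed (use d in auto)
      moreover have "l0_size P (simple_integral A (d n)) =
          l0_size P (\<lambda>\<omega>. simple_integral A (h (k n)) \<omega> - simple_integral A (h (l n)) \<omega>)" for n
      proof (rule l0_size_cong_AE)
        show "AE \<omega> in P. simple_integral A (d n) \<omega> = simple_integral A (h (k n)) \<omega> - simple_integral A (h (l n)) \<omega>"
          unfolding d_def by (intro simple_integral_diff h A)
      qed measurable
      ultimately have "(\<lambda>n. l0_size P (\<lambda>\<omega>. simple_integral A (h (k n)) \<omega> - simple_integral A (h (l n)) \<omega>)) \<longlonglongrightarrow> 0"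
        by simp
      from order_tendstoD(2)[OF this \<open>0 < \<epsilon>\<close>] obtain n
        where "l0_size P (\<lambda>\<omega>. simple_integral A (h (k n)) \<omega> - simple_integral A (h (l n)) \<omega>) < \<epsilon>"
        by (auto simp only: eventually_sequentially)
      with kl(3)[of n] show False by simp
    qed
  qed measurable
  then have "rm_approximation \<kappa> P \<Lambda> f h"
    using h by (auto simp: rm_approximation_def)
  then show ?thesis
    using h(2) h_bound by (intro exI[of _ h] conjI) auto
qed

lemma rm_integrable_bounded:
  assumes "f \<in> borel_measurable \<kappa>" "\<And>u. u \<in> space \<kappa> \<Longrightarrow> \<bar>f u\<bar> \<le> C"
  shows "rm_integrable \<kappa> P \<Lambda> f"
proof -
  obtain h where "rm_approximation \<kappa> P \<Lambda> f h"
    using bounded_approximation[OF assms] by auto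
  then show ?thesis
    using assms(1) by (auto simp: rm_integrable_def)
qed

text \<open>
  The choice of a version and of an approximation in the definition of the integral is immaterial:
  every approximation leads to the chosen version.
\<close>

lemma rm_integral_limit:
  assumes h: "rm_approximation \<kappa> P \<Lambda> f h" and A: "A \<in> sets \<kappa>"
  shows "converges_in_prob P (\<lambda>k. simple_integral A (h k)) (rm_integral \<kappa> P \<Lambda> A f)"
proof -
  obtain L where L: "converges_in_prob P (\<lambda>k. simple_integral A (h k)) L"
    using h A by (auto simp: rm_approximation_def)
  define Q where "Q L' \<longleftrightarrow> (\<exists>g. rm_approximation \<kappa> P \<Lambda> f g \<and>
      converges_in_prob P (\<lambda>k. simple_integral A (g k)) L')" for L'
  have "Q L"
    using h L by (auto simp: Q_def)
  then have "Q (SOME L'. Q L')"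
    by (rule someI[of Q L])
  then have "Q (rm_integral \<kappa> P \<Lambda> A f)"
    by (simp add: rm_integral_def Q_def)
  then obtain g where g: "rm_approximation \<kappa> P \<Lambda> f g"
      "converges_in_prob P (\<lambda>k. simple_integral A (g k)) (rm_integral \<kappa> P \<Lambda> A f)"
    by (auto simp: Q_def)
  have hs: "simple_function \<kappa> (h k)" for k
    using h by (auto simp: rm_approximation_def)
  note [measurable] = measurable_simple_integral[OF A hs]
  have [measurable]: "L \<in> borel_measurable P" "rm_integral \<kappa> P \<Lambda> A f \<in> borel_measurable P"
    using L g by (auto simp: converges_in_prob_def)
  have eq: "AE \<omega> in P. rm_integral \<kappa> P \<Lambda> A f \<omega> = L \<omega>"
    using approximation_limit_unique[OF g(1) h A g(2) L] .
  have "l0_size P (\<lambda>\<omega>. simple_integral A (h k) \<omega> - rm_integral \<kappa> P \<Lambda> A f \<omega>) =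
      l0_size P (\<lambda>\<omega>. simple_integral A (h k) \<omega> - L \<omega>)" for k
    using eq by (intro l0_size_cong_AE) (auto elim: eventually_mono)
  with L show ?thesis
    by (simp add: converges_in_prob_iff_l0_size)
qed

lemma measurable_rm_integral_bounded:
  assumes "f \<in> borel_measurable \<kappa>" "\<And>u. u \<in> space \<kappa> \<Longrightarrow> \<bar>f u\<bar> \<le> C" "A \<in> sets \<kappa>"
  shows "rm_integral \<kappa> P \<Lambda> A f \<in> borel_measurable P"
proof -
  obtain h where "rm_approximation \<kappa> P \<Lambda> f h"
    using bounded_approximation[OF assms(1,2)] by auto
  then show ?thesis
    using rm_integral_limit assms(3) by (auto simp: converges_in_prob_def)
qed

text \<open>
  The joint characteristic function of several integrals, at the frequencies \<open>c i\<close>. Integrals of simple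
  functions are linear almost surely, which reduces it to the law of the integral of one simple
  function; dominated continuity of \<open>E\<close> passes to the limit.
\<close>

lemma expectation_iexp_rm_integral:
  assumes I: "finite I" and f [measurable]: "\<And>i. i \<in> I \<Longrightarrow> f i \<in> borel_measurable \<kappa>"
    and bound: "\<And>i u. i \<in> I \<Longrightarrow> u \<in> space \<kappa> \<Longrightarrow> \<bar>f i u\<bar> \<le> C i"
  shows "(\<integral>\<omega>. iexp (\<Sum>i\<in>I. c i * rm_integral \<kappa> P \<Lambda> (space \<kappa>) (f i) \<omega>) \<partial>P) =
    exp (E (\<lambda>u. \<Sum>i\<in>I. c i * f i u))"
proof -
  define S where "S = space \<kappa>"
  have S [measurable]: "S \<in> sets \<kappa>" by (simp add: S_def)
  have "\<forall>i\<in>I. \<exists>h. rm_approximation \<kappa> P \<Lambda> (f i) h \<and>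
      (\<forall>k. \<forall>u\<in>space \<kappa>. \<bar>h k u\<bar> \<le> 2 * C i) \<and> (\<forall>u\<in>space \<kappa>. (\<lambda>k. h k u) \<longlonglongrightarrow> f i u)"
    by (intro ballI bounded_approximation f bound)
  from bchoice[OF this] obtain h where "\<forall>i\<in>I. rm_approximation \<kappa> P \<Lambda> (f i) (h i) \<and>
      (\<forall>k. \<forall>u\<in>space \<kappa>. \<bar>h i k u\<bar> \<le> 2 * C i) \<and> (\<forall>u\<in>space \<kappa>. (\<lambda>k. h i k u) \<longlonglongrightarrow> f i u)"
    by blast
  then have h: "\<And>i. i \<in> I \<Longrightarrow> rm_approximation \<kappa> P \<Lambda> (f i) (h i)"
      "\<And>i k u. i \<in> I \<Longrightarrow> u \<in> space \<kappa> \<Longrightarrow> \<bar>h i k u\<bar> \<le> 2 * C i"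
      "\<And>i u. i \<in> I \<Longrightarrow> u \<in> space \<kappa> \<Longrightarrow> (\<lambda>k. h i k u) \<longlonglongrightarrow> f i u"
    by simp_all
  have hs: "simple_function \<kappa> (h i k)" if "i \<in> I" for i k
    using h(1)[OF that] by (auto simp: rm_approximation_def)
  note [measurable] = measurable_simple_integral[OF S hs] borel_measurable_simple_function[OF hs]
  define L where "L i = rm_integral \<kappa> P \<Lambda> S (f i)" for i
  have L: "L i \<in> borel_measurable P"
      "(\<lambda>k. l0_size P (\<lambda>\<omega>. simple_integral S (h i k) \<omega> - L i \<omega>)) \<longlonglongrightarrow> 0" if "i \<in> I" for i
    using rm_integral_limit[OF h(1)[OF that] S] that
    by (auto simp: converges_in_prob_iff_l0_size L_def)
  note [measurable] = L(1)
  define H where "H k u = (\<Sum>i\<in>I. c i * h i k u)" for k u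
  have H: "simple_function \<kappa> (H k)" for k
    unfolding H_def using hs by (intro simple_function_sum simple_function_mult simple_function_const)
  note [measurable] = measurable_simple_integral[OF S H] borel_measurable_simple_function[OF H]
  have "(\<lambda>k. l0_size P (\<lambda>\<omega>. (\<Sum>i\<in>I. c i * simple_integral S (h i k) \<omega>) - (\<Sum>i\<in>I. c i * L i \<omega>))) \<longlonglongrightarrow> 0"
  proof -
    have "l0_size P (\<lambda>\<omega>. (\<Sum>i\<in>I. c i * simple_integral S (h i k) \<omega>) - (\<Sum>i\<in>I. c i * L i \<omega>)) \<le>
        (\<Sum>i\<in>I. (1 + \<bar>c i\<bar>) * l0_size P (\<lambda>\<omega>. simple_integral S (h i k) \<omega> - L i \<omega>))" (is "?l k \<le> ?r k") for k
    proof -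
      have "?l k = l0_size P (\<lambda>\<omega>. \<Sum>i\<in>I. c i * (simple_integral S (h i k) \<omega> - L i \<omega>))"
        by (simp add: sum_subtractf right_diff_distrib)
      also have "\<dots> \<le> (\<Sum>i\<in>I. l0_size P (\<lambda>\<omega>. c i * (simple_integral S (h i k) \<omega> - L i \<omega>)))"
        using I by (intro l0_size_sum) auto
      also have "\<dots> \<le> ?r k"
        by (intro sum_mono l0_size_scale) auto
      finally show ?thesis .
    qed
    moreover have "?r \<longlonglongrightarrow> (\<Sum>i\<in>I. (1 + \<bar>c i\<bar>) * 0)"
      by (intro tendsto_sum tendsto_mult tendsto_const L)
    ultimately show ?thesis
      by (intro l0_size_tendsto_zero_le) simp_all
  qed
  then have "(\<lambda>k. \<integral>\<omega>. iexp (\<Sum>i\<in>I. c i * simple_integral S (h i k) \<omega>) \<partial>P) \<longlonglongrightarrow>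
      (\<integral>\<omega>. iexp (\<Sum>i\<in>I. c i * L i \<omega>) \<partial>P)"
    by (intro expectation_iexp_tendsto) auto
  moreover have "(\<integral>\<omega>. iexp (\<Sum>i\<in>I. c i * simple_integral S (h i k) \<omega>) \<partial>P) = exp (E (\<lambda>u. H k u * indicator S u))" for k
  proof -
    have "AE \<omega> in P. simple_integral S (H k) \<omega> = (\<Sum>i\<in>I. c i * simple_integral S (h i k) \<omega>)"
      unfolding H_def by (intro simple_integral_lincomb I hs S)
    then have "(\<integral>\<omega>. iexp (\<Sum>i\<in>I. c i * simple_integral S (h i k) \<omega>) \<partial>P) = (\<integral>\<omega>. iexp (simple_integral S (H k) \<omega>) \<partial>P)"
      by (intro integral_cong_AE) (auto elim: eventually_mono)
    then show ?thesis
      by (simp add: expectation_iexp_simple_integral H)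
  qed
  moreover have "(\<lambda>k. E (\<lambda>u. H k u * indicator S u)) \<longlonglongrightarrow> E (\<lambda>u. \<Sum>i\<in>I. c i * f i u)"
  proof (rule E_tendsto[where C = "\<Sum>i\<in>I. \<bar>c i\<bar> * (2 * C i)"])
    show "\<bar>H k u * indicator S u\<bar> \<le> (\<Sum>i\<in>I. \<bar>c i\<bar> * (2 * C i))" if "u \<in> space \<kappa>" for k u
    proof -
      have "\<bar>H k u\<bar> \<le> (\<Sum>i\<in>I. \<bar>c i * h i k u\<bar>)"
        unfolding H_def by (rule sum_abs)
      also have "\<dots> \<le> (\<Sum>i\<in>I. \<bar>c i\<bar> * (2 * C i))"
        using h(2) that by (intro sum_mono) (simp add: abs_mult mult_left_mono)
      finally show ?thesis using that by (simp add: S_def)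
    qed
    show "AE u in \<kappa>. (\<lambda>k. H k u * indicator S u) \<longlonglongrightarrow> (\<Sum>i\<in>I. c i * f i u)"
      unfolding H_def using h(3)
      by (intro AE_I2) (auto simp: S_def intro!: tendsto_sum tendsto_mult)
  qed auto
  ultimately have "(\<lambda>k. exp (E (\<lambda>u. H k u * indicator S u))) \<longlonglongrightarrow> (\<integral>\<omega>. iexp (\<Sum>i\<in>I. c i * L i \<omega>) \<partial>P)"
    "(\<lambda>k. exp (E (\<lambda>u. H k u * indicator S u))) \<longlonglongrightarrow> exp (E (\<lambda>u. \<Sum>i\<in>I. c i * f i u))"
    by (auto intro: tendsto_exp)
  then show ?thesis
    unfolding L_def S_def by (rule LIMSEQ_unique)
qed

end

section \<open>Laws on sequence space and characteristic functions\<close>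

text \<open>Levy's uniqueness theorem for probability measures, rescaled by the common total mass.\<close>

lemma finite_measure_eqI_char:
  assumes M: "finite_measure M" "sets M = sets borel" and N: "finite_measure N" "sets N = sets borel"
    and char: "char M = char N"
  shows "M = N"
proof -
  interpret M: finite_measure M by fact
  interpret N: finite_measure N by fact
  have space: "space M = UNIV" "space N = UNIV"
    using M(2) N(2) by (auto dest: sets_eq_imp_space_eq)
  define c where "c = measure M UNIV"
  have "complex_of_real (measure M UNIV) = of_real (measure N UNIV)"
    using fun_cong[OF char, of 0] space by (simp add: char_def)
  then have c: "measure M UNIV = c" "measure N UNIV = c"
    by (simp_all add: c_def)
  show ?thesis
  proof (cases "c = 0")
    case True
    have "emeasure M A = 0" "emeasure N A = 0" for A
      using M.bounded_measure[of A] N.bounded_measure[of A] c True space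
      by (auto simp: M.emeasure_eq_measure N.emeasure_eq_measure measure_le_0_iff)
    then show ?thesis
      using M(2) N(2) by (intro measure_eqI) auto
  next
    case False
    then have c_pos: "0 < c"
      by (simp add: c_def zero_less_measure_iff)
    define S where "S L = density L (\<lambda>_. ennreal (1 / c))" for L :: "real measure"
    have rd: "real_distribution (S L)"
      if "finite_measure L" "sets L = sets borel" "space L = UNIV" "measure L UNIV = c" for L
    proof -
      interpret L: finite_measure L by fact
      have "emeasure (S L) (space (S L)) = 1"
        using that c_pos unfolding S_def
        by (simp add: emeasure_density L.emeasure_eq_measure nn_integral_cmult
            ennreal_mult[symmetric])
      then show ?thesis
        using that by (auto simp: real_distribution_def real_distribution_axioms_def S_def intro!: prob_spaceI)
    qed
    have char_S: "char (S L) t = char L t / c" if "sets L = sets borel" for L t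
    proof -
      have [measurable_cong]: "sets L = sets borel" by fact
      show ?thesis
        unfolding char_def S_def using c_pos
        by (subst integral_density) (auto simp: scaleR_conv_of_real)
    qed
    have "S M = S N"
      using M N c space char by (intro Levy_uniqueness rd) (auto simp: fun_eq_iff char_S)
    moreover have "L = density (S L) (\<lambda>_. ennreal c)" if "sets L = sets borel" for L
    proof -
      have "density (S L) (\<lambda>_. ennreal c) = density L (\<lambda>_. ennreal (1 / c) * ennreal c)"
        unfolding S_def by (subst density_density_eq) auto
      also have "(\<lambda>_. ennreal (1 / c) * ennreal c) = (\<lambda>_. 1)"
        using c_pos by (auto simp: ennreal_mult[symmetric])
      finally show ?thesis by (simp add: density_1)
    qed
    ultimately show ?thesis
      using M(2) N(2) by metis
  qed
qed

text \<open>
  The law of \<open>u\<close> under a nonnegative weight whose characteristic function is a combination of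
  expectations of \<open>G * iexp (s * T + t * u)\<close> with \<open>s = 0, 1, -1\<close>.
\<close>

definition phase_law ::
  "'a measure \<Rightarrow> ('a \<Rightarrow> real) \<Rightarrow> ('a \<Rightarrow> real) \<Rightarrow> ('a \<Rightarrow> real) \<Rightarrow> real \<Rightarrow> real measure" where
  "phase_law P G T u c = distr (density P (\<lambda>\<omega>. ennreal (G \<omega> * (1 + cos (T \<omega> + c))))) borel u"

lemma phase_weight_bounds:
  fixes G :: real
  assumes "0 \<le> G" "G \<le> 1"
  shows "0 \<le> G * (1 + cos x)" "G * (1 + cos x) \<le> 2"
proof -
  have "0 \<le> 1 + cos x" "1 + cos x \<le> 2"
    using cos_ge_minus_one[of x] cos_le_one[of x] by linarith+
  then show "0 \<le> G * (1 + cos x)" "G * (1 + cos x) \<le> 2"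
    using assms mult_mono[of G 1 "1 + cos x" 2] by auto
qed

context prob_space
begin

context
  fixes G T u :: "'a \<Rightarrow> real"
  assumes [measurable]: "G \<in> borel_measurable M" "T \<in> borel_measurable M" "u \<in> borel_measurable M"
    and G: "\<And>\<omega>. 0 \<le> G \<omega>" "\<And>\<omega>. G \<omega> \<le> 1"
begin

lemma finite_measure_phase_law: "finite_measure (phase_law M G T u c)"
proof -
  have "(\<integral>\<^sup>+\<omega>. ennreal (G \<omega> * (1 + cos (T \<omega> + c))) \<partial>M) \<le> (\<integral>\<^sup>+\<omega>. ennreal 2 \<partial>M)"
    using G by (intro nn_integral_mono ennreal_leI phase_weight_bounds) auto
  also have "\<dots> < \<infinity>"
    by (simp add: emeasure_space_1)
  finally have "(\<integral>\<^sup>+\<omega>. ennreal (G \<omega> * (1 + cos (T \<omega> + c))) \<partial>M) \<noteq> \<infinity>" by simp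
  then show ?thesis
    unfolding phase_law_def
    by (intro finite_measure.finite_measure_distr finite_measureI)
      (auto simp: emeasure_density cong: nn_integral_cong)
qed

lemma char_phase_law:
  "char (phase_law M G T u c) t = (\<integral>\<omega>. of_real (G \<omega>) * iexp (0 * T \<omega> + t * u \<omega>) \<partial>M) +
    iexp c / 2 * (\<integral>\<omega>. of_real (G \<omega>) * iexp (1 * T \<omega> + t * u \<omega>) \<partial>M) +
    iexp (- c) / 2 * (\<integral>\<omega>. of_real (G \<omega>) * iexp (- 1 * T \<omega> + t * u \<omega>) \<partial>M)"
proof -
  have int: "integrable M (\<lambda>\<omega>. of_real (G \<omega>) * iexp (s * T \<omega> + t * u \<omega>))" for s
    using G by (intro integrable_const_bound[where B = 1]) (auto simp: norm_mult)
  have "char (phase_law M G T u c) t =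
      (\<integral>\<omega>. of_real (G \<omega> * (1 + cos (T \<omega> + c))) * iexp (t * u \<omega>) \<partial>M)"
    unfolding char_def phase_law_def
    using phase_weight_bounds(1)[OF G]
    by (subst integral_distr) (simp_all add: integral_density scaleR_conv_of_real)
  also have "\<dots> = (\<integral>\<omega>. of_real (G \<omega>) * iexp (0 * T \<omega> + t * u \<omega>) +
      iexp c / 2 * (of_real (G \<omega>) * iexp (1 * T \<omega> + t * u \<omega>)) +
      iexp (- c) / 2 * (of_real (G \<omega>) * iexp (- 1 * T \<omega> + t * u \<omega>)) \<partial>M)"
  proof (rule Bochner_Integration.integral_cong[OF refl])
    fix \<omega>
    have cos: "complex_of_real (cos (T \<omega> + c)) = (iexp c * iexp (T \<omega>) + iexp (- c) * iexp (- T \<omega>)) / 2"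
      by (simp add: cos_of_real[symmetric] cos_exp_eq exp_add[symmetric] algebra_simps)
    have split: "iexp (a + b) = iexp a * iexp b" for a b
      by (simp add: exp_add[symmetric] algebra_simps)
    show "of_real (G \<omega> * (1 + cos (T \<omega> + c))) * iexp (t * u \<omega>) =
        of_real (G \<omega>) * iexp (0 * T \<omega> + t * u \<omega>) +
        iexp c / 2 * (of_real (G \<omega>) * iexp (1 * T \<omega> + t * u \<omega>)) +
        iexp (- c) / 2 * (of_real (G \<omega>) * iexp (- 1 * T \<omega> + t * u \<omega>))"
      unfolding split unfolding of_real_mult of_real_add cos of_real_1 by (simp add: field_simps del: mult_exp_exp)
  qed
  also have "\<dots> = (\<integral>\<omega>. of_real (G \<omega>) * iexp (0 * T \<omega> + t * u \<omega>) \<partial>M) +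
      iexp c / 2 * (\<integral>\<omega>. of_real (G \<omega>) * iexp (1 * T \<omega> + t * u \<omega>) \<partial>M) +
      iexp (- c) / 2 * (\<integral>\<omega>. of_real (G \<omega>) * iexp (- 1 * T \<omega> + t * u \<omega>) \<partial>M)"
    by (subst Bochner_Integration.integral_add,
        intro Bochner_Integration.integrable_add integrable_mult_right int,
        intro integrable_mult_right int,
        subst Bochner_Integration.integral_add, rule int, intro integrable_mult_right int,
        simp only: integral_mult_right_zero)
  finally show ?thesis .
qed

lemma measure_phase_law:
  assumes [measurable]: "B \<in> sets borel"
  shows "measure (phase_law M G T u c) B = (\<integral>\<omega>. G \<omega> * (1 + cos (T \<omega> + c)) * indicator B (u \<omega>) \<partial>M)"
proof -
  have "emeasure (phase_law M G T u c) B =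
      (\<integral>\<^sup>+\<omega>. ennreal (G \<omega> * (1 + cos (T \<omega> + c)) * indicator B (u \<omega>)) \<partial>M)"
    unfolding phase_law_def
    by (simp add: emeasure_distr emeasure_density)
      (auto intro!: nn_integral_cong simp: indicator_def)
  then show ?thesis
    using phase_weight_bounds(1)[OF G]
    by (simp add: measure_def integral_eq_nn_integral)
qed

text \<open>
  Opposite phases cancel the constant in \<open>1 + cos (T + c)\<close>: the phases \<open>0, pi\<close> give the cosine of \<open>T\<close>
  and the phases \<open>- pi / 2, pi / 2\<close> its sine.
\<close>

lemma integral_indicator_iexp_phase_law:
  assumes [measurable]: "B \<in> sets borel"
  shows "(\<integral>\<omega>. of_real (G \<omega> * indicator B (u \<omega>)) * iexp (T \<omega>) \<partial>M) =
    of_real ((measure (phase_law M G T u 0) B - measure (phase_law M G T u pi) B) / 2) +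
    \<i> * of_real ((measure (phase_law M G T u (- pi / 2)) B - measure (phase_law M G T u (pi / 2)) B) / 2)"
proof -
  have int: "integrable M (\<lambda>\<omega>. G \<omega> * (1 + cos (T \<omega> + c)) * indicator B (u \<omega>))" for c
    using phase_weight_bounds[OF G]
    by (intro integrable_const_bound[where B = 2]) (auto simp: indicator_def)
  have "(\<integral>\<omega>. of_real (G \<omega> * indicator B (u \<omega>)) * iexp (T \<omega>) \<partial>M) =
    (\<integral>\<omega>. of_real ((G \<omega> * (1 + cos (T \<omega> + 0)) * indicator B (u \<omega>) -
        G \<omega> * (1 + cos (T \<omega> + pi)) * indicator B (u \<omega>)) / 2) +
      \<i> * of_real ((G \<omega> * (1 + cos (T \<omega> + - pi / 2)) * indicator B (u \<omega>) -
        G \<omega> * (1 + cos (T \<omega> + pi / 2)) * indicator B (u \<omega>)) / 2) \<partial>M)"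
  proof (rule Bochner_Integration.integral_cong[OF refl])
    fix \<omega>
    have "cos (T \<omega> + - pi / 2) = sin (T \<omega>)" "cos (T \<omega> + pi / 2) = - sin (T \<omega>)"
      by (simp_all add: cos_add cos_diff)
    then show "of_real (G \<omega> * indicator B (u \<omega>)) * iexp (T \<omega>) =
      of_real ((G \<omega> * (1 + cos (T \<omega> + 0)) * indicator B (u \<omega>) -
        G \<omega> * (1 + cos (T \<omega> + pi)) * indicator B (u \<omega>)) / 2) +
      \<i> * of_real ((G \<omega> * (1 + cos (T \<omega> + - pi / 2)) * indicator B (u \<omega>) -
        G \<omega> * (1 + cos (T \<omega> + pi / 2)) * indicator B (u \<omega>)) / 2)"
      by (simp add: complex_eq_iff Re_exp Im_exp indicator_def algebra_simps)
  qed
  also have "\<dots> = of_real ((measure (phase_law M G T u 0) B - measure (phase_law M G T u pi) B) / 2) +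
    \<i> * of_real ((measure (phase_law M G T u (- pi / 2)) B - measure (phase_law M G T u (pi / 2)) B) / 2)"
  proof -
    have diff: "integrable M (\<lambda>\<omega>. (G \<omega> * (1 + cos (T \<omega> + c)) * indicator B (u \<omega>) -
          G \<omega> * (1 + cos (T \<omega> + d)) * indicator B (u \<omega>)) / 2)"
        "(\<integral>\<omega>. (G \<omega> * (1 + cos (T \<omega> + c)) * indicator B (u \<omega>) -
          G \<omega> * (1 + cos (T \<omega> + d)) * indicator B (u \<omega>)) / 2 \<partial>M) =
        (measure (phase_law M G T u c) B - measure (phase_law M G T u d) B) / 2" for c d
      using int[of c] int[of d] by (simp_all add: measure_phase_law)
    have "(\<integral>\<omega>. of_real (f \<omega>) + \<i> * of_real (g \<omega>) \<partial>M) = of_real (\<integral>\<omega>. f \<omega> \<partial>M) + \<i> * of_real (\<integral>\<omega>. g \<omega> \<partial>M)"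
      if "integrable M f" "integrable M g" for f g :: "'a \<Rightarrow> real"
      using that by simp
    from this[OF diff(1) diff(1)] show ?thesis
      unfolding diff(2) .
  qed
  finally show ?thesis .
qed

end

end

text \<open>
  The one-dimensional uniqueness theorem is applied to the laws of \<open>u\<close> and \<open>u'\<close> under the
  nonnegative weights \<open>G * (1 + cos (T + c))\<close>. The phases \<open>c\<close> recover the complex weight \<open>G * iexp T\<close>.
\<close>

lemma weighted_law_unique:
  fixes G T u :: "'a \<Rightarrow> real" and G' T' u' :: "'b \<Rightarrow> real"
  assumes P: "prob_space P" and P': "prob_space P'"
    and rv: "G \<in> borel_measurable P" "T \<in> borel_measurable P" "u \<in> borel_measurable P"
    and rv': "G' \<in> borel_measurable P'" "T' \<in> borel_measurable P'" "u' \<in> borel_measurable P'"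
    and G: "\<And>\<omega>. 0 \<le> G \<omega>" "\<And>\<omega>. G \<omega> \<le> 1" and G': "\<And>\<omega>. 0 \<le> G' \<omega>" "\<And>\<omega>. G' \<omega> \<le> 1"
    and eq: "\<And>s t. (\<integral>\<omega>. of_real (G \<omega>) * iexp (s * T \<omega> + t * u \<omega>) \<partial>P) =
      (\<integral>\<omega>. of_real (G' \<omega>) * iexp (s * T' \<omega> + t * u' \<omega>) \<partial>P')"
    and B: "B \<in> sets borel"
  shows "(\<integral>\<omega>. of_real (G \<omega> * indicator B (u \<omega>)) * iexp (T \<omega>) \<partial>P) =
    (\<integral>\<omega>. of_real (G' \<omega> * indicator B (u' \<omega>)) * iexp (T' \<omega>) \<partial>P')"
proof -
  have "phase_law P G T u c = phase_law P' G' T' u' c" for c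
  proof (rule finite_measure_eqI_char)
    show "char (phase_law P G T u c) = char (phase_law P' G' T' u' c)"
      unfolding fun_eq_iff prob_space.char_phase_law[OF P rv G] prob_space.char_phase_law[OF P' rv' G'] eq
      by simp
  qed (simp_all add: prob_space.finite_measure_phase_law[OF P rv G]
      prob_space.finite_measure_phase_law[OF P' rv' G'], simp_all add: phase_law_def)
  then show ?thesis
    by (simp only: prob_space.integral_indicator_iexp_phase_law[OF P rv G B]
        prob_space.integral_indicator_iexp_phase_law[OF P' rv' G' B])
qed

text \<open>
  Coordinates are added one at a time to the set \<open>J\<close> on which indicators appear, while the
  frequencies stay arbitrary on all of \<open>I\<close>. With \<open>J = I\<close> and \<open>\<theta> = 0\<close> these are the
  probabilities of cylinder sets.
\<close>

lemma cylinder_expectation_unique: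
  fixes U :: "'i \<Rightarrow> 'a \<Rightarrow> real" and V :: "'i \<Rightarrow> 'b \<Rightarrow> real"
  assumes P: "prob_space P" and P': "prob_space P'"
    and U: "\<And>i. U i \<in> borel_measurable P" and V: "\<And>i. V i \<in> borel_measurable P'"
    and I: "finite I"
    and eq: "\<And>\<theta>. (\<integral>\<omega>. iexp (\<Sum>i\<in>I. \<theta> i * U i \<omega>) \<partial>P) = (\<integral>\<omega>. iexp (\<Sum>i\<in>I. \<theta> i * V i \<omega>) \<partial>P')"
    and J: "J \<subseteq> I" and A: "\<And>j. j \<in> J \<Longrightarrow> A j \<in> sets borel"
  shows "(\<integral>\<omega>. of_real (\<Prod>j\<in>J. indicator (A j) (U j \<omega>)) * iexp (\<Sum>i\<in>I. \<theta> i * U i \<omega>) \<partial>P) =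
    (\<integral>\<omega>. of_real (\<Prod>j\<in>J. indicator (A j) (V j \<omega>)) * iexp (\<Sum>i\<in>I. \<theta> i * V i \<omega>) \<partial>P')"
  using finite_subset[OF J I] J A
proof (induction J arbitrary: \<theta>)
  case empty
  then show ?case using eq by simp
next
  case (insert k J)
  note [measurable] = U V
  have A [measurable]: "A k \<in> sets borel" "\<And>j. j \<in> J \<Longrightarrow> A j \<in> sets borel"
    using insert.prems by auto
  have sum: "s * (\<Sum>i\<in>I. \<theta> i * W i) + t * W k = (\<Sum>i\<in>I. (s * \<theta> i + (if i = k then t else 0)) * W i)"
    for s t and W :: "'i \<Rightarrow> real"
  proof -
    have "(\<Sum>i\<in>I. (s * \<theta> i + (if i = k then t else 0)) * W i) =
        (\<Sum>i\<in>I. s * (\<theta> i * W i) + (if i = k then t * W i else 0))"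
      by (intro sum.cong) (auto simp: algebra_simps)
    also have "\<dots> = s * (\<Sum>i\<in>I. \<theta> i * W i) + t * W k"
      using I insert.prems(1) by (simp add: sum.distrib sum_distrib_left)
    finally show ?thesis ..
  qed
  have "(\<integral>\<omega>. of_real ((\<Prod>j\<in>J. indicator (A j) (U j \<omega>)) * indicator (A k) (U k \<omega>)) * iexp (\<Sum>i\<in>I. \<theta> i * U i \<omega>) \<partial>P) =
    (\<integral>\<omega>. of_real ((\<Prod>j\<in>J. indicator (A j) (V j \<omega>)) * indicator (A k) (V k \<omega>)) * iexp (\<Sum>i\<in>I. \<theta> i * V i \<omega>) \<partial>P')"
  proof (rule weighted_law_unique[OF P P'])
    show "(\<integral>\<omega>. of_real (\<Prod>j\<in>J. indicator (A j) (U j \<omega>)) * iexp (s * (\<Sum>i\<in>I. \<theta> i * U i \<omega>) + t * U k \<omega>) \<partial>P) =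
      (\<integral>\<omega>. of_real (\<Prod>j\<in>J. indicator (A j) (V j \<omega>)) * iexp (s * (\<Sum>i\<in>I. \<theta> i * V i \<omega>) + t * V k \<omega>) \<partial>P')" for s t
    proof -
      have sU: "s * (\<Sum>i\<in>I. \<theta> i * U i \<omega>) + t * U k \<omega> = (\<Sum>i\<in>I. (s * \<theta> i + (if i = k then t else 0)) * U i \<omega>)" for \<omega>
        by (rule sum[of s "\<lambda>i. U i \<omega>" t])
      have sV: "s * (\<Sum>i\<in>I. \<theta> i * V i \<omega>) + t * V k \<omega> = (\<Sum>i\<in>I. (s * \<theta> i + (if i = k then t else 0)) * V i \<omega>)" for \<omega>
        by (rule sum[of s "\<lambda>i. V i \<omega>" t])
      show ?thesis
        unfolding sU sV by (rule insert.IH) (use insert.prems in auto)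
    qed
  qed (auto intro!: prod_nonneg prod_le_1)
  then show ?case
    using insert.hyps by (simp add: mult.commute)
qed

lemma process_law_cylinder:
  assumes W: "process Q W" and J: "finite J" and A [measurable]: "\<And>j. j \<in> J \<Longrightarrow> A j \<in> sets borel"
  shows "emeasure (process_law Q W) (prod_emb UNIV (\<lambda>_. borel) J (Pi\<^sub>E J A)) =
      ennreal (Re (\<integral>\<omega>. of_real (\<Prod>j\<in>J. indicator (A j) (W j \<omega>)) * iexp (\<Sum>i\<in>J. 0 * W i \<omega>) \<partial>Q))"
proof -
  interpret Q: prob_space Q using W by (simp add: process_def)
  have [measurable]: "W i \<in> borel_measurable Q" for i
    using W by (simp add: process_def)
  define C where "C = {\<omega> \<in> space Q. \<forall>j\<in>J. W j \<omega> \<in> A j}"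
  have C: "C \<in> sets Q"
    unfolding C_def using J by measurable
  have "emeasure (process_law Q W) (prod_emb UNIV (\<lambda>_. borel) J (Pi\<^sub>E J A)) =
      emeasure Q ((\<lambda>\<omega> i. W i \<omega>) -` prod_emb UNIV (\<lambda>_. borel) J (Pi\<^sub>E J A) \<inter> space Q)"
    unfolding process_law_def
    by (intro emeasure_distr sets_PiM_I measurable_abs_UNIV J A) auto
  also have "(\<lambda>\<omega> i. W i \<omega>) -` prod_emb UNIV (\<lambda>_. borel) J (Pi\<^sub>E J A) \<inter> space Q = C"
    by (auto simp: C_def prod_emb_def PiE_iff)
  also have "emeasure Q C = ennreal (measure Q C)"
    by (rule Q.emeasure_eq_measure)
  also have "measure Q C = Re (\<integral>\<omega>. of_real (indicator C \<omega>) \<partial>Q)"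
    using C by (simp only: integral_complex_of_real Re_complex_of_real integral_indicator)
      (simp add: C_def Collect_conj_eq Int_absorb1)
  also have "(\<integral>\<omega>. complex_of_real (indicator C \<omega>) \<partial>Q) =
      (\<integral>\<omega>. of_real (\<Prod>j\<in>J. indicator (A j) (W j \<omega>)) * iexp (\<Sum>i\<in>J. 0 * W i \<omega>) \<partial>Q)"
    using J by (intro Bochner_Integration.integral_cong) (auto simp: C_def indicator_def)
  finally show ?thesis .
qed

lemma process_law_eqI_char:
  fixes U :: "'i \<Rightarrow> 'a \<Rightarrow> real" and V :: "'i \<Rightarrow> 'b \<Rightarrow> real"
  assumes U: "process P U" and V: "process P' V"
    and eq: "\<And>I \<theta>. finite I \<Longrightarrow> (\<integral>\<omega>. iexp (\<Sum>i\<in>I. \<theta> i * U i \<omega>) \<partial>P) = (\<integral>\<omega>. iexp (\<Sum>i\<in>I. \<theta> i * V i \<omega>) \<partial>P')"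
  shows "process_law P U = process_law P' V"
proof (rule measure_eqI_PiM_infinite)
  interpret P: prob_space P using U by (simp add: process_def)
  have [measurable]: "U i \<in> borel_measurable P" for i
    using U by (auto simp: process_def)
  show "finite_measure (process_law P U)"
    unfolding process_law_def by (intro P.finite_measure_distr measurable_abs_UNIV) auto
  fix A :: "'i \<Rightarrow> real set" and J
  assume J: "finite J" and A: "\<And>j. j \<in> J \<Longrightarrow> A j \<in> sets borel"
  show "emeasure (process_law P U) (prod_emb UNIV (\<lambda>_. borel) J (Pi\<^sub>E J A)) =
    emeasure (process_law P' V) (prod_emb UNIV (\<lambda>_. borel) J (Pi\<^sub>E J A))"
  proof -
    have "(\<integral>\<omega>. of_real (\<Prod>j\<in>J. indicator (A j) (U j \<omega>)) * iexp (\<Sum>i\<in>J. 0 * U i \<omega>) \<partial>P) =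
        (\<integral>\<omega>. of_real (\<Prod>j\<in>J. indicator (A j) (V j \<omega>)) * iexp (\<Sum>i\<in>J. 0 * V i \<omega>) \<partial>P')"
      using U V A by (intro cylinder_expectation_unique J eq) (auto simp: process_def)
    then show ?thesis
      by (simp only: process_law_cylinder[where A = A, OF U J] process_law_cylinder[where A = A, OF V J] A)
  qed
qed (auto simp: process_law_def)

section \<open>Integrals against differences of Levy measures\<close>

lemma levy_measure_finite_away:
  fixes F :: "'v::real_normed_vector measure"
  assumes F: "levy_measure F" and r: "0 < r" and B: "B \<in> sets borel" "\<And>x. x \<in> B \<Longrightarrow> r \<le> norm x"
  shows "emeasure F B < \<infinity>"
proof -
  have [measurable_cong]: "sets F = sets borel"
    using F by (simp add: levy_measure_def)
  define c where "c = min 1 (r\<^sup>2)"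
  have c: "0 < c" using r by (simp add: c_def)
  have "ennreal c * emeasure F B = (\<integral>\<^sup>+x. ennreal c * indicator B x \<partial>F)"
    using B(1) by (simp add: nn_integral_cmult_indicator)
  also have "\<dots> \<le> (\<integral>\<^sup>+x. ennreal (min 1 ((norm x)\<^sup>2)) \<partial>F)"
  proof (intro nn_integral_mono)
    fix x show "ennreal c * indicator B x \<le> ennreal (min 1 ((norm x)\<^sup>2))"
      using B(2)[of x] r by (auto simp: indicator_def c_def intro!: ennreal_leI min.coboundedI2 power_mono)
  qed
  also have "\<dots> < \<infinity>"
    using F by (simp add: levy_measure_def)
  finally show ?thesis
    using c by (auto simp: ennreal_mult_less_top)
qed

text \<open>
  Levy measures may be infinite near zero. Weighted by \<open>min 1 (x\<^sup>2)\<close> they are finite, the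
  Radon-Nikodym theorem applies to a finite measure dominating both of them, and the weight is divided out again.
\<close>

lemma levy_measures_common_density:
  fixes F1 F2 :: "real measure"
  assumes F1: "levy_measure F1" and F2: "levy_measure F2"
  obtains \<mu> q1 q2 where "sets \<mu> = sets borel"
    "q1 \<in> borel_measurable borel" "\<And>x. 0 \<le> q1 x" "q1 0 = 0" "F1 = density \<mu> (\<lambda>x. ennreal (q1 x))"
    "q2 \<in> borel_measurable borel" "\<And>x. 0 \<le> q2 x" "q2 0 = 0" "F2 = density \<mu> (\<lambda>x. ennreal (q2 x))"
proof -
  define w :: "real \<Rightarrow> real" where "w x = min 1 ((norm x)\<^sup>2)" for x
  have w: "w \<in> borel_measurable borel" "\<And>x. 0 \<le> w x" "w 0 = 0" "\<And>x. x \<noteq> 0 \<Longrightarrow> 0 < w x"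
    unfolding w_def by auto
  note [measurable] = w(1)
  define weighted where "weighted F = density F (\<lambda>x. ennreal (w x))" for F
  have weighted: "finite_measure (weighted F)" "sets (weighted F) = sets borel" "space (weighted F) = UNIV"
    if "levy_measure F" for F
  proof -
    have [measurable_cong]: "sets F = sets borel"
      using that by (simp add: levy_measure_def)
    show "sets (weighted F) = sets borel"
      by (simp add: weighted_def \<open>sets F = sets borel\<close>)
    then show "space (weighted F) = UNIV"
      by (auto dest: sets_eq_imp_space_eq)
    have "emeasure (weighted F) (space F) = (\<integral>\<^sup>+x. ennreal (w x) * indicator (space F) x \<partial>F)"
      unfolding weighted_def by (rule emeasure_density) auto
    also have "\<dots> = (\<integral>\<^sup>+x. ennreal (w x) \<partial>F)"
      by (intro nn_integral_cong) auto
    also have "\<dots> < \<infinity>"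
      using that unfolding levy_measure_def w_def by blast
    finally have "emeasure (weighted F) (space F) < \<infinity>" .
    then show "finite_measure (weighted F)"
      by (intro finite_measureI) (simp add: weighted_def)
  qed
  define \<mu> where "\<mu> = sup_measure' (weighted F1) (weighted F2)"
  note s = weighted(2)[OF F1] weighted(2)[OF F2]
  have \<mu>: "sets \<mu> = sets borel" "space \<mu> = UNIV"
    using s weighted(3)[OF F1] by (simp_all add: \<mu>_def)
  have le: "emeasure (weighted F1) X \<le> emeasure \<mu> X" "emeasure (weighted F2) X \<le> emeasure \<mu> X"
    if "X \<in> sets borel" for X
    unfolding \<mu>_def using s that by (auto intro!: le_emeasure_sup_measure'1 le_emeasure_sup_measure'2)
  interpret W1: finite_measure "weighted F1" by (rule weighted(1)[OF F1])
  interpret W2: finite_measure "weighted F2" by (rule weighted(1)[OF F2])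
  have "emeasure \<mu> UNIV \<le> emeasure (weighted F1) UNIV + emeasure (weighted F2) UNIV"
  proof -
    have "emeasure \<mu> UNIV = (SUP Y\<in>sets (weighted F1). emeasure (weighted F1) (UNIV \<inter> Y) + emeasure (weighted F2) (UNIV \<inter> - Y))"
      unfolding \<mu>_def using s by (intro emeasure_sup_measure') auto
    also have "\<dots> \<le> emeasure (weighted F1) UNIV + emeasure (weighted F2) UNIV"
      using s by (intro SUP_least add_mono emeasure_mono) auto
    finally show ?thesis .
  qed
  also have "\<dots> < \<infinity>"
    by (simp add: W1.emeasure_eq_measure W2.emeasure_eq_measure)
  finally interpret \<mu>: finite_measure \<mu>
    by (intro finite_measureI) (simp add: \<mu>)
  have q: "\<exists>q. q \<in> borel_measurable borel \<and> (\<forall>x. 0 \<le> q x) \<and> q 0 = 0 \<and> F = density \<mu> (\<lambda>x. ennreal (q x))"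
    if F: "levy_measure F" and le: "\<And>X. X \<in> sets borel \<Longrightarrow> emeasure (weighted F) X \<le> emeasure \<mu> X" for F
  proof -
    have [measurable_cong]: "sets F = sets borel" "sets \<mu> = sets borel"
      using F \<mu> by (simp_all add: levy_measure_def)
    have ac: "absolutely_continuous \<mu> (weighted F)"
      unfolding absolutely_continuous_def
    proof
      fix X assume "X \<in> null_sets \<mu>"
      then show "X \<in> null_sets (weighted F)"
        using le[of X] weighted(2)[OF F] \<mu> by (auto simp: null_sets_def)
    qed
    obtain D where D [measurable]: "D \<in> borel_measurable \<mu>"
        and D_eq: "AE x in \<mu>. RN_deriv \<mu> (weighted F) x = ennreal (D x)" and D_nn: "\<And>x. 0 \<le> D x"
      by (rule \<mu>.real_RN_deriv[OF weighted(1)[OF F] ac]) (simp add: weighted(2)[OF F] \<mu>(1), rule that)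
    have "density \<mu> (RN_deriv \<mu> (weighted F)) = weighted F"
      using weighted(2)[OF F] \<mu>(1) by (intro \<mu>.density_RN_deriv ac) simp
    moreover have "density \<mu> (RN_deriv \<mu> (weighted F)) = density \<mu> (\<lambda>x. ennreal (D x))"
      using D_eq by (intro density_cong) auto
    ultimately have dens: "weighted F = density \<mu> (\<lambda>x. ennreal (D x))" by simp
    have [measurable]: "D \<in> borel_measurable borel"
      using D by simp
    have "density (weighted F) (\<lambda>x. ennreal (1 / w x)) = density F (\<lambda>x. ennreal (w x) * ennreal (1 / w x))"
      unfolding weighted_def by (subst density_density_eq) auto
    also have "\<dots> = density F (\<lambda>_. 1)"
    proof (rule density_cong)
      have "{0} \<in> null_sets F"
        using F by (auto simp: levy_measure_def null_sets_def)
      then have "AE x in F. x \<notin> {0}"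
        by (rule AE_not_in)
      then show "AE x in F. ennreal (w x) * ennreal (1 / w x) = 1"
      proof eventually_elim
        case (elim x)
        then show ?case
          using w(4)[of x] by (simp add: ennreal_mult[symmetric])
      qed
    qed auto
    finally have "F = density (weighted F) (\<lambda>x. ennreal (1 / w x))"
      by (simp add: density_1)
    also have "\<dots> = density \<mu> (\<lambda>x. ennreal (D x / w x))"
      unfolding dens using D_nn w(2)
      by (subst density_density_eq) (auto simp: ennreal_mult[symmetric])
    finally have "F = density \<mu> (\<lambda>x. ennreal (D x / w x))" .
    then show ?thesis
      using D_nn w by (intro exI[of _ "\<lambda>x. D x / w x"]) auto
  qed
  obtain q1 where "q1 \<in> borel_measurable borel" "\<forall>x. 0 \<le> q1 x" "q1 0 = 0" "F1 = density \<mu> (\<lambda>x. ennreal (q1 x))"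
    using q[OF F1 le(1)] by blast
  moreover obtain q2 where "q2 \<in> borel_measurable borel" "\<forall>x. 0 \<le> q2 x" "q2 0 = 0" "F2 = density \<mu> (\<lambda>x. ennreal (q2 x))"
    using q[OF F2 le(2)] by blast
  ultimately show thesis
    using that[OF \<mu>(1)] by blast
qed

text \<open>
  The supremum defining the positive part is attained in the limit on the sets where
  \<open>q1 \<ge> q2\<close>, intersected with complements of shrinking neighbourhoods of zero.
\<close>

lemma jordan_pos_density_difference:
  fixes \<mu> :: "real measure"
  assumes \<mu> [measurable_cong]: "sets \<mu> = sets borel"
    and q1 [measurable]: "q1 \<in> borel_measurable borel" and q1_nn: "\<And>x. 0 \<le> q1 x" "q1 0 = 0"
    and q2 [measurable]: "q2 \<in> borel_measurable borel" and q2_nn: "\<And>x. 0 \<le> q2 x" "q2 0 = 0"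
    and F1: "levy_measure (density \<mu> (\<lambda>x. ennreal (q1 x)))"
    and F2: "levy_measure (density \<mu> (\<lambda>x. ennreal (q2 x)))"
  shows "jordan_pos borel norm (\<lambda>B. measure (density \<mu> (\<lambda>x. ennreal (q1 x))) B - measure (density \<mu> (\<lambda>x. ennreal (q2 x))) B) =
    density \<mu> (\<lambda>x. ennreal (max 0 (q1 x - q2 x)))"
proof -
  define F where "F q = density \<mu> (\<lambda>x. ennreal (q x))" for q :: "real \<Rightarrow> real"
  define p where "p x = max 0 (q1 x - q2 x)" for x
  have p [measurable]: "p \<in> borel_measurable borel"
    unfolding p_def by measurable
  have F_emeasure: "emeasure (F q) C = (\<integral>\<^sup>+x. ennreal (q x) * indicator C x \<partial>\<mu>)"
    if "q \<in> borel_measurable borel" "C \<in> sets borel" for q C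
    unfolding F_def using that by (simp add: emeasure_density)
  have away_fin: "emeasure (F q1) C = ennreal (measure (F q1) C)" "emeasure (F q2) C = ennreal (measure (F q2) C)"
    if C: "C \<in> away_sets borel norm" for C
  proof -
    obtain r where "0 < r" "C \<in> sets borel" "\<forall>x\<in>C. r \<le> norm x"
      using C unfolding away_sets_def by blast
    then have "emeasure (F q1) C < \<infinity>" "emeasure (F q2) C < \<infinity>"
      unfolding F_def by (blast intro: levy_measure_finite_away[OF F1] levy_measure_finite_away[OF F2])+
    then show "emeasure (F q1) C = ennreal (measure (F q1) C)" "emeasure (F q2) C = ennreal (measure (F q2) C)"
      by (auto intro!: emeasure_eq_ennreal_measure)
  qed
  have pt: "ennreal (q1 x) \<le> ennreal (q2 x) + ennreal (p x)"
    "q2 x \<le> q1 x \<Longrightarrow> ennreal (q1 x) = ennreal (q2 x) + ennreal (p x)" for x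
    using q2_nn(1)[of x] by (subst ennreal_plus[symmetric]; force simp: p_def intro!: ennreal_leI)+
  have F_p: "emeasure (F q1) C \<le> emeasure (F q2) C + emeasure (F p) C" if "C \<in> sets borel" for C
  proof -
    have "emeasure (F q1) C \<le> (\<integral>\<^sup>+x. ennreal (q2 x) * indicator C x + ennreal (p x) * indicator C x \<partial>\<mu>)"
      using pt(1) unfolding F_emeasure[OF q1 that]
      by (intro nn_integral_mono) (auto simp: indicator_def)
    then show ?thesis
      using that by (simp add: F_emeasure nn_integral_add)
  qed
  have F_p_eq: "emeasure (F q1) C = emeasure (F q2) C + emeasure (F p) C"
    if "C \<in> sets borel" "\<And>x. x \<in> C \<Longrightarrow> q2 x \<le> q1 x" for C
  proof -
    have "emeasure (F q1) C = (\<integral>\<^sup>+x. ennreal (q2 x) * indicator C x + ennreal (p x) * indicator C x \<partial>\<mu>)"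
      using pt(2) that(2) unfolding F_emeasure[OF q1 that(1)]
      by (intro nn_integral_cong) (auto simp: indicator_def)
    then show ?thesis
      using that by (simp add: F_emeasure nn_integral_add)
  qed
  have "(SUP C\<in>{C \<in> away_sets borel norm. C \<subseteq> B}. ennreal (measure (F q1) C - measure (F q2) C)) = emeasure (F p) B"
    (is "?sup = _") if B [measurable]: "B \<in> sets borel" for B
  proof (rule antisym)
    show "?sup \<le> emeasure (F p) B"
    proof (rule SUP_least, safe)
      fix C assume C: "C \<in> away_sets borel norm" "C \<subseteq> B"
      then have C_sets: "C \<in> sets borel" by (auto simp: away_sets_def)
      have "ennreal (measure (F q1) C - measure (F q2) C) = ennreal (measure (F q1) C) - ennreal (measure (F q2) C)"
        by (simp add: ennreal_minus)
      also have "\<dots> \<le> emeasure (F p) C"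
        using F_p[OF C_sets] away_fin[OF C(1)] by (subst ennreal_minus_le_iff) auto
      also have "\<dots> \<le> emeasure (F p) B"
        using C by (intro emeasure_mono) (simp_all add: F_def \<mu>)
      finally show "ennreal (measure (F q1) C - measure (F q2) C) \<le> emeasure (F p) B" .
    qed
  next
    define C where "C n = {x \<in> B. q2 x \<le> q1 x \<and> inverse (real (Suc n)) \<le> norm x}" for n
    have C_sets [measurable]: "C n \<in> sets borel" for n
      unfolding C_def by measurable
    have C_away: "C n \<in> away_sets borel norm" "C n \<subseteq> B" for n
      by (auto simp: away_sets_def C_def intro!: exI[of _ "inverse (real (Suc n))"])
    have C_val: "emeasure (F p) (C n) = ennreal (measure (F q1) (C n) - measure (F q2) (C n))" for n
    proof -
      have "ennreal (measure (F q1) (C n)) = ennreal (measure (F q2) (C n)) + emeasure (F p) (C n)"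
        unfolding away_fin(1)[OF C_away(1), symmetric] away_fin(2)[OF C_away(1), symmetric]
        by (rule F_p_eq) (auto simp: C_def)
      then show ?thesis
        by (subst ennreal_minus[symmetric]) simp_all
    qed
    have "incseq C"
    proof (rule incseq_SucI)
      fix n
      have "inverse (real (Suc (Suc n))) \<le> inverse (real (Suc n))" by simp
      then show "C n \<subseteq> C (Suc n)"
        unfolding C_def by (blast intro: order_trans)
    qed
    have "emeasure (F p) B = emeasure (F p) (\<Union>n. C n)"
    proof -
      have "p x = 0" if "x \<in> B" "x \<notin> (\<Union>n. C n)" for x
      proof (cases "x = 0 \<or> q1 x < q2 x")
        case False
        then obtain n where "inverse (real (Suc n)) < norm x"
          using reals_Archimedean[of "norm x"] by auto
        then have "x \<in> C n"
          unfolding C_def using that(1) False by (auto intro: less_imp_le)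
        then show ?thesis using that by auto
      qed (use q1_nn q2_nn in \<open>auto simp: p_def\<close>)
      moreover have "(\<Union>n. C n) \<subseteq> B" using C_away by auto
      ultimately show ?thesis
        by (simp add: F_emeasure) (intro nn_integral_cong, auto simp: indicator_def)
    qed
    also have "\<dots> = (SUP n. emeasure (F p) (C n))"
      using \<open>incseq C\<close> by (intro SUP_emeasure_incseq[symmetric]) (auto simp: F_def \<mu>)
    also have "\<dots> \<le> ?sup"
      unfolding C_val using C_away by (intro SUP_least SUP_upper) auto
    finally show "emeasure (F p) B \<le> ?sup" .
  qed
  then have "jordan_pos borel norm (\<lambda>B. measure (F q1) B - measure (F q2) B) =
      measure_of UNIV (sets borel) (emeasure (F p))"
    unfolding jordan_pos_def space_borel
    using sets.sigma_sets_eq[of "borel :: real measure"] by (intro measure_of_eq) auto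
  also have "\<dots> = F p"
    using measure_of_of_measure[of "F p"] sets_eq_imp_space_eq[OF \<mu>] by (simp add: F_def \<mu>)
  finally show ?thesis
    by (simp add: F_def p_def)
qed

text \<open>
  The Jordan parts of the difference are smaller than the two measures, because common mass cancels.
  The cancelled mass contributes equally to both integrals on the right.
\<close>

lemma signed_integral_levy_difference:
  fixes F1 F2 :: "real measure" and g :: "real \<Rightarrow> complex"
  assumes F1: "levy_measure F1" and F2: "levy_measure F2"
    and g1: "integrable F1 g" and g2: "integrable F2 g"
  shows "signed_integral borel norm (\<lambda>B. measure F1 B - measure F2 B) g = (\<integral>x. g x \<partial>F1) - (\<integral>x. g x \<partial>F2)"
proof -
  obtain \<mu> q1 q2 where \<mu> [measurable_cong]: "sets \<mu> = sets borel"
    and q1 [measurable]: "q1 \<in> borel_measurable borel" and q1_nn: "\<And>x. 0 \<le> q1 x" "q1 0 = 0"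
    and d1: "F1 = density \<mu> (\<lambda>x. ennreal (q1 x))"
    and q2 [measurable]: "q2 \<in> borel_measurable borel" and q2_nn: "\<And>x. 0 \<le> q2 x" "q2 0 = 0"
    and d2: "F2 = density \<mu> (\<lambda>x. ennreal (q2 x))"
    by (rule levy_measures_common_density[OF F1 F2]) blast
  have [measurable]: "g \<in> borel_measurable borel"
    using borel_measurable_integrable[OF g1] F1 by (simp add: levy_measure_def cong: measurable_cong_sets)
  have pos: "jordan_pos borel norm (\<lambda>B. measure F1 B - measure F2 B) = density \<mu> (\<lambda>x. ennreal (max 0 (q1 x - q2 x)))"
    unfolding d1 d2 using q1_nn q2_nn F1 F2 by (intro jordan_pos_density_difference) (auto simp: \<mu> d1 d2)
  have neg: "jordan_neg borel norm (\<lambda>B. measure F1 B - measure F2 B) = density \<mu> (\<lambda>x. ennreal (max 0 (q2 x - q1 x)))"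
    unfolding jordan_neg_def minus_diff_eq d1 d2
    using q1_nn q2_nn F1 F2 by (intro jordan_pos_density_difference) (auto simp: \<mu> d1 d2)
  have int: "integrable \<mu> (\<lambda>x. q1 x *\<^sub>R g x)" "integrable \<mu> (\<lambda>x. q2 x *\<^sub>R g x)"
    using g1 g2 q1_nn q2_nn unfolding d1 d2 by (auto simp: integrable_density)
  have int_max: "integrable \<mu> (\<lambda>x. max 0 (q1 x - q2 x) *\<^sub>R g x)" "integrable \<mu> (\<lambda>x. max 0 (q2 x - q1 x) *\<^sub>R g x)"
  proof -
    have "norm (max 0 (q1 x - q2 x) *\<^sub>R g x) \<le> norm (q1 x *\<^sub>R g x)"
      "norm (max 0 (q2 x - q1 x) *\<^sub>R g x) \<le> norm (q2 x *\<^sub>R g x)" for x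
      using q1_nn(1)[of x] q2_nn(1)[of x] by (auto intro!: mult_right_mono)
    then show "integrable \<mu> (\<lambda>x. max 0 (q1 x - q2 x) *\<^sub>R g x)" "integrable \<mu> (\<lambda>x. max 0 (q2 x - q1 x) *\<^sub>R g x)"
      by (intro Bochner_Integration.integrable_bound[OF int(1)] Bochner_Integration.integrable_bound[OF int(2)]; auto)+
  qed
  have "signed_integral borel norm (\<lambda>B. measure F1 B - measure F2 B) g =
      (\<integral>x. max 0 (q1 x - q2 x) *\<^sub>R g x \<partial>\<mu>) - (\<integral>x. max 0 (q2 x - q1 x) *\<^sub>R g x \<partial>\<mu>)"
    unfolding signed_integral_def pos neg by (intro arg_cong2[where f = minus] integral_density) auto
  also have "\<dots> = (\<integral>x. max 0 (q1 x - q2 x) *\<^sub>R g x - max 0 (q2 x - q1 x) *\<^sub>R g x \<partial>\<mu>)"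
    using int_max by simp
  also have "\<dots> = (\<integral>x. q1 x *\<^sub>R g x - q2 x *\<^sub>R g x \<partial>\<mu>)"
    by (intro Bochner_Integration.integral_cong) (auto simp: max_def scaleR_diff_left[symmetric])
  also have "\<dots> = (\<integral>x. q1 x *\<^sub>R g x \<partial>\<mu>) - (\<integral>x. q2 x *\<^sub>R g x \<partial>\<mu>)"
    using int by simp
  also have "\<dots> = (\<integral>x. g x \<partial>F1) - (\<integral>x. g x \<partial>F2)"
    unfolding d1 d2 using q1_nn q2_nn by (simp add: integral_density)
  finally show ?thesis .
qed

section \<open>Kernel integrals as exponent functionals\<close>

lemma (in exponent_functional) exponent_functional_scale: "exponent_functional \<kappa> (\<lambda>h. a * E h)"
proof
  show "a * E (\<lambda>u. g u + h u) = a * E g + a * E h"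
    if "g \<in> borel_measurable \<kappa>" "h \<in> borel_measurable \<kappa>" "\<And>u. u \<in> space \<kappa> \<Longrightarrow> \<bar>g u\<bar> \<le> C"
      "\<And>u. u \<in> space \<kappa> \<Longrightarrow> \<bar>h u\<bar> \<le> C" "\<And>u. u \<in> space \<kappa> \<Longrightarrow> g u = 0 \<or> h u = 0" for g h C
    using E_add[OF that] by (simp add: distrib_left)
  show "(\<lambda>k. a * E (g k)) \<longlonglongrightarrow> a * E h"
    if "\<And>k. g k \<in> borel_measurable \<kappa>" "h \<in> borel_measurable \<kappa>"
      "\<And>k u. u \<in> space \<kappa> \<Longrightarrow> \<bar>g k u\<bar> \<le> C" "AE u in \<kappa>. (\<lambda>k::nat. g k u) \<longlonglongrightarrow> h u" for g h C
    using E_tendsto[OF that] by (intro tendsto_mult tendsto_const)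
qed

lemma exponent_functional_plus:
  assumes "exponent_functional \<kappa> E1" "exponent_functional \<kappa> E2"
  shows "exponent_functional \<kappa> (\<lambda>h. E1 h + E2 h)"
proof
  show "E1 (\<lambda>u. g u + h u) + E2 (\<lambda>u. g u + h u) = E1 g + E2 g + (E1 h + E2 h)"
    if "g \<in> borel_measurable \<kappa>" "h \<in> borel_measurable \<kappa>" "\<And>u. u \<in> space \<kappa> \<Longrightarrow> \<bar>g u\<bar> \<le> C"
      "\<And>u. u \<in> space \<kappa> \<Longrightarrow> \<bar>h u\<bar> \<le> C" "\<And>u. u \<in> space \<kappa> \<Longrightarrow> g u = 0 \<or> h u = 0" for g h C
    using exponent_functional.E_add[OF assms(1) that] exponent_functional.E_add[OF assms(2) that] by simp
  show "(\<lambda>k. E1 (g k) + E2 (g k)) \<longlonglongrightarrow> E1 h + E2 h"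
    if "\<And>k. g k \<in> borel_measurable \<kappa>" "h \<in> borel_measurable \<kappa>"
      "\<And>k u. u \<in> space \<kappa> \<Longrightarrow> \<bar>g k u\<bar> \<le> C" "AE u in \<kappa>. (\<lambda>k::nat. g k u) \<longlonglongrightarrow> h u" for g h C
    using exponent_functional.E_tendsto[OF assms(1) that] exponent_functional.E_tendsto[OF assms(2) that]
    by (intro tendsto_add)
qed

text \<open>
  The Gaussian part and the jump part are both integrals of a kernel along a map \<open>p\<close> into the space of
  the random measure. Points at which the kernel vanishes for all \<open>t\<close> may be mapped into null sets, as
  happens for eigenvectors of the covariance operator with eigenvalue zero.
\<close>

lemma exponent_functional_kernel:
  fixes p :: "'w \<Rightarrow> 'u" and k :: "real \<Rightarrow> 'w \<Rightarrow> complex"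
  assumes p: "p \<in> measurable N \<kappa>"
    and null: "\<And>A. A \<in> null_sets \<kappa> \<Longrightarrow> AE w in N. p w \<in> A \<longrightarrow> (\<forall>t. k t w = 0)"
    and k_meas: "\<And>h. h \<in> borel_measurable \<kappa> \<Longrightarrow> (\<lambda>w. k (h (p w)) w) \<in> borel_measurable N"
    and k_zero: "\<And>w. k 0 w = 0" and k_cont: "\<And>t w. isCont (\<lambda>t. k t w) t"
    and k_bound: "\<And>C. \<exists>B. integrable N B \<and> (\<forall>t w. w \<in> space N \<longrightarrow> \<bar>t\<bar> \<le> C \<longrightarrow> norm (k t w) \<le> B w)"
  shows "exponent_functional \<kappa> (\<lambda>h. \<integral>w. k (h (p w)) w \<partial>N)"
proof
  have p_space: "p w \<in> space \<kappa>" if "w \<in> space N" for w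
    using p that by (rule measurable_space)
  have int: "integrable N (\<lambda>w. k (h (p w)) w)"
    if h: "h \<in> borel_measurable \<kappa>" "\<And>u. u \<in> space \<kappa> \<Longrightarrow> \<bar>h u\<bar> \<le> C" for h C
  proof -
    obtain B where B: "integrable N B" "\<And>t w. w \<in> space N \<Longrightarrow> \<bar>t\<bar> \<le> C \<Longrightarrow> norm (k t w) \<le> B w"
      using k_bound[of C] by blast
    have "norm (k (h (p w)) w) \<le> norm (B w)" if "w \<in> space N" for w
      using B(2)[OF that h(2)[OF p_space[OF that]]] by (simp add: order_trans[OF _ abs_ge_self])
    then show ?thesis
      by (intro Bochner_Integration.integrable_bound[OF B(1)] k_meas h AE_I2)
  qed
  show "(\<integral>w. k (g (p w) + h (p w)) w \<partial>N) = (\<integral>w. k (g (p w)) w \<partial>N) + (\<integral>w. k (h (p w)) w \<partial>N)"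
    if "g \<in> borel_measurable \<kappa>" "h \<in> borel_measurable \<kappa>" "\<And>u. u \<in> space \<kappa> \<Longrightarrow> \<bar>g u\<bar> \<le> C"
      "\<And>u. u \<in> space \<kappa> \<Longrightarrow> \<bar>h u\<bar> \<le> C" and disj: "\<And>u. u \<in> space \<kappa> \<Longrightarrow> g u = 0 \<or> h u = 0" for g h C
  proof -
    have "k (g (p w) + h (p w)) w = k (g (p w)) w + k (h (p w)) w" if "w \<in> space N" for w
      using disj[OF p_space[OF that]] k_zero[of w] by auto
    then have "(\<integral>w. k (g (p w) + h (p w)) w \<partial>N) = (\<integral>w. k (g (p w)) w + k (h (p w)) w \<partial>N)"
      by (intro Bochner_Integration.integral_cong) auto
    also have "\<dots> = (\<integral>w. k (g (p w)) w \<partial>N) + (\<integral>w. k (h (p w)) w \<partial>N)"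
      using that by (intro Bochner_Integration.integral_add int)
    finally show ?thesis .
  qed
  show "(\<lambda>n. \<integral>w. k (g n (p w)) w \<partial>N) \<longlonglongrightarrow> (\<integral>w. k (h (p w)) w \<partial>N)"
    if g: "\<And>n. g n \<in> borel_measurable \<kappa>" and h: "h \<in> borel_measurable \<kappa>"
      and bound: "\<And>n u. u \<in> space \<kappa> \<Longrightarrow> \<bar>g n u\<bar> \<le> C"
      and lim: "AE u in \<kappa>. (\<lambda>n::nat. g n u) \<longlonglongrightarrow> h u" for g h C
  proof -
    obtain B where B: "integrable N B" "\<And>t w. w \<in> space N \<Longrightarrow> \<bar>t\<bar> \<le> C \<Longrightarrow> norm (k t w) \<le> B w"
      using k_bound[of C] by blast
    obtain A where A: "A \<in> null_sets \<kappa>" "{u \<in> space \<kappa>. \<not> (\<lambda>n. g n u) \<longlonglongrightarrow> h u} \<subseteq> A"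
      using lim by (auto simp: eventually_ae_filter)
    show ?thesis
    proof (rule integral_dominated_convergence[OF _ _ B(1)])
      show "AE w in N. (\<lambda>n. k (g n (p w)) w) \<longlonglongrightarrow> k (h (p w)) w"
        using null[OF A(1)] AE_space
      proof eventually_elim
        case (elim w)
        show ?case
        proof (cases "p w \<in> A")
          case False
          then have "(\<lambda>n. g n (p w)) \<longlonglongrightarrow> h (p w)"
            using A(2) p_space[OF elim(2)] by auto
          then show ?thesis
            by (rule isCont_tendsto_compose[OF k_cont])
        qed (use elim in simp)
      qed
      show "AE w in N. norm (k (g n (p w)) w) \<le> B w" for n
        using B(2) bound p_space by (intro AE_I2) auto
    qed (use k_meas g h in auto)
  qed
qed

section \<open>Levy measures in polar coordinates\<close>

lemma sets_sphere_space: "A \<in> sets sphere_space \<longleftrightarrow> A \<in> sets borel \<and> A \<subseteq> unit_sphere"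
proof -
  have "closed {u :: l2. norm u = 1}"
    by (intro closed_Collect_eq continuous_intros)
  moreover have "unit_sphere = {u :: l2. norm u = 1}"
    by auto
  ultimately have "unit_sphere \<in> sets borel"
    by simp
  then show ?thesis
    unfolding sphere_space_def by (subst sets_restrict_space_iff) auto
qed

lemma space_sphere_space: "space sphere_space = unit_sphere"
  by (simp add: sphere_space_def space_restrict_space)

definition jump_kernel :: "real \<Rightarrow> real \<Rightarrow> complex" where
  "jump_kernel \<theta> x = iexp (\<theta> * x) - 1 - \<i> * of_real (\<theta> * trunc x)"

lemma continuous_trunc: "continuous_on UNIV (trunc :: real \<Rightarrow> real)"
proof -
  have "trunc x = max (-1) (min 1 x)" for x :: real
    by (auto simp: trunc_def max_def min_def abs_if divide_simps)
  then have eq: "(trunc :: real \<Rightarrow> real) = (\<lambda>x. max (-1) (min 1 x))"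
    by (rule ext)
  show ?thesis
    unfolding eq by (intro continuous_intros)
qed

lemma measurable_trunc [measurable]: "(trunc :: real \<Rightarrow> real) \<in> borel_measurable borel"
  by (rule borel_measurable_continuous_onI[OF continuous_trunc])

lemma measurable_jump_kernel [measurable (raw)]:
  assumes [measurable]: "f \<in> borel_measurable M" "g \<in> borel_measurable M"
  shows "(\<lambda>w. jump_kernel (f w) (g w)) \<in> borel_measurable M"
  unfolding jump_kernel_def by measurable

lemma jump_kernel_zero [simp]: "jump_kernel 0 x = 0" "jump_kernel \<theta> 0 = 0"
  by (simp_all add: jump_kernel_def trunc_def)

lemma isCont_jump_kernel: "isCont (\<lambda>\<theta>. jump_kernel \<theta> x) \<theta>"
  unfolding jump_kernel_def by (intro continuous_intros)

lemma jump_kernel_bound: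
  assumes "\<bar>\<theta>\<bar> \<le> C"
  shows "norm (jump_kernel \<theta> x) \<le> (2 + C + C\<^sup>2) * min 1 (x\<^sup>2)"
proof -
  have C: "0 \<le> C" using assms by simp
  have \<theta>2: "\<theta>\<^sup>2 \<le> C\<^sup>2"
    using assms by (simp add: abs_le_square_iff[symmetric])
  show ?thesis
  proof (cases "\<bar>x\<bar> \<le> 1")
    case True
    have "norm (jump_kernel \<theta> x) \<le> (\<theta> * x)\<^sup>2 / 2"
      using iexp_approx1[of "\<theta> * x" 1] True
      by (simp add: jump_kernel_def trunc_def numeral_2_eq_2[symmetric] algebra_simps)
    also have "\<dots> \<le> (2 + C + C\<^sup>2) * x\<^sup>2"
    proof -
      have "\<theta>\<^sup>2 / 2 \<le> 2 + C + C\<^sup>2"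
        using \<theta>2 C zero_le_power2[of C] by linarith
      then have "\<theta>\<^sup>2 / 2 * x\<^sup>2 \<le> (2 + C + C\<^sup>2) * x\<^sup>2"
        by (intro mult_right_mono) auto
      then show ?thesis by (simp add: power_mult_distrib)
    qed
    also have "x\<^sup>2 = min 1 (x\<^sup>2)"
      using True by (simp add: min_def abs_le_square_iff[of x 1, simplified])
    finally show ?thesis .
  next
    case False
    have "norm (jump_kernel \<theta> x) \<le> norm (iexp (\<theta> * x) - 1) + norm (\<i> * of_real (\<theta> * trunc x) :: complex)"
      unfolding jump_kernel_def by (rule norm_triangle_ineq4)
    also have "norm (iexp (\<theta> * x) - 1) \<le> 2"
      using norm_triangle_ineq4[of "iexp (\<theta> * x)" 1] by simp
    also have "norm (\<i> * of_real (\<theta> * trunc x) :: complex) \<le> C"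
    proof -
      have "\<bar>trunc x\<bar> \<le> 1"
        using False by (simp add: trunc_def abs_mult)
      then have "\<bar>\<theta>\<bar> * \<bar>trunc x\<bar> \<le> C * 1"
        using assms C by (intro mult_mono) auto
      then show ?thesis
        by (simp add: norm_mult abs_mult)
    qed
    also have "2 + C \<le> (2 + C + C\<^sup>2) * min 1 (x\<^sup>2)"
      using False by (simp add: min_def abs_le_square_iff[of x 1, simplified])
    finally show ?thesis by simp
  qed
qed

text \<open>
  Borel sets of \<open>l2 \<times> real\<close> are reached through continuous functions on the product, not through a product
  sigma-algebra: a rectangle is an intersection of preimages under the two projections.
\<close>

locale polar_levy_measure =
  fixes M :: "l2 measure" and F :: "(l2 \<times> real) measure"
  assumes M: "levy_measure M" and F: "polar_measure M F"
begin

lemma sets_F: "sets F = sets (restrict_space borel (unit_sphere \<times> {0<..}))"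
  and M_eq: "M = distr F borel (\<lambda>(u, x). x *\<^sub>R u)"
  using F by (simp_all add: polar_measure_def)

lemma space_F: "space F = unit_sphere \<times> {0<..}"
  using sets_eq_imp_space_eq[OF sets_F] by (simp add: space_restrict_space)

lemma measurable_continuous_F:
  fixes g :: "l2 \<times> real \<Rightarrow> 'b::topological_space"
  assumes "continuous_on UNIV g"
  shows "g \<in> borel_measurable F"
proof -
  have "g \<in> borel_measurable (restrict_space borel (unit_sphere \<times> {0<..}))"
    by (intro measurable_restrict_space1 borel_measurable_continuous_onI assms)
  then show ?thesis
    by (simp cong: measurable_cong_sets add: sets_F measurable_cong_sets[OF sets_F refl])
qed

lemma measurable_polar [measurable]:
  "fst \<in> measurable F sphere_space" "snd \<in> borel_measurable F"
  "(\<lambda>(u, x). x *\<^sub>R u) \<in> borel_measurable F" "(\<lambda>w. snd w *\<^sub>R fst w) \<in> borel_measurable F"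
proof -
  show "snd \<in> borel_measurable F"
    by (intro measurable_continuous_F continuous_intros)
  show "(\<lambda>w. snd w *\<^sub>R fst w) \<in> borel_measurable F"
    by (intro measurable_continuous_F continuous_intros)
  then show "(\<lambda>(u, x). x *\<^sub>R u) \<in> borel_measurable F"
    by (simp add: case_prod_beta')
  have "fst \<in> borel_measurable F"
    by (intro measurable_continuous_F continuous_intros)
  then show "fst \<in> measurable F sphere_space"
    unfolding sphere_space_def by (intro measurable_restrict_space2) (auto simp: space_F)
qed

lemma min_one_integrable: "integrable F (\<lambda>w. min 1 ((snd w)\<^sup>2))"
proof (rule integrableI_nonneg)
  have "(\<integral>\<^sup>+v. ennreal (min 1 ((norm v)\<^sup>2)) \<partial>M) = (\<integral>\<^sup>+w. ennreal (min 1 ((norm (snd w *\<^sub>R fst w))\<^sup>2)) \<partial>F)"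
    unfolding M_eq case_prod_beta'
    by (subst nn_integral_distr) (auto intro!: measurable_compose[OF _ measurable_ennreal]
        borel_measurable_continuous_onI continuous_intros)
  also have "\<dots> = (\<integral>\<^sup>+w. ennreal (min 1 ((snd w)\<^sup>2)) \<partial>F)"
    by (intro nn_integral_cong) (auto simp: space_F)
  finally show "(\<integral>\<^sup>+w. ennreal (min 1 ((snd w)\<^sup>2)) \<partial>F) < \<infinity>"
    using M by (simp add: levy_measure_def)
qed auto

text \<open>As the image of a restriction of \<open>F\<close>, the radial measure inherits its integrals from \<open>F\<close>.\<close>

lemma radial_measure_eq:
  assumes A: "A \<in> sets sphere_space"
  shows "radial_measure F A = distr (density F (\<lambda>w. indicator A (fst w))) borel snd"
    (is "_ = ?R")
proof -
  note A [measurable]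
  have "radial_measure F A = measure_of UNIV (sets borel) (emeasure ?R)"
    unfolding radial_measure_def
  proof (intro measure_of_eq)
    fix B :: "real set" assume "B \<in> sigma_sets UNIV (sets borel)"
    then have B [measurable]: "B \<in> sets borel"
      using sets.sigma_sets_eq[of "borel :: real measure"] by simp
    have AB: "A \<times> (B \<inter> {0<..}) = fst -` A \<inter> space F \<inter> (snd -` B \<inter> space F)"
      using A by (auto simp: space_F sets_sphere_space)
    have AB_sets: "A \<times> (B \<inter> {0<..}) \<in> sets F"
      unfolding AB by measurable
    have "emeasure ?R B = (\<integral>\<^sup>+w. indicator A (fst w) * indicator (snd -` B \<inter> space F) w \<partial>F)"
      by (simp add: emeasure_distr emeasure_density)
    also have "\<dots> = (\<integral>\<^sup>+w. indicator (A \<times> (B \<inter> {0<..})) w \<partial>F)"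
      by (intro nn_integral_cong) (auto simp: indicator_def space_F)
    also have "\<dots> = emeasure F (A \<times> (B \<inter> {0<..}))"
      using AB_sets by simp
    finally show "emeasure F (A \<times> (B \<inter> {0<..})) = emeasure ?R B" ..
  qed simp
  also have "\<dots> = ?R"
    using measure_of_of_measure[of ?R] by simp
  finally show ?thesis .
qed

lemma nn_integral_radial_measure:
  assumes A [measurable]: "A \<in> sets sphere_space" and [measurable]: "g \<in> borel_measurable borel"
  shows "(\<integral>\<^sup>+x. g x \<partial>radial_measure F A) = (\<integral>\<^sup>+w. indicator A (fst w) * g (snd w) \<partial>F)"
  unfolding radial_measure_eq[OF A] by (simp add: nn_integral_distr nn_integral_density)

lemma jump_mass_eq:
  assumes A [measurable]: "A \<in> sets sphere_space"
  shows "jump_mass F A = emeasure (distr (density F (\<lambda>w. ennreal (min 1 ((snd w)\<^sup>2)))) sphere_space fst) A"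
proof -
  have "jump_mass F A = (\<integral>\<^sup>+w. indicator A (fst w) * ennreal (min 1 ((snd w)\<^sup>2)) \<partial>F)"
    unfolding jump_mass_def by (intro nn_integral_radial_measure A) auto
  also have "\<dots> = (\<integral>\<^sup>+w. ennreal (min 1 ((snd w)\<^sup>2)) * indicator (fst -` A \<inter> space F) w \<partial>F)"
    by (intro nn_integral_cong) (auto simp: indicator_def)
  finally show ?thesis
    by (simp add: emeasure_distr emeasure_density)
qed

lemma levy_measure_radial:
  assumes A: "A \<in> sets sphere_space"
  shows "levy_measure (radial_measure F A)"
  unfolding levy_measure_def
proof (intro conjI)
  note A [measurable]
  show "sets (radial_measure F A) = sets borel"
    by (simp add: radial_measure_eq[OF A])
  have "emeasure (radial_measure F A) {0} = (\<integral>\<^sup>+x. indicator {0} x \<partial>radial_measure F A)"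
    by (simp add: radial_measure_eq[OF A])
  also have "\<dots> = (\<integral>\<^sup>+w. indicator A (fst w) * indicator {0} (snd w) \<partial>F)"
    by (rule nn_integral_radial_measure[OF A]) simp
  also have "\<dots> = (\<integral>\<^sup>+w. 0 \<partial>F)"
    by (intro nn_integral_cong) (auto simp: space_F indicator_def)
  finally show "emeasure (radial_measure F A) {0} = 0" by simp
  have "(\<integral>\<^sup>+x. ennreal (min 1 ((norm x)\<^sup>2)) \<partial>radial_measure F A) \<le> (\<integral>\<^sup>+w. ennreal (min 1 ((snd w)\<^sup>2)) \<partial>F)"
    by (subst nn_integral_radial_measure[OF A]) (auto intro!: nn_integral_mono simp: indicator_def)
  also have "\<dots> < \<infinity>"
    using min_one_integrable by (simp add: nn_integral_eq_integral)
  finally show "(\<integral>\<^sup>+x. ennreal (min 1 ((norm x)\<^sup>2)) \<partial>radial_measure F A) < \<infinity>" .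
qed

lemma integrable_jump_kernel: "integrable F (\<lambda>w. jump_kernel \<theta> (snd w))"
proof (rule Bochner_Integration.integrable_bound[OF integrable_mult_right[OF min_one_integrable]])
  show "AE w in F. norm (jump_kernel \<theta> (snd w)) \<le> norm ((2 + \<bar>\<theta>\<bar> + \<bar>\<theta>\<bar>\<^sup>2) * min 1 ((snd w)\<^sup>2))"
    using jump_kernel_bound[of \<theta> "\<bar>\<theta>\<bar>"] by (intro AE_I2 order_trans[OF _ abs_ge_self[folded real_norm_def]]) simp
qed measurable

text \<open>
  For general \<open>h\<close> the kernel depends on both polar coordinates, so the exponent is an integral over \<open>F\<close>. For
  multiples of the indicator of \<open>A\<close> it reduces to an integral over \<open>radial_measure F A\<close>.
\<close>

definition jump_exponent :: "(l2 \<Rightarrow> real) \<Rightarrow> complex" where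
  "jump_exponent h = (\<integral>w. jump_kernel (h (fst w)) (snd w) \<partial>F)"

lemma integral_jump_kernel_radial:
  assumes A: "A \<in> sets sphere_space"
  shows "integrable (radial_measure F A) (jump_kernel \<theta>)"
    and "(\<integral>x. jump_kernel \<theta> x \<partial>radial_measure F A) = jump_exponent (\<lambda>u. \<theta> * indicator A u)"
proof -
  note A [measurable]
  have dens: "density F (\<lambda>w. indicator A (fst w)) = density F (\<lambda>w. ennreal (indicator A (fst w)))"
    by (simp add: ennreal_indicator)
  have eq: "indicator A (fst w) *\<^sub>R jump_kernel \<theta> (snd w) = jump_kernel (\<theta> * indicator A (fst w)) (snd w)" for w :: "l2 \<times> real"
    by (simp add: indicator_def)
  have "integrable F (\<lambda>w. indicator A (fst w) *\<^sub>R jump_kernel \<theta> (snd w))"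
    by (rule Bochner_Integration.integrable_bound[OF integrable_jump_kernel[of \<theta>]]) (auto simp: indicator_def)
  then show "integrable (radial_measure F A) (jump_kernel \<theta>)"
    unfolding radial_measure_eq[OF A] dens
    by (subst integrable_distr_eq) (auto simp: integrable_density)
  show "(\<integral>x. jump_kernel \<theta> x \<partial>radial_measure F A) = jump_exponent (\<lambda>u. \<theta> * indicator A u)"
    unfolding radial_measure_eq[OF A] dens jump_exponent_def eq[symmetric]
    by (subst integral_distr) (auto simp: integral_density)
qed

text \<open>
  On the unit sphere \<open>trunc (x *\<^sub>R u) = trunc x *\<^sub>R u\<close> for \<open>x > 0\<close>, so the compensating terms on \<open>l2\<close> and on
  the real line agree in polar coordinates.
\<close>

lemma jump_exponent_inner:
  "jump_exponent (\<lambda>u. inner y u) = (\<integral>v. iexp (inner y v) - 1 - \<i> * of_real (inner (trunc v) y) \<partial>M)"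
proof -
  have trunc_meas: "(trunc :: l2 \<Rightarrow> l2) \<in> borel_measurable borel"
  proof -
    have eq: "(trunc :: l2 \<Rightarrow> l2) = (\<lambda>v. (1 / max 1 (norm v)) *\<^sub>R v)"
      by (auto simp: trunc_def fun_eq_iff max_def inverse_eq_divide)
    have "continuous_on UNIV (\<lambda>v :: l2. (1 / max 1 (norm v)) *\<^sub>R v)"
      by (intro continuous_intros) (auto simp: max_def)
    then show ?thesis
      unfolding eq by (rule borel_measurable_continuous_onI)
  qed
  have inner_meas: "(\<lambda>v. inner v y) \<in> borel_measurable borel" for y :: l2
    by (intro borel_measurable_continuous_onI continuous_intros)
  have [measurable]: "(\<lambda>v. inner y v) \<in> borel_measurable borel" "(\<lambda>v. inner (trunc v) y) \<in> borel_measurable borel"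
    using inner_meas[of y] measurable_compose[OF trunc_meas inner_meas[of y]] by (simp_all add: inner_commute)
  have "(\<integral>v. iexp (inner y v) - 1 - \<i> * of_real (inner (trunc v) y) \<partial>M) =
      (\<integral>w. iexp (inner y (snd w *\<^sub>R fst w)) - 1 - \<i> * of_real (inner (trunc (snd w *\<^sub>R fst w)) y) \<partial>F)"
    unfolding M_eq case_prod_beta' by (subst integral_distr) auto
  also have "\<dots> = jump_exponent (\<lambda>u. inner y u)"
    unfolding jump_exponent_def
  proof (intro Bochner_Integration.integral_cong refl)
    fix w assume "w \<in> space F"
    then have w: "norm (fst w) = 1" "0 < snd w"
      by (auto simp: space_F)
    then have "trunc (snd w *\<^sub>R fst w) = trunc (snd w) *\<^sub>R fst w"
      by (auto simp: trunc_def)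
    then show "iexp (inner y (snd w *\<^sub>R fst w)) - 1 - \<i> * of_real (inner (trunc (snd w *\<^sub>R fst w)) y) =
        jump_kernel (inner y (fst w)) (snd w)"
      by (simp add: jump_kernel_def inner_commute mult.commute)
  qed
  finally show ?thesis ..
qed

lemma exponent_functional_jump:
  assumes \<kappa>: "sets \<kappa> = sets sphere_space"
    and null: "\<And>A. A \<in> null_sets \<kappa> \<Longrightarrow> jump_mass F A = 0"
  shows "exponent_functional \<kappa> jump_exponent"
  unfolding jump_exponent_def[abs_def]
proof (rule exponent_functional_kernel)
  have [measurable_cong]: "sets \<kappa> = sets sphere_space" by fact
  show fst_meas: "fst \<in> measurable F \<kappa>"
    using measurable_polar(1) measurable_cong_sets[OF refl \<kappa>, of F] by simp
  show "AE w in F. fst w \<in> A \<longrightarrow> (\<forall>t. jump_kernel t (snd w) = 0)" if A: "A \<in> null_sets \<kappa>" for A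
  proof -
    have [measurable]: "A \<in> sets sphere_space" using A \<kappa> by auto
    have "(\<integral>\<^sup>+w. indicator A (fst w) * ennreal (min 1 ((snd w)\<^sup>2)) \<partial>F) = jump_mass F A"
      unfolding jump_mass_def by (intro nn_integral_radial_measure[symmetric]) auto
    then have "AE w in F. indicator A (fst w) * ennreal (min 1 ((snd w)\<^sup>2)) = 0"
      unfolding null[OF A] by (subst (asm) nn_integral_0_iff_AE) auto
    then show ?thesis
      using AE_space by eventually_elim (auto simp: space_F indicator_def min_def split: if_splits)
  qed
  show "(\<lambda>w. jump_kernel (h (fst w)) (snd w)) \<in> borel_measurable F" if [measurable]: "h \<in> borel_measurable \<kappa>" for h
  proof -
    have [measurable]: "(\<lambda>w. h (fst w)) \<in> borel_measurable F"
      by (rule measurable_compose[OF fst_meas that])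
    show ?thesis by measurable
  qed
  show "\<exists>B. integrable F B \<and> (\<forall>t w. w \<in> space F \<longrightarrow> \<bar>t\<bar> \<le> C \<longrightarrow> norm (jump_kernel t (snd w)) \<le> B w)" for C
    using jump_kernel_bound
    by (intro exI[of _ "\<lambda>w. (2 + C + C\<^sup>2) * min 1 ((snd w)\<^sup>2)"] conjI integrable_mult_right min_one_integrable) auto
qed (auto intro: isCont_jump_kernel)

end

section \<open>Drift, Gaussian part and control measures\<close>

definition drift_exponent :: "l2 \<Rightarrow> (l2 \<Rightarrow> real) \<Rightarrow> complex" where
  "drift_exponent z h = (if z = 0 then 0 else of_real (norm z * h (z /\<^sub>R norm z)))"

text \<open>
  Written over the counting measure, the series is one of the kernel integrals treated above.
\<close>

definition gauss_exponent :: "(nat \<Rightarrow> real) \<Rightarrow> (nat \<Rightarrow> l2) \<Rightarrow> (l2 \<Rightarrow> real) \<Rightarrow> complex" where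
  "gauss_exponent \<beta> e h = (\<integral>j. of_real (\<beta> j * (h (e j))\<^sup>2) \<partial>count_space UNIV)"

lemma drift_exponent_indicator: "drift_exponent z (\<lambda>u. t * indicator A u) = of_real (t * nu0 z A)"
  by (simp add: drift_exponent_def nu0_def)

lemma drift_exponent_inner: "drift_exponent z (\<lambda>u. inner y u) = of_real (inner z y)"
  by (simp add: drift_exponent_def inner_commute)

definition nu0_measure :: "l2 \<Rightarrow> l2 measure" where
  "nu0_measure z = (if z = 0 then null_measure sphere_space
    else density (return sphere_space (z /\<^sub>R norm z)) (\<lambda>_. ennreal (norm z)))"

lemma sets_nu0_measure [simp]: "sets (nu0_measure z) = sets sphere_space"
  by (simp add: nu0_measure_def)

lemma nu0_eq_emeasure:
  assumes "A \<in> sets sphere_space"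
  shows "ennreal (nu0 z A) = emeasure (nu0_measure z) A"
proof (cases "z = 0")
  case False
  then have [simp]: "z /\<^sub>R norm z \<in> space sphere_space"
    by (simp add: space_sphere_space)
  show ?thesis
    using False assms
    by (simp add: nu0_def nu0_measure_def emeasure_density nn_integral_cmult ennreal_mult ennreal_indicator)
qed (use assms in \<open>simp add: nu0_def nu0_measure_def\<close>)

text \<open>A direction with positive mass lies in no null set, so convergence almost everywhere includes it.\<close>

lemma exponent_functional_drift:
  assumes \<kappa>: "sets \<kappa> = sets sphere_space"
    and null: "\<And>A. A \<in> null_sets \<kappa> \<Longrightarrow> nu0 z A = 0"
  shows "exponent_functional \<kappa> (drift_exponent z)"
proof
  show "drift_exponent z (\<lambda>u. g u + h u) = drift_exponent z g + drift_exponent z h" for g h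
    by (simp add: drift_exponent_def distrib_left)
  show "(\<lambda>k. drift_exponent z (g k)) \<longlonglongrightarrow> drift_exponent z h"
    if lim: "AE u in \<kappa>. (\<lambda>k::nat. g k u) \<longlonglongrightarrow> h u" for g h
  proof (cases "z = 0")
    case False
    obtain A where A: "A \<in> null_sets \<kappa>" "{u \<in> space \<kappa>. \<not> (\<lambda>k. g k u) \<longlonglongrightarrow> h u} \<subseteq> A"
      using lim by (auto simp: eventually_ae_filter)
    have "z /\<^sub>R norm z \<in> space \<kappa>"
      using False sets_eq_imp_space_eq[OF \<kappa>] by (simp add: space_sphere_space)
    moreover have "z /\<^sub>R norm z \<notin> A"
      using null[OF A(1)] False by (auto simp: nu0_def indicator_def split: if_splits)
    ultimately have "(\<lambda>k. g k (z /\<^sub>R norm z)) \<longlonglongrightarrow> h (z /\<^sub>R norm z)"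
      using A(2) by auto
    then show ?thesis
      using False by (simp add: drift_exponent_def tendsto_intros)
  qed (simp add: drift_exponent_def)
qed

locale gauss_spectrum =
  fixes \<beta> :: "nat \<Rightarrow> real" and e :: "nat \<Rightarrow> l2"
  assumes \<beta>_nonneg: "\<And>j. 0 \<le> \<beta> j" and \<beta>_summable: "summable \<beta>"
    and e_norm: "\<And>j. inner (e j) (e j) = 1"
begin

lemma e_sphere: "e j \<in> space sphere_space"
  using e_norm[of j] by (simp add: space_sphere_space norm_eq_sqrt_inner)

lemma gauss_integrable:
  assumes "\<And>j. \<bar>x j\<bar> \<le> C"
  shows "integrable (count_space UNIV) (\<lambda>j. \<beta> j * x j)"
proof -
  have "summable (\<lambda>j. norm (\<beta> j * x j))"
  proof (rule summable_comparison_test'[of "\<lambda>j. \<beta> j * C" 0])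
    show "summable (\<lambda>j. \<beta> j * C)" by (intro summable_mult2 \<beta>_summable)
    show "norm (norm (\<beta> j * x j)) \<le> \<beta> j * C" for j
      using assms[of j] \<beta>_nonneg[of j] by (auto simp: abs_mult intro!: mult_left_mono)
  qed
  then show ?thesis
    by (simp add: integrable_count_space_nat_iff)
qed

lemma gauss_exponent_bounded:
  assumes "\<And>j. \<bar>h (e j)\<bar> \<le> C"
  shows "gauss_exponent \<beta> e h = of_real (\<Sum>j. \<beta> j * (h (e j))\<^sup>2)"
proof -
  have "\<bar>(h (e j))\<^sup>2\<bar> \<le> C\<^sup>2" for j
    using power_mono[OF assms[of j], of 2] by simp
  then show ?thesis
    unfolding gauss_exponent_def integral_complex_of_real
    by (intro arg_cong[where f = of_real] integral_count_space_nat gauss_integrable)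
qed

lemma gauss_exponent_indicator: "gauss_exponent \<beta> e (\<lambda>u. t * indicator A u) = of_real (t\<^sup>2 * nu1 \<beta> e A)"
proof -
  have "gauss_exponent \<beta> e (\<lambda>u. t * indicator A u) = of_real (\<Sum>j. \<beta> j * (t * indicator A (e j))\<^sup>2)"
    by (rule gauss_exponent_bounded[where C = "\<bar>t\<bar>"]) (simp add: indicator_def)
  also have "(\<lambda>j. \<beta> j * (t * indicator A (e j))\<^sup>2) = (\<lambda>j. t\<^sup>2 * (\<beta> j * indicator A (e j)))"
    by (simp add: indicator_def fun_eq_iff)
  also have "(\<Sum>j. t\<^sup>2 * (\<beta> j * indicator A (e j))) = t\<^sup>2 * nu1 \<beta> e A"
    unfolding nu1_def
    using \<beta>_nonneg by (intro suminf_mult summable_comparison_test'[OF \<beta>_summable, of 0]) (auto simp: indicator_def)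
  finally show ?thesis .
qed

lemma gauss_exponent_inner:
  assumes K: "\<And>y. (\<lambda>j. (\<beta> j * inner (e j) y) *\<^sub>R e j) sums K y"
  shows "gauss_exponent \<beta> e (\<lambda>u. inner y u) = of_real (inner y (K y))"
proof -
  have "(\<lambda>j. inner y ((\<beta> j * inner (e j) y) *\<^sub>R e j)) sums inner y (K y)"
    by (rule bounded_linear.sums[OF bounded_linear_inner_right K])
  then have "(\<lambda>j. \<beta> j * (inner y (e j))\<^sup>2) sums inner y (K y)"
    by (simp add: inner_commute power2_eq_square mult.assoc)
  then have "(\<Sum>j. \<beta> j * (inner y (e j))\<^sup>2) = inner y (K y)"
    by (simp add: sums_iff)
  moreover have "\<bar>inner y (e j)\<bar> \<le> norm y" for j
    using Cauchy_Schwarz_ineq2[of y "e j"] e_norm[of j] by (simp add: norm_eq_sqrt_inner)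
  ultimately show ?thesis
    by (subst gauss_exponent_bounded) simp_all
qed

lemma nu1_eq_emeasure:
  assumes A: "A \<in> sets sphere_space"
  shows "ennreal (nu1 \<beta> e A) =
    emeasure (distr (density (count_space UNIV) (\<lambda>j. ennreal (\<beta> j))) sphere_space e) A"
proof -
  have e: "e \<in> measurable (density (count_space UNIV) (\<lambda>j. ennreal (\<beta> j))) sphere_space"
    using e_sphere by simp
  have "emeasure (distr (density (count_space UNIV) (\<lambda>j. ennreal (\<beta> j))) sphere_space e) A =
      (\<integral>\<^sup>+j. ennreal (\<beta> j) * indicator (e -` A) j \<partial>count_space UNIV)"
    using e A by (simp add: emeasure_distr emeasure_density)
  also have "\<dots> = (\<Sum>j. ennreal (\<beta> j * indicator A (e j)))"
    by (subst nn_integral_count_space_nat) (auto intro!: suminf_cong simp: indicator_def)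
  also have "\<dots> = ennreal (\<Sum>j. \<beta> j * indicator A (e j))"
    using \<beta>_nonneg
    by (intro suminf_ennreal2 summable_comparison_test'[OF \<beta>_summable, of 0]) (auto simp: indicator_def)
  finally show ?thesis by (simp add: nu1_def)
qed

lemma exponent_functional_gauss:
  assumes \<kappa>: "sets \<kappa> = sets sphere_space"
    and null: "\<And>A. A \<in> null_sets \<kappa> \<Longrightarrow> nu1 \<beta> e A = 0"
  shows "exponent_functional \<kappa> (gauss_exponent \<beta> e)"
proof -
  have e_space: "e j \<in> space \<kappa>" for j
    using e_sphere sets_eq_imp_space_eq[OF \<kappa>] by simp
  show ?thesis
    unfolding gauss_exponent_def[abs_def]
  proof (rule exponent_functional_kernel)
    show "AE j in count_space UNIV. e j \<in> A \<longrightarrow> (\<forall>t. complex_of_real (\<beta> j * t\<^sup>2) = 0)"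
      if A: "A \<in> null_sets \<kappa>" for A
    proof -
      have s: "summable (\<lambda>j. \<beta> j * indicator A (e j))"
        using \<beta>_nonneg by (intro summable_comparison_test'[OF \<beta>_summable, of 0]) (auto simp: indicator_def)
      have "\<forall>j. \<beta> j * indicator A (e j) = 0"
        using null[OF A] \<beta>_nonneg unfolding nu1_def
        by (subst (asm) suminf_eq_zero_iff[OF s]) auto
      then show ?thesis
        by (auto simp: AE_count_space indicator_def split: if_splits)
    qed
    show "\<exists>B. integrable (count_space UNIV) B \<and> (\<forall>t j. j \<in> space (count_space UNIV) \<longrightarrow> \<bar>t\<bar> \<le> C \<longrightarrow>
        norm (complex_of_real (\<beta> j * t\<^sup>2)) \<le> B j)" for C
    proof (intro exI[of _ "\<lambda>j. \<beta> j * C\<^sup>2"] conjI allI impI)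
      show "integrable (count_space UNIV) (\<lambda>j. \<beta> j * C\<^sup>2)"
        by (rule gauss_integrable[of _ "C\<^sup>2"]) simp
      show "norm (complex_of_real (\<beta> j * t\<^sup>2)) \<le> \<beta> j * C\<^sup>2" if "\<bar>t\<bar> \<le> C" for t j
        using \<beta>_nonneg[of j] that power_mono[OF that, of 2]
        by (auto simp: norm_mult norm_power intro!: mult_left_mono)
    qed
  qed (use e_space in \<open>auto intro!: continuous_intros\<close>)
qed

end

lemma sets_measure_of_sphere: "sets (measure_of unit_sphere (sets sphere_space) f) = sets sphere_space"
  using sets.sigma_sets_eq[of sphere_space] sets.space_closed[of sphere_space]
  by (simp add: space_sphere_space)

text \<open>
  A control measure has the defining set function as its values because the latter is a finite sum
  of measures. Its null sets are then null for every component, which is what the exponent functionals require.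
\<close>

lemma emeasure_measure_of_sphere:
  assumes N: "\<And>N. N \<in> set Ns \<Longrightarrow> sets N = sets sphere_space" and A: "A \<in> sets sphere_space"
    and f: "\<And>A. A \<in> sets sphere_space \<Longrightarrow> f A = (\<Sum>N\<leftarrow>Ns. emeasure N A)"
  shows "emeasure (measure_of unit_sphere (sets sphere_space) f) A = f A"
proof (rule emeasure_measure_of[OF refl])
  show "sets sphere_space \<subseteq> Pow unit_sphere"
    using sets.space_closed[of sphere_space] by (simp add: space_sphere_space)
  note sets = sets_measure_of_sphere[of f]
  have f_nth: "f A = (\<Sum>i<length Ns. emeasure (Ns ! i) A)" if "A \<in> sets sphere_space" for A
    using f[OF that] by (simp add: sum_list_sum_nth atLeast0LessThan)
  show "A \<in> sets (measure_of unit_sphere (sets sphere_space) f)"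
    using A sets by simp
  show "positive (sets (measure_of unit_sphere (sets sphere_space) f)) f"
    unfolding sets positive_def using f_nth[of "{}"] by simp
  show "countably_additive (sets (measure_of unit_sphere (sets sphere_space) f)) f"
    unfolding sets countably_additive_def
  proof safe
    fix B :: "nat \<Rightarrow> l2 set"
    assume B: "range B \<subseteq> sets sphere_space" "disjoint_family B" "\<Union> (range B) \<in> sets sphere_space"
    have "(\<Sum>n. f (B n)) = (\<Sum>n. \<Sum>i<length Ns. emeasure (Ns ! i) (B n))"
      using B by (intro suminf_cong f_nth) auto
    also have "\<dots> = (\<Sum>i<length Ns. \<Sum>n. emeasure (Ns ! i) (B n))"
      by (rule suminf_sum) simp
    also have "\<dots> = (\<Sum>i<length Ns. emeasure (Ns ! i) (\<Union> (range B)))"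
      using B N by (intro sum.cong suminf_emeasure) auto
    finally show "(\<Sum>n. f (B n)) = f (\<Union> (range B))"
      using f_nth[OF B(3)] by simp
  qed
qed

lemma nu0_nonneg: "0 \<le> nu0 z A"
  by (simp add: nu0_def)

lemma (in gauss_spectrum) nu1_nonneg: "0 \<le> nu1 \<beta> e A"
  unfolding nu1_def using \<beta>_nonneg
  by (intro suminf_nonneg summable_comparison_test'[OF \<beta>_summable, of 0]) (auto simp: indicator_def)

lemma (in polar_levy_measure) null_control_Y:
  assumes "A \<in> null_sets (control_Y z F)"
  shows "nu0 z A = 0" "jump_mass F A = 0"
proof -
  have A: "A \<in> sets sphere_space"
    using assms by (auto simp: control_Y_def sets_measure_of_sphere)
  have "emeasure (control_Y z F) A = ennreal (nu0 z A) + jump_mass F A"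
    unfolding control_Y_def
    by (rule emeasure_measure_of_sphere[where Ns = "[nu0_measure z,
        distr (density F (\<lambda>w. ennreal (min 1 ((snd w)\<^sup>2)))) sphere_space fst]", OF _ A])
      (auto simp: nu0_eq_emeasure jump_mass_eq)
  then show "nu0 z A = 0" "jump_mass F A = 0"
    using assms nu0_nonneg[of z A] by (auto simp: null_sets_def ennreal_eq_0_iff)
qed

lemma (in gauss_spectrum) null_control_Z:
  assumes "polar_levy_measure M F" and null: "A \<in> null_sets (control_Z \<beta> e F)"
  shows "nu1 \<beta> e A = 0" "jump_mass F A = 0"
proof -
  interpret polar_levy_measure M F by fact
  have A: "A \<in> sets sphere_space"
    using null by (auto simp: control_Z_def sets_measure_of_sphere)
  have "emeasure (control_Z \<beta> e F) A = ennreal (nu1 \<beta> e A) + jump_mass F A"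
    unfolding control_Z_def
    by (rule emeasure_measure_of_sphere[where Ns = "[
        distr (density (count_space UNIV) (\<lambda>j. ennreal (\<beta> j))) sphere_space e,
        distr (density F (\<lambda>w. ennreal (min 1 ((snd w)\<^sup>2)))) sphere_space fst]", OF _ A])
      (auto simp: nu1_eq_emeasure jump_mass_eq)
  then show "nu1 \<beta> e A = 0" "jump_mass F A = 0"
    using null nu1_nonneg[of A] by (auto simp: null_sets_def ennreal_eq_0_iff)
qed

lemma (in gauss_spectrum) null_control_X:
  assumes Z: "polar_levy_measure M\<^sub>Z F\<^sub>Z" and Y: "polar_levy_measure M\<^sub>Y F\<^sub>Y"
    and null: "A \<in> null_sets (control_X z \<beta> e F\<^sub>Z F\<^sub>Y)"
  shows "nu0 z A = 0" "nu1 \<beta> e A = 0" "jump_mass F\<^sub>Z A = 0" "jump_mass F\<^sub>Y A = 0"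
proof -
  have A: "A \<in> sets sphere_space"
    using null by (auto simp: control_X_def sets_measure_of_sphere)
  have "emeasure (control_X z \<beta> e F\<^sub>Z F\<^sub>Y) A = ennreal (nu0 z A) + ennreal (nu1 \<beta> e A) + jump_mass F\<^sub>Z A + jump_mass F\<^sub>Y A"
    unfolding control_X_def
    by (rule emeasure_measure_of_sphere[where Ns = "[nu0_measure z,
        distr (density (count_space UNIV) (\<lambda>j. ennreal (\<beta> j))) sphere_space e,
        distr (density F\<^sub>Z (\<lambda>w. ennreal (min 1 ((snd w)\<^sup>2)))) sphere_space fst,
        distr (density F\<^sub>Y (\<lambda>w. ennreal (min 1 ((snd w)\<^sup>2)))) sphere_space fst]", OF _ A])
      (auto simp: nu0_eq_emeasure nu1_eq_emeasure polar_levy_measure.jump_mass_eq[OF Z]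
        polar_levy_measure.jump_mass_eq[OF Y] add.assoc)
  then show "nu0 z A = 0" "nu1 \<beta> e A = 0" "jump_mass F\<^sub>Z A = 0" "jump_mass F\<^sub>Y A = 0"
    using null nu0_nonneg[of z A] nu1_nonneg[of A] by (auto simp: null_sets_def ennreal_eq_0_iff)
qed

section \<open>Laws of processes and of their images in the Hilbert space\<close>

lemma l2_coord_to_l2: "summable (\<lambda>n. (x n)\<^sup>2) \<Longrightarrow> l2_coord (to_l2 x) = x"
  by (simp add: to_l2_def Abs_l2_inverse)

lemma l2_coord_unit: "l2_coord (l2_unit n) k = (if k = n then 1 else 0)"
proof -
  have "summable (\<lambda>k. (if k = n then 1 else 0 :: real)\<^sup>2)"
    by (rule summable_finite[of "{n}"]) auto
  then show ?thesis
    unfolding l2_unit_def by (simp add: l2_coord_to_l2)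
qed

lemma inner_l2_unit: "inner (l2_unit n) v = l2_coord v n"
proof -
  have "inner (l2_unit n) v = (\<Sum>k\<in>{n}. l2_coord (l2_unit n) k * l2_coord v k)"
    unfolding inner_l2_def by (rule suminf_finite) (auto simp: l2_coord_unit)
  then show ?thesis by (simp add: l2_coord_unit)
qed

lemma norm_l2_unit: "norm (l2_unit n) = 1"
  by (simp add: norm_eq_sqrt_inner inner_l2_unit l2_coord_unit)

text \<open>
  Pairing with this vector turns a point of \<open>l2\<close> into the linear combination with coefficients \<open>\<theta>\<close> of the
  coordinates divided by \<open>b\<close>: it undoes the normalization of the processes.
\<close>

definition dual_vector :: "(nat \<Rightarrow> real) \<Rightarrow> nat set \<Rightarrow> (nat \<Rightarrow> real) \<Rightarrow> l2" where
  "dual_vector b I \<theta> = (\<Sum>i\<in>I. (\<theta> i * inverse (b i)) *\<^sub>R l2_unit i)"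

lemma inner_dual_vector: "inner (dual_vector b I \<theta>) u = (\<Sum>i\<in>I. \<theta> i * (inverse (b i) * l2_coord u i))"
  by (simp add: dual_vector_def inner_sum_left inner_l2_unit mult.assoc)

lemma measurable_inner_l2: "(\<lambda>v :: l2. inner y v) \<in> borel_measurable borel"
  by (intro borel_measurable_continuous_onI continuous_intros)

lemma expectation_iexp_to_l2:
  assumes U: "process P U" and b: "\<And>n. 0 < b n"
    and W: "(\<lambda>\<omega>. to_l2 (\<lambda>n. b n * U n \<omega>)) \<in> borel_measurable P"
    and sum: "AE \<omega> in P. summable (\<lambda>n. (b n * U n \<omega>)\<^sup>2)"
  shows "(\<integral>\<omega>. iexp (\<Sum>i\<in>I. \<theta> i * U i \<omega>) \<partial>P) =
    (\<integral>\<omega>. iexp (inner (dual_vector b I \<theta>) (to_l2 (\<lambda>n. b n * U n \<omega>))) \<partial>P)"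
proof (rule integral_cong_AE)
  have [measurable]: "U i \<in> borel_measurable P" for i
    using U by (simp add: process_def)
  have [measurable]: "(\<lambda>\<omega>. inner (dual_vector b I \<theta>) (to_l2 (\<lambda>n. b n * U n \<omega>))) \<in> borel_measurable P"
    by (rule measurable_compose[OF W measurable_inner_l2])
  show "(\<lambda>\<omega>. iexp (\<Sum>i\<in>I. \<theta> i * U i \<omega>)) \<in> borel_measurable P"
    "(\<lambda>\<omega>. iexp (inner (dual_vector b I \<theta>) (to_l2 (\<lambda>n. b n * U n \<omega>)))) \<in> borel_measurable P"
    by measurable
  show "AE \<omega> in P. iexp (\<Sum>i\<in>I. \<theta> i * U i \<omega>) = iexp (inner (dual_vector b I \<theta>) (to_l2 (\<lambda>n. b n * U n \<omega>)))"
    using sum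
  proof eventually_elim
    case (elim \<omega>)
    have "inverse (b i) * (b i * U i \<omega>) = U i \<omega>" for i
      using b[of i] by simp
    then have "inner (dual_vector b I \<theta>) (to_l2 (\<lambda>n. b n * U n \<omega>)) = (\<Sum>i\<in>I. \<theta> i * U i \<omega>)"
      by (simp only: inner_dual_vector l2_coord_to_l2[OF elim])
    then show ?case by simp
  qed
qed

lemma measurable_process: "process P U \<Longrightarrow> (\<lambda>\<omega> i. U i \<omega>) \<in> measurable P (Pi\<^sub>M UNIV (\<lambda>_. borel))"
  by (intro measurable_abs_UNIV) (simp add: process_def)

lemma expectation_iexp_process_law:
  assumes U: "process P U"
  shows "(\<integral>\<omega>. iexp (\<Sum>i\<in>I. \<theta> i * U i \<omega>) \<partial>P) = (\<integral>x. iexp (\<Sum>i\<in>I. \<theta> i * x i) \<partial>process_law P U)"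
  unfolding process_law_def by (subst integral_distr[OF measurable_process[OF U]]) auto

lemma process_add: "process P U \<Longrightarrow> process P V \<Longrightarrow> process P (\<lambda>i \<omega>. U i \<omega> + V i \<omega>)"
  unfolding process_def by (intro conjI allI borel_measurable_add) auto

lemma expectation_iexp_independent_sum:
  assumes U: "process P U" and V: "process P V" and ind: "independent_processes P U V"
  shows "(\<integral>\<omega>. iexp (\<Sum>i\<in>I. \<theta> i * (U i \<omega> + V i \<omega>)) \<partial>P) =
    (\<integral>\<omega>. iexp (\<Sum>i\<in>I. \<theta> i * U i \<omega>) \<partial>P) * (\<integral>\<omega>. iexp (\<Sum>i\<in>I. \<theta> i * V i \<omega>) \<partial>P)"
proof -
  interpret prob_space P using U by (simp add: process_def)
  have [measurable]: "U i \<in> borel_measurable P" "V i \<in> borel_measurable P" for i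
    using U V by (simp_all add: process_def)
  define g where "g x = (\<Sum>i\<in>I. \<theta> i * x i)" for x :: "'b \<Rightarrow> real"
  have g: "g \<in> borel_measurable (Pi\<^sub>M UNIV (\<lambda>_. borel))"
    unfolding g_def by measurable
  have "indep_var borel (g \<circ> (\<lambda>\<omega> i. U i \<omega>)) borel (g \<circ> (\<lambda>\<omega> i. V i \<omega>))"
    using ind unfolding independent_processes_def by (rule indep_var_compose[OF _ g g])
  then have "indep_var borel (\<lambda>\<omega>. \<Sum>i\<in>I. \<theta> i * U i \<omega>) borel (\<lambda>\<omega>. \<Sum>i\<in>I. \<theta> i * V i \<omega>)"
    by (simp add: g_def o_def)
  from char_distr_add[OF this, of 1] show ?thesis
    by (simp add: char_def integral_distr distrib_left sum.distrib)
qed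

lemma process_law_independent_sum_cong:
  assumes U: "process P U" and V: "process P V" and V': "process P V'"
    and ind: "independent_processes P U V" and ind': "independent_processes P U V'"
    and law: "process_law P V = process_law P V'"
  shows "process_law P (\<lambda>i \<omega>. U i \<omega> + V i \<omega>) = process_law P (\<lambda>i \<omega>. U i \<omega> + V' i \<omega>)"
  by (intro process_law_eqI_char process_add U V V')
    (simp only: expectation_iexp_independent_sum[OF U V ind] expectation_iexp_independent_sum[OF U V' ind']
      expectation_iexp_process_law[OF V] expectation_iexp_process_law[OF V'] law)

section \<open>Integrals of the scaled coordinate functions\<close>

lemma abs_l2_coord_le: "\<bar>l2_coord u n\<bar> \<le> norm u"
  using Cauchy_Schwarz_ineq2[of "l2_unit n" u] by (simp add: inner_l2_unit norm_l2_unit)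

lemma measurable_l2_coord_sphere:
  assumes "sets \<kappa> = sets sphere_space"
  shows "(\<lambda>u. inverse (b n) * l2_coord u n) \<in> borel_measurable \<kappa>"
proof -
  have "(\<lambda>u. inverse (b n) * l2_coord u n) \<in> borel_measurable sphere_space"
    unfolding inner_l2_unit[symmetric] sphere_space_def
    by (intro measurable_restrict_space1 borel_measurable_times borel_measurable_const measurable_inner_l2)
  then show ?thesis
    by (simp add: measurable_cong_sets[OF assms refl])
qed

locale sphere_integrator = random_integrator \<kappa> E P \<Lambda>
  for \<kappa> :: "l2 measure" and E and P :: "'a measure" and \<Lambda> +
  fixes b :: "nat \<Rightarrow> real"
  assumes sets_\<kappa>: "sets \<kappa> = sets sphere_space"
begin

lemma space_\<kappa>: "space \<kappa> = unit_sphere"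
  using sets_eq_imp_space_eq[OF sets_\<kappa>] by (simp add: space_sphere_space)

lemma unit_sphere_sets: "unit_sphere \<in> sets \<kappa>"
  using sets.top[of \<kappa>] by (simp add: space_\<kappa>)

lemma coordinate_bounded: "u \<in> space \<kappa> \<Longrightarrow> \<bar>inverse (b n) * l2_coord u n\<bar> \<le> \<bar>inverse (b n)\<bar>"
  using abs_l2_coord_le[of u n] mult_left_mono[of "\<bar>l2_coord u n\<bar>" 1 "\<bar>inverse (b n)\<bar>"]
  by (simp add: space_\<kappa> abs_mult)

lemmas coordinate_measurable = measurable_l2_coord_sphere[OF sets_\<kappa>, of b]

definition coordinate_integral :: "nat \<Rightarrow> 'a \<Rightarrow> real" where
  "coordinate_integral n = rm_integral \<kappa> P \<Lambda> unit_sphere (\<lambda>u. inverse (b n) * l2_coord u n)"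

lemma rm_integrable_coordinate: "rm_integrable \<kappa> P \<Lambda> (\<lambda>u. inverse (b n) * l2_coord u n)"
  by (rule rm_integrable_bounded[OF coordinate_measurable coordinate_bounded])

lemma process_coordinate_integral: "process P coordinate_integral"
  unfolding process_def coordinate_integral_def
  using measurable_rm_integral_bounded[OF coordinate_measurable coordinate_bounded unit_sphere_sets]
  by (simp add: prob_space_axioms)

lemma expectation_iexp_coordinate_integral:
  assumes "finite I"
  shows "(\<integral>\<omega>. iexp (\<Sum>i\<in>I. \<theta> i * coordinate_integral i \<omega>) \<partial>P) = exp (E (\<lambda>u. inner (dual_vector b I \<theta>) u))"
  unfolding coordinate_integral_def inner_dual_vector space_\<kappa>[symmetric]
  by (rule expectation_iexp_rm_integral[OF assms coordinate_measurable coordinate_bounded])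

end

lemma random_measure_cong_sets: "sets S = sets T \<Longrightarrow> random_measure S P \<Lambda> \<longleftrightarrow> random_measure T P \<Lambda>"
  by (simp add: random_measure_def)

lemma trunc_jump_kernel: "iexp (\<theta> * x) - 1 - \<i> * of_real (\<theta> * trunc x) = jump_kernel \<theta> x"
  by (simp add: jump_kernel_def)

lemma (in polar_levy_measure) sphere_integrator_Y:
  assumes \<Lambda>: "ID_random_measure sphere_space P \<Lambda> (\<lambda>A. - nu0 z A) (\<lambda>_. 0) (radial_measure F)"
  shows "sphere_integrator (control_Y z F) (\<lambda>h. - \<i> * drift_exponent z h + jump_exponent h) P \<Lambda>"
proof (intro sphere_integrator.intro random_integrator.intro random_integrator_axioms.intro sphere_integrator_axioms.intro)
  show sets: "sets (control_Y z F) = sets sphere_space"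
    by (simp add: control_Y_def sets_measure_of_sphere)
  show "exponent_functional (control_Y z F) (\<lambda>h. - \<i> * drift_exponent z h + jump_exponent h)"
    by (intro exponent_functional_plus exponent_functional.exponent_functional_scale
        exponent_functional_drift exponent_functional_jump sets null_control_Y)
  show "prob_space P"
    using \<Lambda> by (simp add: ID_random_measure_def random_measure_def)
  show "random_measure (control_Y z F) P \<Lambda>"
    using \<Lambda> by (simp add: ID_random_measure_def random_measure_cong_sets[OF sets])
  fix A t assume "A \<in> sets (control_Y z F)"
  then have A: "A \<in> sets sphere_space" by (simp add: sets)
  then show "char (distr P borel (\<Lambda> A)) t =
      exp (- \<i> * drift_exponent z (\<lambda>u. t * indicator A u) + jump_exponent (\<lambda>u. t * indicator A u))"
    using \<Lambda> unfolding ID_random_measure_def trunc_jump_kernel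
    by (simp add: integral_jump_kernel_radial(2)[OF A] drift_exponent_indicator)
qed

lemma (in gauss_spectrum) sphere_integrator_Z:
  assumes polar: "polar_levy_measure M F"
    and \<Lambda>: "ID_random_measure sphere_space P \<Lambda> (\<lambda>_. 0) (nu1 \<beta> e) (radial_measure F)"
  shows "sphere_integrator (control_Z \<beta> e F)
    (\<lambda>h. - 1 / 2 * gauss_exponent \<beta> e h + polar_levy_measure.jump_exponent F h) P \<Lambda>"
proof (intro sphere_integrator.intro random_integrator.intro random_integrator_axioms.intro sphere_integrator_axioms.intro)
  interpret polar_levy_measure M F by fact
  show sets: "sets (control_Z \<beta> e F) = sets sphere_space"
    by (simp add: control_Z_def sets_measure_of_sphere)
  show "exponent_functional (control_Z \<beta> e F) (\<lambda>h. - 1 / 2 * gauss_exponent \<beta> e h + jump_exponent h)"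
    by (intro exponent_functional_plus exponent_functional.exponent_functional_scale
        exponent_functional_gauss exponent_functional_jump sets null_control_Z[OF polar])
  show "prob_space P"
    using \<Lambda> by (simp add: ID_random_measure_def random_measure_def)
  show "random_measure (control_Z \<beta> e F) P \<Lambda>"
    using \<Lambda> by (simp add: ID_random_measure_def random_measure_cong_sets[OF sets])
  fix A t assume "A \<in> sets (control_Z \<beta> e F)"
  then have A: "A \<in> sets sphere_space" by (simp add: sets)
  then show "char (distr P borel (\<Lambda> A)) t =
      exp (- 1 / 2 * gauss_exponent \<beta> e (\<lambda>u. t * indicator A u) + jump_exponent (\<lambda>u. t * indicator A u))"
    using \<Lambda> unfolding ID_random_measure_def trunc_jump_kernel
    by (simp add: integral_jump_kernel_radial(2)[OF A] gauss_exponent_indicator)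
qed

text \<open>
  The exponent for \<open>X\<close> is the exponent for \<open>Z\<close> minus the exponent for \<open>Y\<close>; for the jump part this is
  the splitting of the integral against the quasi-Levy type measure.
\<close>

lemma (in gauss_spectrum) sphere_integrator_X:
  assumes Z: "polar_levy_measure M\<^sub>Z F\<^sub>Z" and Y: "polar_levy_measure M\<^sub>Y F\<^sub>Y"
    and \<Lambda>: "QID_random_measure sphere_space P \<Lambda> (nu0 z) (nu1 \<beta> e) (radial_difference F\<^sub>Z F\<^sub>Y)"
  shows "sphere_integrator (control_X z \<beta> e F\<^sub>Z F\<^sub>Y)
    (\<lambda>h. \<i> * drift_exponent z h + (- 1 / 2 * gauss_exponent \<beta> e h +
      (polar_levy_measure.jump_exponent F\<^sub>Z h + - 1 * polar_levy_measure.jump_exponent F\<^sub>Y h))) P \<Lambda>"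
proof (intro sphere_integrator.intro random_integrator.intro random_integrator_axioms.intro sphere_integrator_axioms.intro)
  interpret Z: polar_levy_measure M\<^sub>Z F\<^sub>Z by fact
  interpret Y: polar_levy_measure M\<^sub>Y F\<^sub>Y by fact
  let ?\<kappa> = "control_X z \<beta> e F\<^sub>Z F\<^sub>Y"
  show sets: "sets ?\<kappa> = sets sphere_space"
    by (simp add: control_X_def sets_measure_of_sphere)
  show "exponent_functional ?\<kappa> (\<lambda>h. \<i> * drift_exponent z h + (- 1 / 2 * gauss_exponent \<beta> e h +
      (Z.jump_exponent h + - 1 * Y.jump_exponent h)))"
    by (intro exponent_functional_plus exponent_functional.exponent_functional_scale
        exponent_functional_drift exponent_functional_gauss Z.exponent_functional_jump
        Y.exponent_functional_jump sets null_control_X[OF Z Y])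
  show "prob_space P"
    using \<Lambda> by (simp add: QID_random_measure_def random_measure_def)
  show "random_measure ?\<kappa> P \<Lambda>"
    using \<Lambda> by (simp add: QID_random_measure_def random_measure_cong_sets[OF sets])
  fix A t assume "A \<in> sets ?\<kappa>"
  then have A: "A \<in> sets sphere_space" by (simp add: sets)
  have "signed_integral borel norm (radial_difference F\<^sub>Z F\<^sub>Y A) (jump_kernel t) =
      Z.jump_exponent (\<lambda>u. t * indicator A u) - Y.jump_exponent (\<lambda>u. t * indicator A u)"
    unfolding radial_difference_def[abs_def] Z.integral_jump_kernel_radial(2)[OF A, symmetric]
      Y.integral_jump_kernel_radial(2)[OF A, symmetric]
    by (intro signed_integral_levy_difference Z.levy_measure_radial Y.levy_measure_radial A
        Z.integral_jump_kernel_radial(1) Y.integral_jump_kernel_radial(1))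
  note signed = this
  have "char (distr P borel (\<Lambda> A)) t = exp (\<i> * of_real (t * nu0 z A) - of_real (t\<^sup>2 / 2 * nu1 \<beta> e A) +
      signed_integral borel norm (radial_difference F\<^sub>Z F\<^sub>Y A) (jump_kernel t))"
    using \<Lambda> A unfolding QID_random_measure_def trunc_jump_kernel by blast
  also have "\<dots> = exp (\<i> * drift_exponent z (\<lambda>u. t * indicator A u) + (- 1 / 2 * gauss_exponent \<beta> e (\<lambda>u. t * indicator A u) +
      (Z.jump_exponent (\<lambda>u. t * indicator A u) + - 1 * Y.jump_exponent (\<lambda>u. t * indicator A u))))"
    unfolding signed gauss_exponent_indicator drift_exponent_indicator
    by (rule arg_cong[where f = exp]) simp
  finally show "char (distr P borel (\<Lambda> A)) t =
      exp (\<i> * drift_exponent z (\<lambda>u. t * indicator A u) + (- 1 / 2 * gauss_exponent \<beta> e (\<lambda>u. t * indicator A u) +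
      (Z.jump_exponent (\<lambda>u. t * indicator A u) + - 1 * Y.jump_exponent (\<lambda>u. t * indicator A u))))" .
qed

section \<open>The spectral representation\<close>

theorem theorem7p20:
  fixes P :: "'a measure" and P\<^sub>Z :: "'b measure" and Q\<^sub>Z :: "'c measure" and Q :: "'d measure"
    and X Y :: "nat \<Rightarrow> 'a \<Rightarrow> real" and Z :: "nat \<Rightarrow> 'b \<Rightarrow> real"
    and b :: "nat \<Rightarrow> real"
    and z0 :: l2 and K :: "l2 \<Rightarrow> l2" and M\<^sub>Y M\<^sub>Z :: "l2 measure"
    and \<beta> :: "nat \<Rightarrow> real" and e :: "nat \<Rightarrow> l2"
    and F\<^sub>Y F\<^sub>Z :: "(l2 \<times> real) measure"
    and \<Lambda>\<^sub>Y :: "l2 set \<Rightarrow> 'a \<Rightarrow> real" and \<Lambda>\<^sub>Z :: "l2 set \<Rightarrow> 'c \<Rightarrow> real"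
    and \<Lambda> :: "l2 set \<Rightarrow> 'd \<Rightarrow> real"
    and f :: "nat \<Rightarrow> l2 \<Rightarrow> real"
    and \<kappa>\<^sub>Y \<kappa>\<^sub>Z \<kappa> :: "l2 measure"
  assumes X: "QID_process P X" and Y: "ID_process P Y" and Z: "ID_process P\<^sub>Z Z"
    and generate: "generate P X Y P\<^sub>Z Z"
    and b_pos: "\<And>n. 0 < b n"
    and l2_X: "AE \<omega> in P. summable (\<lambda>n. (b n * X n \<omega>)\<^sup>2)"
    and l2_Y: "AE \<omega> in P. summable (\<lambda>n. (b n * Y n \<omega>)\<^sup>2)"
    and l2_Z: "AE \<omega> in P\<^sub>Z. summable (\<lambda>n. (b n * Z n \<omega>)\<^sup>2)"
    and triplet_Z: "has_triplet P\<^sub>Z (\<lambda>\<omega>. to_l2 (\<lambda>n. b n * Z n \<omega>)) 0 K M\<^sub>Z"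
    and triplet_Y: "has_triplet P (\<lambda>\<omega>. to_l2 (\<lambda>n. b n * Y n \<omega>)) (- z0) (\<lambda>_. 0) M\<^sub>Y"
    and \<beta>_nonneg: "\<And>j. 0 \<le> \<beta> j" and \<beta>_summable: "summable \<beta>"
    and e_orthonormal: "\<And>i j. inner (e i) (e j) = (if i = j then 1 else 0)"
    and K_spectral: "\<And>y. (\<lambda>j. (\<beta> j * inner (e j) y) *\<^sub>R e j) sums K y"
    and F\<^sub>Z: "polar_measure M\<^sub>Z F\<^sub>Z" and F\<^sub>Y: "polar_measure M\<^sub>Y F\<^sub>Y"
    and f_def: "f = (\<lambda>n u. inverse (b n) * l2_coord u n)"
    and \<kappa>\<^sub>Y_def: "\<kappa>\<^sub>Y = control_Y z0 F\<^sub>Y"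
    and \<kappa>\<^sub>Z_def: "\<kappa>\<^sub>Z = control_Z \<beta> e F\<^sub>Z"
    and \<kappa>_def: "\<kappa> = control_X z0 \<beta> e F\<^sub>Z F\<^sub>Y"
  shows
    "(ID_random_measure sphere_space P \<Lambda>\<^sub>Y (\<lambda>A. - nu0 z0 A) (\<lambda>_. 0) (radial_measure F\<^sub>Y) \<and>
      ID_random_measure sphere_space Q\<^sub>Z \<Lambda>\<^sub>Z (\<lambda>_. 0) (nu1 \<beta> e) (radial_measure F\<^sub>Z) \<longrightarrow>
        (\<forall>n. rm_integrable \<kappa>\<^sub>Y P \<Lambda>\<^sub>Y (f n)) \<and> (\<forall>n. rm_integrable \<kappa>\<^sub>Z Q\<^sub>Z \<Lambda>\<^sub>Z (f n)) \<and>
        (independent_processes P X (\<lambda>n. rm_integral \<kappa>\<^sub>Y P \<Lambda>\<^sub>Y unit_sphere (f n)) \<longrightarrow>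
          process_law P (\<lambda>n \<omega>. X n \<omega> + rm_integral \<kappa>\<^sub>Y P \<Lambda>\<^sub>Y unit_sphere (f n) \<omega>) =
          process_law Q\<^sub>Z (\<lambda>n. rm_integral \<kappa>\<^sub>Z Q\<^sub>Z \<Lambda>\<^sub>Z unit_sphere (f n)))) \<and>
     (QID_random_measure sphere_space Q \<Lambda> (nu0 z0) (nu1 \<beta> e) (radial_difference F\<^sub>Z F\<^sub>Y) \<longrightarrow>
        (\<forall>n. rm_integrable \<kappa> Q \<Lambda> (f n)) \<and>
        process_law P X = process_law Q (\<lambda>n. rm_integral \<kappa> Q \<Lambda> unit_sphere (f n)))"
proof -
  have f_eq: "f n = (\<lambda>u. inverse (b n) * l2_coord u n)" for n
    by (simp add: f_def)
  have pX: "process P X" and pY: "process P Y" and pZ: "process P\<^sub>Z Z"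
    using X Y Z by (simp_all add: QID_process_def ID_process_def)
  interpret PZ: polar_levy_measure M\<^sub>Z F\<^sub>Z
    using triplet_Z F\<^sub>Z by (simp add: polar_levy_measure_def has_triplet_def)
  interpret PY: polar_levy_measure M\<^sub>Y F\<^sub>Y
    using triplet_Y F\<^sub>Y by (simp add: polar_levy_measure_def has_triplet_def)
  interpret gauss_spectrum \<beta> e
    using \<beta>_nonneg \<beta>_summable e_orthonormal by unfold_locales simp_all
  have char_Y: "(\<integral>\<omega>. iexp (\<Sum>i\<in>I. \<theta> i * Y i \<omega>) \<partial>P) =
      exp (- \<i> * drift_exponent z0 (inner (dual_vector b I \<theta>)) + PY.jump_exponent (inner (dual_vector b I \<theta>)))" for I \<theta>
    using triplet_Y unfolding has_triplet_def PY.jump_exponent_inner drift_exponent_inner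
    by (subst expectation_iexp_to_l2[OF pY b_pos _ l2_Y]) simp_all
  have char_Z: "(\<integral>\<omega>. iexp (\<Sum>i\<in>I. \<theta> i * Z i \<omega>) \<partial>P\<^sub>Z) =
      exp (- 1 / 2 * gauss_exponent \<beta> e (inner (dual_vector b I \<theta>)) + PZ.jump_exponent (inner (dual_vector b I \<theta>)))" for I \<theta>
    using triplet_Z unfolding has_triplet_def PZ.jump_exponent_inner gauss_exponent_inner[OF K_spectral]
    by (subst expectation_iexp_to_l2[OF pZ b_pos _ l2_Z]) simp_all
  have ind_XY: "independent_processes P X Y"
    and law_XY: "process_law P (\<lambda>i \<omega>. X i \<omega> + Y i \<omega>) = process_law P\<^sub>Z Z"
    using generate by (simp_all add: generate_def)
  have first: "(\<forall>n. rm_integrable \<kappa>\<^sub>Y P \<Lambda>\<^sub>Y (f n)) \<and> (\<forall>n. rm_integrable \<kappa>\<^sub>Z Q\<^sub>Z \<Lambda>\<^sub>Z (f n)) \<and>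
      (independent_processes P X (\<lambda>n. rm_integral \<kappa>\<^sub>Y P \<Lambda>\<^sub>Y unit_sphere (f n)) \<longrightarrow>
        process_law P (\<lambda>n \<omega>. X n \<omega> + rm_integral \<kappa>\<^sub>Y P \<Lambda>\<^sub>Y unit_sphere (f n) \<omega>) =
        process_law Q\<^sub>Z (\<lambda>n. rm_integral \<kappa>\<^sub>Z Q\<^sub>Z \<Lambda>\<^sub>Z unit_sphere (f n)))"
    if \<Lambda>\<^sub>Y: "ID_random_measure sphere_space P \<Lambda>\<^sub>Y (\<lambda>A. - nu0 z0 A) (\<lambda>_. 0) (radial_measure F\<^sub>Y)"
      and \<Lambda>\<^sub>Z: "ID_random_measure sphere_space Q\<^sub>Z \<Lambda>\<^sub>Z (\<lambda>_. 0) (nu1 \<beta> e) (radial_measure F\<^sub>Z)"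
  proof -
    interpret IY: sphere_integrator \<kappa>\<^sub>Y "\<lambda>h. - \<i> * drift_exponent z0 h + PY.jump_exponent h" P \<Lambda>\<^sub>Y b
      unfolding \<kappa>\<^sub>Y_def by (rule PY.sphere_integrator_Y[OF \<Lambda>\<^sub>Y])
    interpret IZ: sphere_integrator \<kappa>\<^sub>Z "\<lambda>h. - 1 / 2 * gauss_exponent \<beta> e h + PZ.jump_exponent h" Q\<^sub>Z \<Lambda>\<^sub>Z b
      unfolding \<kappa>\<^sub>Z_def by (rule sphere_integrator_Z[OF PZ.polar_levy_measure_axioms \<Lambda>\<^sub>Z])
    have law_Y: "process_law P Y = process_law P IY.coordinate_integral"
      by (rule process_law_eqI_char[OF pY IY.process_coordinate_integral])
        (simp only: char_Y IY.expectation_iexp_coordinate_integral)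
    have law_Z: "process_law P\<^sub>Z Z = process_law Q\<^sub>Z IZ.coordinate_integral"
      by (rule process_law_eqI_char[OF pZ IZ.process_coordinate_integral])
        (simp only: char_Z IZ.expectation_iexp_coordinate_integral)
    have "process_law P (\<lambda>n \<omega>. X n \<omega> + IY.coordinate_integral n \<omega>) = process_law Q\<^sub>Z IZ.coordinate_integral"
      if "independent_processes P X IY.coordinate_integral"
      using process_law_independent_sum_cong[OF pX pY IY.process_coordinate_integral ind_XY that law_Y]
        law_XY law_Z by simp
    then show ?thesis
      using IY.rm_integrable_coordinate IZ.rm_integrable_coordinate
      by (simp add: f_eq IY.coordinate_integral_def[abs_def] IZ.coordinate_integral_def[abs_def])
  qed
  have second: "(\<forall>n. rm_integrable \<kappa> Q \<Lambda> (f n)) \<and>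
      process_law P X = process_law Q (\<lambda>n. rm_integral \<kappa> Q \<Lambda> unit_sphere (f n))"
    if \<Lambda>: "QID_random_measure sphere_space Q \<Lambda> (nu0 z0) (nu1 \<beta> e) (radial_difference F\<^sub>Z F\<^sub>Y)"
  proof -
    interpret I: sphere_integrator \<kappa> "\<lambda>h. \<i> * drift_exponent z0 h + (- 1 / 2 * gauss_exponent \<beta> e h +
      (PZ.jump_exponent h + - 1 * PY.jump_exponent h))" Q \<Lambda> b
      unfolding \<kappa>_def
      by (rule sphere_integrator_X[OF PZ.polar_levy_measure_axioms PY.polar_levy_measure_axioms \<Lambda>])
    have "process_law P X = process_law Q I.coordinate_integral"
    proof (rule process_law_eqI_char[OF pX I.process_coordinate_integral])
      fix I :: "nat set" and \<theta> :: "nat \<Rightarrow> real"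
      assume fin: "finite I"
      let ?y = "inner (dual_vector b I \<theta>)"
      have "(\<integral>\<omega>. iexp (\<Sum>i\<in>I. \<theta> i * X i \<omega>) \<partial>P) * (\<integral>\<omega>. iexp (\<Sum>i\<in>I. \<theta> i * Y i \<omega>) \<partial>P) =
          (\<integral>\<omega>. iexp (\<Sum>i\<in>I. \<theta> i * Z i \<omega>) \<partial>P\<^sub>Z)"
        unfolding expectation_iexp_independent_sum[OF pX pY ind_XY, symmetric]
          expectation_iexp_process_law[OF process_add[OF pX pY]] law_XY expectation_iexp_process_law[OF pZ] ..
      \<comment> \<open>The characteristic function of \<open>Y\<close> has no zeros, so it may be divided out.\<close>
      then have "(\<integral>\<omega>. iexp (\<Sum>i\<in>I. \<theta> i * X i \<omega>) \<partial>P) =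
          exp (- 1 / 2 * gauss_exponent \<beta> e ?y + PZ.jump_exponent ?y) /
          exp (- \<i> * drift_exponent z0 ?y + PY.jump_exponent ?y)"
        unfolding char_Y char_Z by (simp add: field_simps)
      also have "\<dots> = exp (\<i> * drift_exponent z0 ?y + (- 1 / 2 * gauss_exponent \<beta> e ?y +
          (PZ.jump_exponent ?y + - 1 * PY.jump_exponent ?y)))"
        unfolding exp_diff[symmetric] by (rule arg_cong[where f = exp]) (simp add: algebra_simps)
      also have "\<dots> = (\<integral>\<omega>. iexp (\<Sum>i\<in>I. \<theta> i * I.coordinate_integral i \<omega>) \<partial>Q)"
        by (rule I.expectation_iexp_coordinate_integral[OF fin, symmetric])
      finally show "(\<integral>\<omega>. iexp (\<Sum>i\<in>I. \<theta> i * X i \<omega>) \<partial>P) =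
          (\<integral>\<omega>. iexp (\<Sum>i\<in>I. \<theta> i * I.coordinate_integral i \<omega>) \<partial>Q)" .
    qed
    then show ?thesis
      using I.rm_integrable_coordinate by (simp add: f_eq I.coordinate_integral_def[abs_def])
  qed
  show ?thesis
    using first second by blast
qed

end
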